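(* For all $(n,m)\in\mathbb{Z}^2$ and all $\xi\in(-\infty,\infty)$, $${\rm P}_{-\frac34-m}^{-\frac13-n}(\tanh\xi)=\left[2^{5/4-2m-3n}\,3^{-3/8}\left(\tfrac14\right)_m\left(\tfrac{13}{12}\right)_{m+n}^{-1}\Gamma(\tfrac43)^{-1}\right](\cosh\xi)^{1/4-m}$$ $$\qquad\times\Bigl[-(-1)^n\sqrt{\sqrt3-1}\;C_+^{1/4+3m+3n}\,r^m_n(-C_-/C_+)+(-1)^m\sqrt{\sqrt3+1}\;C_-^{1/4+3m+3n}\,r^m_n(-C_+/C_-)\Bigr],$$ $${\rm P}_{-\frac34-m}^{\frac13+n}(\tanh\xi)=\left[(-1)^n2^{-1/4-2m-3n}\,3^{-3/8}\left(\tfrac14\right)_m\left(\tfrac{5}{12}\right)_{m-n}^{-1}\Gamma(\tfrac23)^{-1}\right](\cosh\xi)^{1/4-m}$$ $$\qquad\times\Bigl[(-1)^n\sqrt{\sqrt3+1}\;C_+^{1/4+3m+3n}\,r^m_n(-C_-/C_+)+(-1)^m\sqrt{\sqrt3-1}\;C_-^{1/4+3m+3n}\,r^m_n(-C_+/C_-)\Bigr],$$ where ${\rm P}_\nu^\mu$ is the Ferrers function of the first kind, $r^m_n$ are the octahedral functions defined in the context, and $C_\pm=C_\pm(\xi)=\pm\sinh(\xi/3)+\sqrt{\frac{4\sinh^2(\xi/3)+1}{3}}>0$.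
   Context: For $z\in(-1,1)$, the Ferrers function is ${\rm P}_\nu^\mu(z)=\frac1{\Gamma(1-\mu)}\left(\frac{1+z}{1-z}\right)^{\mu/2}{}_2F_1\!\left(-\nu,\nu+1;1-\mu;\frac{1-z}2\right)$, with ${}_2F_1$ the Gauss function. The rising factorial is extended to all integers $k$: $(d)_k=d(d+1)\cdots(d+k-1)$ for $k\ge0$ and $(d)_k=[(d-k')\cdots(d-1)]^{-1}$ for $k=-k'\le0$. Octahedral functions: let $p_{\rm v}(u)=u(1-u)^4$, $p_{\rm e}(u)=(1+u)(1-34u+u^2)$, $p_{\rm f}(u)=1+14u+u^2$, and $R(u)=-108\,p_{\rm v}(u)/p_{\rm e}(u)^2=1-p_{\rm f}(u)^3/p_{\rm e}(u)^2$. For $(n,m)\in\mathbb{Z}^2$, $r^m_n$ is the rational function of $u$ that on a neighborhood of $u=0$ satisfies $${}_2F_1\!\left(-\tfrac1{24}-\tfrac m2-\tfrac n2,\ \tfrac{11}{24}-\tfrac m2-\tfrac n2;\ \tfrac34-m;\ R(u)\right)=p_{\rm e}(u)^{-1/12-m-n}\,r^m_n(u)$$ (with powers of $p_{\rm e}(u)$ equal to $1$ at $u=0$). *)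

theory Defs
  imports
    "HOL-Analysis.Analysis"
    "HOL-Computational_Algebra.Computational_Algebra"
    "HOL-Computational_Algebra.Field_as_Ring"
begin

(* The series definition suffices: below, the argument always lies in the open unit disk.
   The parameter c must not be a nonpositive integer. *)
definition hyp2F1 :: "real \<Rightarrow> real \<Rightarrow> real \<Rightarrow> real \<Rightarrow> real" where
  "hyp2F1 a b c z = eval_fps (fps_hypergeo [a, b] [c] 1) z"

(* Meaningful for -1 < z < 1 and 1 - \<mu> not a nonpositive integer. *)
definition ferrers_P :: "real \<Rightarrow> real \<Rightarrow> real \<Rightarrow> real" where
  "ferrers_P \<nu> \<mu> z =
     1 / Gamma (1 - \<mu>) * ((1 + z) / (1 - z)) powr (\<mu> / 2)
       * hyp2F1 (- \<nu>) (\<nu> + 1) (1 - \<mu>) ((1 - z) / 2)"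

(* For k = -k' < 0 this is 1 / ((d - k') \<dots> (d - 1)). *)
definition rising :: "real \<Rightarrow> int \<Rightarrow> real" where
  "rising d k =
     (if k \<ge> 0 then pochhammer d (nat k)
      else inverse (pochhammer (d - real (nat (- k))) (nat (- k))))"

definition oct_pv :: "real \<Rightarrow> real" where
  "oct_pv u = u * (1 - u) ^ 4"

definition oct_pe :: "real \<Rightarrow> real" where
  "oct_pe u = (1 + u) * (1 - 34 * u + u ^ 2)"

definition oct_pf :: "real \<Rightarrow> real" where
  "oct_pf u = 1 + 14 * u + u ^ 2"

definition oct_R :: "real \<Rightarrow> real" where
  "oct_R u = - 108 * oct_pv u / oct_pe u ^ 2"

lemma oct_R_alt: "oct_pe u \<noteq> 0 \<Longrightarrow> oct_R u = 1 - oct_pf u ^ 3 / oct_pe u ^ 2"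
proof -
  assume nz: "oct_pe u \<noteq> 0"
  have "- 108 * oct_pv u = oct_pe u ^ 2 - oct_pf u ^ 3"
    unfolding oct_pv_def oct_pe_def oct_pf_def by algebra
  then show ?thesis
    using nz by (simp add: oct_R_def diff_divide_distrib)
qed

(* Evaluation of a rational function, in lowest terms; a pole is sent to 0. *)
definition eval_ratfun :: "real poly fract \<Rightarrow> real \<Rightarrow> real" where
  "eval_ratfun r u = (case quot_of_fract r of (p, q) \<Rightarrow> poly p u / poly q u)"

(* oct_r n m is the octahedral function with lower index n and upper index m.
   Since oct_pe 0 = 1, the real power used here is the branch equal to 1 at u = 0. *)
definition oct_r :: "int \<Rightarrow> int \<Rightarrow> real poly fract" where
  "oct_r n m = (THE r. \<forall>\<^sub>F u in nhds 0.
     hyp2F1 (- 1 / 24 - of_int m / 2 - of_int n / 2) (11 / 24 - of_int m / 2 - of_int n / 2)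
         (3 / 4 - of_int m) (oct_R u)
       = oct_pe u powr (- 1 / 12 - of_int m - of_int n) * eval_ratfun r u)"

definition C_plus :: "real \<Rightarrow> real" where
  "C_plus \<xi> = sinh (\<xi> / 3) + sqrt ((4 * sinh (\<xi> / 3) ^ 2 + 1) / 3)"

definition C_minus :: "real \<Rightarrow> real" where
  "C_minus \<xi> = - sinh (\<xi> / 3) + sqrt ((4 * sinh (\<xi> / 3) ^ 2 + 1) / 3)"

end

theory Submission
  imports Defs "HOL-Real_Asymp.Real_Asymp"
begin

text \<open>
  Put \<open>u = -C_- / C_+\<close>. Then \<open>cosh \<xi>\<close>, \<open>sinh \<xi>\<close> and all derivatives become algebraic in \<open>u\<close> and
  \<open>C_+\<close>: \<open>C_+\<^sup>2 p\<^sub>f(u) = -4\<close>, \<open>C_+\<^sup>3 p\<^sub>e(u) = 8 sinh \<xi>\<close>, \<open>16 cosh\<^sup>2 \<xi> = -27 C_+\<^sup>6 p\<^sub>v(u)\<close>.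
  The first order ladder operators that shift \<open>n\<close> or \<open>m\<close> by \<open>1\<close> exist for the Gauss function
  (by contiguity) and for the Ferrers functions, and expressed through \<open>u\<close> both act on the rational
  factor \<open>r\<close> by the same formulas. So both sides of the theorem and the defining equation of \<open>r\<close> are transported
  together over the lattice of pairs \<open>(n, m)\<close>, starting from \<open>n = m = 0\<close>, where \<open>r = 1\<close>. There the Gauss
  function is identified by its differential equation in \<open>u\<close>, whose second solution is not differentiable at \<open>0\<close>, and the
  Ferrers functions are identified among the solutions of Legendre's equation by two terms of the
  expansion as \<open>\<xi> \<rightarrow> \<infinity>\<close>, by means of Wronskians.
\<close>

section \<open>Contiguity relations of the Gauss function\<close>

text \<open>The equation that defines r lives near u = 0, while the theorem evaluates r at negative
  u with \<open>oct_pf u < 0\<close>, a range whose closure misses 0. Only rationality connects the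
  two places. Hence one function is carried along which satisfies the equation near 0, represents
  the Ferrers functions on the whole line, and has poles at most at the zeros of
  \<open>oct_den\<close>, which that range avoids. Every lattice direction is open because each
  ladder coefficient is, up to a constant factor, built from numbers j/12 plus an integer with j not
  divisible by 12, so none vanishes. Second derivatives are never formed: an operator and the one
  that undoes it make up a first order system that replaces the second order equation. Reflection of
  \<xi> exchanges C_+ and C_-, so the second term of each formula is the reflected first one. The
  ladder operators in \<xi> anticommute with reflection, which is the source of the signs (-1)^n and
  (-1)^m.\<close>

lemma fps_hypergeo21_nth:
  "fps_hypergeo [a, b] [c] 1 $ n = pochhammer a n * pochhammer b n / (pochhammer c n * fact n)"
  for a b c :: real
  by simp

lemma fps_hypergeo21_Suc:
  fixes a b c :: real
  assumes "c + real n \<noteq> 0"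
  shows "real (Suc n) * fps_hypergeo [a, b] [c] 1 $ Suc n
    = (a + real n) * (b + real n) / (c + real n) * fps_hypergeo [a, b] [c] 1 $ n"
proof -
  have "real (Suc n) \<noteq> 0" by simp
  then show ?thesis
    using assms unfolding fps_hypergeo21_nth pochhammer_Suc fact_Suc of_nat_mult
    by (simp add: divide_simps del: of_nat_Suc)
qed

lemma not_nonpos_Int_add_nat:
  fixes c :: real
  assumes "c \<notin> \<int>\<^sub>\<le>\<^sub>0"
  shows "c + real n \<noteq> 0"
proof
  assume "c + real n = 0"
  then have "c = - of_nat n" by simp
  then show False using assms by simp
qed

text \<open>The ratio test needs nonzero coefficients. A vanishing coefficient forces all later ones
  to vanish by the recurrence, and the series is then a polynomial; otherwise the quotients tend to
  1.\<close>

lemma fps_conv_radius_hypergeo21: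
  fixes a b c :: real
  assumes c: "c \<notin> \<int>\<^sub>\<le>\<^sub>0"
  shows "fps_conv_radius (fps_hypergeo [a, b] [c] 1) \<ge> 1"
proof (cases "\<exists>k. fps_hypergeo [a, b] [c] 1 $ k = 0")
  case True
  then obtain k where k: "fps_hypergeo [a, b] [c] 1 $ k = 0" by blast
  have z: "fps_hypergeo [a, b] [c] 1 $ n = 0" if "n \<ge> k" for n
    using that
  proof (induction n rule: dec_induct)
    case (step n)
    then have "real (Suc n) * fps_hypergeo [a, b] [c] 1 $ Suc n = 0"
      unfolding fps_hypergeo21_Suc[OF not_nonpos_Int_add_nat[OF c], of n a b]
      by (simp del: fps_hypergeo_nth)
    then show ?case by (metis mult_eq_0_iff of_nat_eq_0_iff nat.distinct(1))
  qed (use k in auto)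
  have "summable (\<lambda>n. fps_hypergeo [a, b] [c] 1 $ n * 1 ^ n)"
    by (rule summable_finite[of "{..<k}"]) (use z in \<open>auto simp del: fps_hypergeo_nth\<close>)
  then have "conv_radius (fps_nth (fps_hypergeo [a, b] [c] 1)) \<ge> norm (1::real)"
    by (rule conv_radius_geI)
  then show ?thesis by (simp add: fps_conv_radius_def one_ereal_def)
next
  case False
  let ?t = "fps_nth (fps_hypergeo [a, b] [c] 1)"
  have nz: "?t n \<noteq> 0" for n using False by blast
  have rat: "norm (?t n) / norm (?t (Suc n))
      = \<bar>(c + real n) * (1 + real n) / ((a + real n) * (b + real n))\<bar>" for n
  proof -
    have c0: "c + real n \<noteq> 0" by (rule not_nonpos_Int_add_nat[OF c])
    have e: "real (Suc n) * ?t (Suc n) = (a + real n) * (b + real n) / (c + real n) * ?t n"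
      by (rule fps_hypergeo21_Suc[OF c0])
    moreover have "real (Suc n) * ?t (Suc n) \<noteq> 0" using nz[of "Suc n"] by simp
    ultimately have ab: "(a + real n) * (b + real n) \<noteq> 0" by auto
    have "?t n / ?t (Suc n) = (c + real n) * real (Suc n) / ((a + real n) * (b + real n))"
      using e ab c0 nz[of n] nz[of "Suc n"] by (simp add: frac_eq_eq field_simps del: fps_hypergeo_nth of_nat_Suc)
    then show ?thesis by (simp del: fps_hypergeo_nth flip: abs_divide add: add.commute)
  qed
  have "(\<lambda>n. (c + real n) * (1 + real n) / ((a + real n) * (b + real n))) \<longlonglongrightarrow> 1"
    by real_asymp
  then have "(\<lambda>n. \<bar>(c + real n) * (1 + real n) / ((a + real n) * (b + real n))\<bar>) \<longlonglongrightarrow> \<bar>1\<bar>"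
    by (rule tendsto_rabs)
  then have "(\<lambda>n. norm (?t n) / norm (?t (Suc n))) \<longlonglongrightarrow> 1"
    unfolding rat by simp
  then have "(\<lambda>n. ereal (norm (?t n) / norm (?t (Suc n)))) \<longlonglongrightarrow> ereal 1"
    by simp
  then have "conv_radius ?t = ereal 1"
    by (intro conv_radius_ratio_limit_ereal_nonzero) auto
  then show ?thesis by (simp add: fps_conv_radius_def one_ereal_def)
qed

text \<open>The derived series itself, not a Gauss function with raised parameters: its coefficients
  are multiples of those of \<open>hyp2F1 a b c\<close>, so contiguity becomes a comparison of
  coefficients.\<close>

definition hyp2F1_deriv :: "real \<Rightarrow> real \<Rightarrow> real \<Rightarrow> real \<Rightarrow> real" where
  "hyp2F1_deriv a b c z = eval_fps (fps_deriv (fps_hypergeo [a, b] [c] 1)) z"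

lemma has_real_derivative_hyp2F1:
  assumes "c \<notin> \<int>\<^sub>\<le>\<^sub>0" "\<bar>z\<bar> < 1"
  shows "(hyp2F1 a b c has_real_derivative hyp2F1_deriv a b c z) (at z)"
proof -
  have "ereal (norm z) < fps_conv_radius (fps_hypergeo [a, b] [c] 1)"
    using fps_conv_radius_hypergeo21[OF assms(1), of a b] assms(2)
    by (metis ereal_less(3) less_le_trans real_norm_def)
  then show ?thesis
    unfolding hyp2F1_def[abs_def] hyp2F1_deriv_def
    by (intro has_field_derivative_eval_fps) auto
qed

lemma hyp2F1_0 [simp]: "hyp2F1 a b c 0 = 1"
  by (simp add: hyp2F1_def eval_fps_at_0)

lemma hyp2F1_sym: "hyp2F1 a b c z = hyp2F1 b a c z"
proof -
  have "fps_hypergeo [a, b] [c] 1 = fps_hypergeo [b, a] [c] 1"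
    by (rule fps_ext) (simp add: mult.commute)
  then show ?thesis by (simp add: hyp2F1_def)
qed

lemma hyp2F1_deriv_sym: "hyp2F1_deriv a b c z = hyp2F1_deriv b a c z"
proof -
  have "fps_hypergeo [a, b] [c] 1 = fps_hypergeo [b, a] [c] 1"
    by (rule fps_ext) (simp add: mult.commute)
  then show ?thesis by (simp add: hyp2F1_deriv_def)
qed

text \<open>Every contiguity relation below has this shape; it reduces them to a rational identity
  for the two coefficients of degree \<^term>\<open>n\<close> and \<^term>\<open>Suc n\<close>.\<close>

lemma hyp2F1_contiguous:
  fixes a b c a' b' c' K p0 p1 q0 q1 :: real
  assumes c: "c \<notin> \<int>\<^sub>\<le>\<^sub>0" and c': "c' \<notin> \<int>\<^sub>\<le>\<^sub>0" and z: "\<bar>z\<bar> < 1"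
  assumes zero: "K = p0 + q0 * (a * b / c)"
  assumes step: "\<And>n. K * (pochhammer a' (Suc n) * pochhammer b' (Suc n) / (pochhammer c' (Suc n) * fact (Suc n)))
    = (p0 + q1 * real (Suc n)) * T (Suc n) + (p1 + q2 * real n) * T n + q0 * (real n + 2) * T (Suc (Suc n))"
  assumes T: "\<And>n. T n = pochhammer a n * pochhammer b n / (pochhammer c n * fact n)"
  shows "K * hyp2F1 a' b' c' z
    = (q0 + q1 * z + q2 * z\<^sup>2) * hyp2F1_deriv a b c z + (p0 + p1 * z) * hyp2F1 a b c z"
proof -
  define f where "f = fps_hypergeo [a, b] [c] 1"
  define g where "g = fps_hypergeo [a', b'] [c'] 1"
  have fT: "f $ n = T n" for n unfolding f_def T fps_hypergeo21_nth ..
  define Q where "Q = fps_of_poly [:q0, q1, q2:]"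
  define P where "P = fps_of_poly [:p0, p1:]"
  have rad: "ereal (norm z) < fps_conv_radius f" "ereal (norm z) < fps_conv_radius g"
    using fps_conv_radius_hypergeo21[OF c, of a b] fps_conv_radius_hypergeo21[OF c', of a' b'] z
    unfolding f_def g_def by (metis ereal_less(3) less_le_trans real_norm_def)+
  then have radd: "ereal (norm z) < fps_conv_radius (fps_deriv f)"
    using fps_conv_radius_deriv[of f] by (meson less_le_trans)
  have Q: "Q = fps_const q0 + fps_const q1 * fps_X + fps_const q2 * fps_X ^ 2"
    unfolding Q_def by (simp add: fps_of_poly_pCons power2_eq_square algebra_simps)
  have P: "P = fps_const p0 + fps_const p1 * fps_X"
    unfolding P_def by (simp add: fps_of_poly_pCons algebra_simps)
  have "fps_const K * g = Q * fps_deriv f + P * f"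
  proof (rule fps_ext)
    fix n
    show "(fps_const K * g) $ n = (Q * fps_deriv f + P * f) $ n"
    proof (cases n)
      case 0
      have "c \<noteq> 0" using c by auto
      then show ?thesis
        using zero 0 by (simp add: Q P g_def fT T fps_mult_nth_0)
    next
      case (Suc k)
      have "(fps_const K * g) $ n = (p0 + q1 * real (Suc k)) * T (Suc k) + (p1 + q2 * real k) * T k + q0 * (real k + 2) * T (Suc (Suc k))"
        unfolding step[symmetric] unfolding Suc g_def fps_mult_left_const_nth fps_hypergeo21_nth ..
      also have "\<dots> = (Q * fps_deriv f + P * f) $ n"
      \<comment> \<open>The summand with X^2 contributes \<open>k * T k\<close>. In degree 1 this is
        0 because the shift reaches below degree 0, hence the split.\<close>
      proof (cases k)
        case 0
        then show ?thesis unfolding Suc Q P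
          by (simp add: distrib_right fT mult.assoc fps_X_power_mult_nth algebra_simps)
      next
        case (Suc j)
        then show ?thesis unfolding \<open>n = Suc k\<close> Q P
          by (simp add: distrib_right fT mult.assoc fps_X_power_mult_nth fps_X_power_mult_right_nth algebra_simps)
      qed
      finally show ?thesis .
    qed
  qed
  then have "eval_fps (fps_const K * g) z = eval_fps (Q * fps_deriv f + P * f) z" by simp
  moreover have "eval_fps (fps_const K * g) z = K * eval_fps g z"
    using rad by (subst eval_fps_mult) auto
  moreover have "eval_fps (Q * fps_deriv f + P * f) z
      = eval_fps Q z * eval_fps (fps_deriv f) z + eval_fps P z * eval_fps f z"
  proof -
    have "ereal (norm z) < fps_conv_radius (Q * fps_deriv f)" "ereal (norm z) < fps_conv_radius (P * f)"
      using radd rad fps_conv_radius_mult[of Q "fps_deriv f"] fps_conv_radius_mult[of P f]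
      unfolding Q_def P_def by (auto simp: min_def intro: less_le_trans split: if_splits)
    then show ?thesis
      using radd rad by (simp add: eval_fps_add eval_fps_mult Q_def P_def)
  qed
  ultimately show ?thesis
    unfolding hyp2F1_def hyp2F1_deriv_def f_def[symmetric] g_def[symmetric]
    by (simp add: Q_def P_def power2_eq_square algebra_simps)
qed

lemma divide_eq_mult_divide_add:
  fixes D N p B q :: real
  assumes "D \<noteq> 0" "N = p * B + q * D"
  shows "N / D = p * (B / D) + q"
  using assms by (simp add: add_divide_distrib)

text \<open>These are the cancellations of the coefficient identities below, stated over variables
  so that they are matched as a whole and the large Pochhammer terms need not be rearranged.\<close>

lemma fraction_cancel_1: "d \<noteq> 0 \<Longrightarrow> k \<noteq> 0 \<Longrightarrow>
    d * (A * x * (B * y) / (d * P * (m * F))) = k * (x * y) / (k * m) * (A * B / (P * F))"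
  and fraction_cancel_2: "d \<noteq> 0 \<Longrightarrow> K / d * (X * A * B / (C * P / d * F)) = K * X / C * (A * B / (P * F))"
  and fraction_cancel_3: "d \<noteq> 0 \<Longrightarrow>
    K * (y * (A * x) / d * (- d * B) / (P * w * (v * F))) = - K * x * y / (w * v) * (A * B / (P * F))"
  for A B C P F K X d k m v w x y :: real
  by (simp_all add: ac_simps)

lemma fraction_cancel_4: "m \<noteq> 0 \<Longrightarrow> F = k * (A / C) + K \<Longrightarrow>
    F * B = K * B + (0 + 0 * x) + k * m * (A / (C * m)) * B"
  for A B C F K k m x :: real
  by (simp add: distrib_right)

lemma fraction_cancel_5: "d \<noteq> 0 \<Longrightarrow> x * (d - y) / d = x + (-1) * (x * y / d)" for d x y :: real
  by (rule trans[OF divide_eq_mult_divide_add add.commute]) (assumption, algebra)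

lemma fraction_cancel_6: "d \<noteq> 0 \<Longrightarrow> (d - x) * (d - y) / d = d - x - y + 1 * (x * y / d)" for d x y :: real
  by (rule trans[OF divide_eq_mult_divide_add add.commute]) (assumption, algebra)

context
  fixes a b c z :: real
  assumes c: "c \<notin> \<int>\<^sub>\<le>\<^sub>0" and z: "\<bar>z\<bar> < 1"
begin

abbreviation (input) "hyp2F1_term n \<equiv> pochhammer a n * pochhammer b n / (pochhammer c n * fact n)"

abbreviation (input) "hyp2F1_ratio n \<equiv> (a + real n) * (b + real n) / ((c + real n) * (1 + real n))"
abbreviation (input) "hyp2F1_ratio' n \<equiv> (a + (1 + real n)) * (b + (1 + real n)) / ((c + (1 + real n)) * (2 + real n))"

lemma hyp2F1_term_Suc:
  "hyp2F1_term (Suc n) = (a + real n) * (b + real n) / ((c + real n) * (1 + real n)) * hyp2F1_term n"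
  by (simp only: pochhammer_Suc fact_Suc of_nat_mult of_nat_Suc times_divide_times_eq times_divide_eq_right divide_divide_eq_left ac_simps)

lemma c_add_nat: "c + real n \<noteq> 0" "c \<noteq> 0"
  using not_nonpos_Int_add_nat[OF c, of n] not_nonpos_Int_add_nat[OF c, of 0] by auto

text \<open>Consecutive coefficients differ by the factors \<open>hyp2F1_ratio\<close> and
  \<open>hyp2F1_ratio'\<close>. Dividing by the coefficient of degree n removes all Pochhammer
  symbols and leaves a rational identity in n.\<close>

lemma hyp2F1_contiguous_ratio:
  fixes r :: "nat \<Rightarrow> real" and K p0 p1 q0 q1 q2 a' b' c' :: real
  assumes c': "c' \<notin> \<int>\<^sub>\<le>\<^sub>0"
  assumes zero: "K = p0 + q0 * (a * b / c)"
  assumes ratio: "\<And>n. K * (pochhammer a' (Suc n) * pochhammer b' (Suc n) / (pochhammer c' (Suc n) * fact (Suc n)))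
    = r n * hyp2F1_term n"
  assumes rat: "\<And>n. r n = (p0 + q1 * (1 + real n)) * hyp2F1_ratio n
    + (p1 + q2 * real n) + q0 * (2 + real n) * hyp2F1_ratio' n
        * hyp2F1_ratio n"
  shows "K * hyp2F1 a' b' c' z
    = (q0 + q1 * z + q2 * z\<^sup>2) * hyp2F1_deriv a b c z + (p0 + p1 * z) * hyp2F1 a b c z"
proof (rule hyp2F1_contiguous[OF c c' z zero, where T = "\<lambda>n. hyp2F1_term n"])
  fix n
  have 2: "hyp2F1_term (Suc (Suc n)) = (a + (1 + real n)) * (b + (1 + real n)) / ((c + (1 + real n)) * (2 + real n))
      * hyp2F1_term (Suc n)"
    unfolding hyp2F1_term_Suc[of "Suc n"] by simp
  show "K * (pochhammer a' (Suc n) * pochhammer b' (Suc n) / (pochhammer c' (Suc n) * fact (Suc n)))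
      = (p0 + q1 * real (Suc n)) * hyp2F1_term (Suc n) + (p1 + q2 * real n) * hyp2F1_term n
        + q0 * (real n + 2) * hyp2F1_term (Suc (Suc n))"
    unfolding 2 ratio unfolding hyp2F1_term_Suc[of n] rat of_nat_Suc
    by (simp only: distrib_right mult.assoc add.commute[of "real n" 2] add.assoc)
qed simp

lemma pochhammer_plus1: "d * pochhammer (d + 1) n = (d + real n) * pochhammer d n" for d :: real
  by (metis pochhammer_rec pochhammer_rec' )

lemma pochhammer_plus1': "d \<noteq> 0 \<Longrightarrow> pochhammer (d + 1) n = (d + real n) * pochhammer d n / d" for d :: real
  by (metis nonzero_mult_div_cancel_left pochhammer_plus1)

lemma pochhammer_minus1: "pochhammer (d - 1) (Suc n) = (d - 1) * pochhammer d n" for d :: real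
  by (simp add: pochhammer_rec)

lemma hyp2F1_a_plus1:
  "a * hyp2F1 (a + 1) b c z = z * hyp2F1_deriv a b c z + a * hyp2F1 a b c z"
proof -
  have "a * hyp2F1 (a + 1) b c z = (0 + 1 * z + 0 * z\<^sup>2) * hyp2F1_deriv a b c z + (a + 0 * z) * hyp2F1 a b c z"
  proof (rule hyp2F1_contiguous_ratio[OF c])
    fix n
    have "a * (pochhammer (a + 1) (Suc n) * pochhammer b (Suc n) / (pochhammer c (Suc n) * fact (Suc n)))
        = (a + (1 + real n)) * hyp2F1_term (Suc n)"
      using pochhammer_plus1[of a "Suc n"] by (simp add: mult.assoc[symmetric] del: fact_Suc)
    then show "a * (pochhammer (a + 1) (Suc n) * pochhammer b (Suc n) / (pochhammer c (Suc n) * fact (Suc n)))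
        = ((a + (1 + real n)) * hyp2F1_ratio n) * hyp2F1_term n"
      unfolding hyp2F1_term_Suc[of n] by (simp only: mult.assoc)
  qed simp_all
  then show ?thesis by simp
qed

lemma hyp2F1_b_minus1:
  "(c - b) * hyp2F1 a (b - 1) c z
    = (1 - z) * z * hyp2F1_deriv a b c z - (b - c + a * z) * hyp2F1 a b c z"
proof -
  have "(c - b) * hyp2F1 a (b - 1) c z
      = (0 + 1 * z + (-1) * z\<^sup>2) * hyp2F1_deriv a b c z + ((c - b) + (-a) * z) * hyp2F1 a b c z"
  proof (rule hyp2F1_contiguous_ratio[OF c])
    fix n
    show "(c - b) * (pochhammer a (Suc n) * pochhammer (b - 1) (Suc n) / (pochhammer c (Suc n) * fact (Suc n)))
       = ((c - b) * (a + real n) * (b - 1) / ((c + real n) * (1 + real n))) * hyp2F1_term n"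
      unfolding pochhammer_minus1 by (simp only: pochhammer_Suc fact_Suc of_nat_mult of_nat_Suc times_divide_times_eq times_divide_eq_right divide_divide_eq_left ac_simps)
    show "(c - b) * (a + real n) * (b - 1) / ((c + real n) * (1 + real n))
      = (c - b + 1 * (1 + real n)) * hyp2F1_ratio n + (- a + - 1 * real n)
       + 0 * (2 + real n) * hyp2F1_ratio' n
        * hyp2F1_ratio n"
      unfolding mult_zero_left add_0_right
      by (rule divide_eq_mult_divide_add) (use c_add_nat(1)[of n] in simp, algebra)
  qed auto
  then show ?thesis by (simp add: power2_eq_square algebra_simps)
qed

lemma hyp2F1_c_minus1:
  assumes c1: "c - 1 \<notin> \<int>\<^sub>\<le>\<^sub>0"
  shows "(c - 1) * hyp2F1 a b (c - 1) z = z * hyp2F1_deriv a b c z + (c - 1) * hyp2F1 a b c z"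
proof -
  have c10: "c - 1 \<noteq> 0" using c1 by auto
  have "(c - 1) * hyp2F1 a b (c - 1) z
      = (0 + 1 * z + 0 * z\<^sup>2) * hyp2F1_deriv a b c z + ((c - 1) + 0 * z) * hyp2F1 a b c z"
  proof (rule hyp2F1_contiguous_ratio[OF c1])
    fix n
    show "(c - 1) * (pochhammer a (Suc n) * pochhammer b (Suc n) / (pochhammer (c - 1) (Suc n) * fact (Suc n)))
       = ((c + real n) * ((a + real n) * (b + real n)) / ((c + real n) * (1 + real n))) * hyp2F1_term n"
      unfolding pochhammer_minus1[of c] pochhammer_minus1[of b] pochhammer_Suc[of a] pochhammer_Suc[of b] fact_Suc of_nat_mult of_nat_Suc
      by (rule fraction_cancel_1[OF c10 c_add_nat(1)])
    show "(c + real n) * ((a + real n) * (b + real n)) / ((c + real n) * (1 + real n))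
      = (c - 1 + 1 * (1 + real n)) * hyp2F1_ratio n + (0 + 0 * real n)
       + 0 * (2 + real n) * hyp2F1_ratio' n
        * hyp2F1_ratio n"
      unfolding mult_zero_left add_0_right times_divide_eq_right by simp
  qed auto
  then show ?thesis by simp
qed

lemma hyp2F1_b_c_minus1:
  assumes c1: "c - 1 \<notin> \<int>\<^sub>\<le>\<^sub>0"
  shows "(c - 1) * hyp2F1 a (b - 1) (c - 1) z
    = (1 - z) * z * hyp2F1_deriv a b c z + (c - 1 - a * z) * hyp2F1 a b c z"
proof -
  have c10: "c - 1 \<noteq> 0" using c1 by auto
  have "(c - 1) * hyp2F1 a (b - 1) (c - 1) z
      = (0 + 1 * z + (-1) * z\<^sup>2) * hyp2F1_deriv a b c z + ((c - 1) + (-a) * z) * hyp2F1 a b c z"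
  proof (rule hyp2F1_contiguous_ratio[OF c1])
    fix n
    show "(c - 1) * (pochhammer a (Suc n) * pochhammer (b - 1) (Suc n) / (pochhammer (c - 1) (Suc n) * fact (Suc n)))
       = ((c + real n) * ((a + real n) * (b - 1)) / ((c + real n) * (1 + real n))) * hyp2F1_term n"
      unfolding pochhammer_minus1[of c] pochhammer_minus1[of b] pochhammer_Suc[of a] pochhammer_Suc[of b] fact_Suc of_nat_mult of_nat_Suc
        mult.commute[of "b - 1"]
      by (rule fraction_cancel_1[OF c10 c_add_nat(1)])
    show "(c + real n) * ((a + real n) * (b - 1)) / ((c + real n) * (1 + real n))
      = (c - 1 + 1 * (1 + real n)) * hyp2F1_ratio n + (- a + - 1 * real n)
       + 0 * (2 + real n) * hyp2F1_ratio' n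
        * hyp2F1_ratio n"
      unfolding mult_zero_left add_0_right
      by (rule divide_eq_mult_divide_add) (use c_add_nat(1)[of n] in simp, algebra)
  qed auto
  then show ?thesis by (simp add: power2_eq_square algebra_simps)
qed

lemma nonpos_Ints_plus1: "c + 1 \<notin> \<int>\<^sub>\<le>\<^sub>0"
  using c by (metis add_diff_cancel nonpos_Ints_diff_Nats Nats_1)

text \<open>Raising c requires the factor 1 - z at the derivative, so here \<open>q0\<close> is
  nonzero and one further coefficient enters. The common factor \<open>hyp2F1_ratio n\<close> is
  split off by \<open>fraction_cancel_4\<close>.\<close>

lemma hyp2F1_a_c_plus1:
  "a * (c - b) / c * hyp2F1 (a + 1) b (c + 1) z
    = a * hyp2F1 a b c z - (1 - z) * hyp2F1_deriv a b c z"
proof -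
  have "a * (c - b) / c * hyp2F1 (a + 1) b (c + 1) z
      = ((-1) + 1 * z + 0 * z\<^sup>2) * hyp2F1_deriv a b c z + (a + 0 * z) * hyp2F1 a b c z"
  proof (rule hyp2F1_contiguous_ratio[OF nonpos_Ints_plus1])
    fix n
    have "a * (c - b) / c * (pochhammer (a + 1) (Suc n) * pochhammer b (Suc n) / (pochhammer (c + 1) (Suc n) * fact (Suc n)))
        = (c - b) / c * ((a * pochhammer (a + 1) (Suc n)) * pochhammer b (Suc n) / (pochhammer (c + 1) (Suc n) * fact (Suc n)))"
      by simp
    also have "\<dots> = ((c - b) * (a + (1 + real n)) / (c + (1 + real n))) * hyp2F1_term (Suc n)"
      unfolding pochhammer_plus1 pochhammer_plus1'[OF c_add_nat(2)] of_nat_Suc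
      by (rule fraction_cancel_2[OF c_add_nat(2)])
    finally show "a * (c - b) / c * (pochhammer (a + 1) (Suc n) * pochhammer b (Suc n) / (pochhammer (c + 1) (Suc n) * fact (Suc n)))
        = (((c - b) * (a + (1 + real n)) / (c + (1 + real n))) * hyp2F1_ratio n) * hyp2F1_term n"
      unfolding hyp2F1_term_Suc[of n] by (simp only: mult.assoc)
    have C: "(c + (1 + real n)) \<noteq> 0" using c_add_nat(1)[of "Suc n"] by (simp add: add.commute)
    have "(c - b) * (a + (1 + real n)) / (c + (1 + real n)) = (-1) * ((a + (1 + real n)) * (b + (1 + real n)) / (c + (1 + real n))) + (a + 1 * (1 + real n))"
      by (rule divide_eq_mult_divide_add[OF C]) algebra
    then show "((c - b) * (a + (1 + real n)) / (c + (1 + real n))) * hyp2F1_ratio n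
      = (a + 1 * (1 + real n)) * hyp2F1_ratio n + (0 + 0 * real n)
       + (-1) * (2 + real n) * hyp2F1_ratio' n
        * hyp2F1_ratio n"
      by (rule fraction_cancel_4[rotated]) simp
  qed (rule fraction_cancel_5[OF c_add_nat(2)])
  also have "\<dots> = a * hyp2F1 a b c z - (1 - z) * hyp2F1_deriv a b c z" by (simp add: algebra_simps)
  finally show ?thesis .
qed

lemma hyp2F1_c_plus1:
  "(c - a) * (c - b) / c * hyp2F1 a b (c + 1) z
    = (1 - z) * hyp2F1_deriv a b c z + (c - a - b) * hyp2F1 a b c z"
proof -
  have "(c - a) * (c - b) / c * hyp2F1 a b (c + 1) z
      = (1 + (-1) * z + 0 * z\<^sup>2) * hyp2F1_deriv a b c z + ((c - a - b) + 0 * z) * hyp2F1 a b c z"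
  proof (rule hyp2F1_contiguous_ratio[OF nonpos_Ints_plus1])
    fix n
    have "(c - a) * (c - b) / c * (pochhammer a (Suc n) * pochhammer b (Suc n) / (pochhammer (c + 1) (Suc n) * fact (Suc n)))
        = ((c - a) * (c - b) / (c + (1 + real n))) * hyp2F1_term (Suc n)"
      unfolding pochhammer_plus1'[OF c_add_nat(2)] of_nat_Suc
      using fraction_cancel_2[OF c_add_nat(2), where X = 1] by simp
    then show "(c - a) * (c - b) / c * (pochhammer a (Suc n) * pochhammer b (Suc n) / (pochhammer (c + 1) (Suc n) * fact (Suc n)))
        = (((c - a) * (c - b) / (c + (1 + real n))) * hyp2F1_ratio n) * hyp2F1_term n"
      unfolding hyp2F1_term_Suc[of n] by (simp only: mult.assoc)
    have C: "(c + (1 + real n)) \<noteq> 0" using c_add_nat(1)[of "Suc n"] by (simp add: add.commute)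
    have "(c - a) * (c - b) / (c + (1 + real n)) = 1 * ((a + (1 + real n)) * (b + (1 + real n)) / (c + (1 + real n))) + (c - a - b + (-1) * (1 + real n))"
      by (rule divide_eq_mult_divide_add[OF C]) algebra
    then show "((c - a) * (c - b) / (c + (1 + real n))) * hyp2F1_ratio n
      = (c - a - b + (-1) * (1 + real n)) * hyp2F1_ratio n + (0 + 0 * real n)
       + 1 * (2 + real n) * hyp2F1_ratio' n
        * hyp2F1_ratio n"
      by (rule fraction_cancel_4[rotated]) simp
  qed (rule fraction_cancel_6[OF c_add_nat(2)])
  also have "\<dots> = (1 - z) * hyp2F1_deriv a b c z + (c - a - b) * hyp2F1 a b c z" by simp
  finally show ?thesis .
qed

text \<open>In the Legendre case a + b = 1 one has b - 1 = - a, so the factor 1/a from raising a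
  cancels against the factor from lowering b. Thus a shift of the degree \<nu> is a single relation
  with polynomial coefficients.\<close>

lemma hyp2F1_a_plus1_b_minus1:
  assumes ab: "a + b = 1" and a: "a \<noteq> 0"
  shows "(1 - c - a) * hyp2F1 (a + 1) (b - 1) c z
    = - 2 * z * (1 - z) * hyp2F1_deriv a b c z + (1 - c - a + 2 * a * z) * hyp2F1 a b c z"
proof -
  have "(1 - c - a) * hyp2F1 (a + 1) (b - 1) c z
      = (0 + (-2) * z + 2 * z\<^sup>2) * hyp2F1_deriv a b c z + ((1 - c - a) + (2 * a) * z) * hyp2F1 a b c z"
  proof (rule hyp2F1_contiguous_ratio[OF c])
    fix n
    show "(1 - c - a) * (pochhammer (a + 1) (Suc n) * pochhammer (b - 1) (Suc n) / (pochhammer c (Suc n) * fact (Suc n)))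
       = (- (1 - c - a) * (a + real n) * (a + (1 + real n)) / ((c + real n) * (1 + real n))) * hyp2F1_term n"
    proof -
      have b: "pochhammer (b - 1) (Suc n) = - a * pochhammer b n"
      proof -
        have "b - 1 = - a" using ab by simp
        then show ?thesis unfolding pochhammer_minus1 by (rule arg_cong)
      qed
      show ?thesis
        unfolding b pochhammer_plus1'[OF a] pochhammer_Suc[of a] pochhammer_Suc[of c]
          fact_Suc of_nat_mult of_nat_Suc
        by (rule fraction_cancel_3[OF a])
    qed
    show "(- (1 - c - a) * (a + real n) * (a + (1 + real n)) / ((c + real n) * (1 + real n)))
      = (1 - c - a + (-2) * (1 + real n)) * hyp2F1_ratio n + (2 * a + 2 * real n)
       + 0 * (2 + real n) * hyp2F1_ratio' n
        * hyp2F1_ratio n"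
      unfolding mult_zero_left add_0_right
      by (rule divide_eq_mult_divide_add) (use c_add_nat(1)[of n] in simp, use ab in algebra)
  qed auto
  then show ?thesis by (simp add: power2_eq_square algebra_simps)
qed

end

section \<open>Ladder operators for the Ferrers function\<close>

definition tanh_arg :: "real \<Rightarrow> real" where
  "tanh_arg \<xi> = (1 - tanh \<xi>) / 2"

lemma half_diff_identities: "1 - (1 - x) / 2 = (1 + x) / 2" "x = 1 - 2 * ((1 - x) / 2)"
  "- (1 - (1 - 2 * x)\<^sup>2) / 2 = - 2 * x * (1 - x)" for x :: real
  by (simp_all add: field_simps power2_eq_square)

lemma tanh_arg_exp: "tanh_arg \<xi> = exp (- \<xi>) / (2 * cosh \<xi>)"
proof -
  have "exp (- \<xi>) = cosh \<xi> - sinh \<xi>" by (rule cosh_minus_sinh [symmetric])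
  moreover have "cosh \<xi> \<noteq> 0" by (rule cosh_real_nonzero)
  ultimately show ?thesis
    by (simp add: tanh_arg_def tanh_def diff_divide_distrib)
qed

lemma one_minus_tanh_arg: "1 - tanh_arg \<xi> = exp \<xi> / (2 * cosh \<xi>)"
proof -
  have "exp \<xi> = cosh \<xi> + sinh \<xi>" by (rule cosh_plus_sinh [symmetric])
  moreover have "cosh \<xi> \<noteq> 0" by (rule cosh_real_nonzero)
  moreover have "1 - tanh_arg \<xi> = (1 + tanh \<xi>) / 2" unfolding tanh_arg_def by (rule half_diff_identities)
  ultimately show ?thesis
    by (simp add: tanh_def add_divide_distrib)
qed

lemma tanh_arg_bounds: "0 < tanh_arg \<xi>" "tanh_arg \<xi> < 1" "\<bar>tanh_arg \<xi>\<bar> < 1"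
proof -
  show "0 < tanh_arg \<xi>" by (simp add: tanh_arg_exp cosh_real_pos)
  moreover have "0 < 1 - tanh_arg \<xi>" by (simp add: one_minus_tanh_arg cosh_real_pos)
  ultimately show "tanh_arg \<xi> < 1" "\<bar>tanh_arg \<xi>\<bar> < 1" by auto
qed

lemma has_real_derivative_tanh_arg:
  "(tanh_arg has_real_derivative - 2 * tanh_arg \<xi> * (1 - tanh_arg \<xi>)) (at \<xi>)"
proof -
  have "(tanh_arg has_real_derivative - (1 - (tanh \<xi>)\<^sup>2) / 2) (at \<xi>)"
    unfolding tanh_arg_def [abs_def]
    by (auto intro!: derivative_eq_intros simp: cosh_real_nonzero)
  also have "- (1 - (tanh \<xi>)\<^sup>2) / 2 = - 2 * tanh_arg \<xi> * (1 - tanh_arg \<xi>)"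
  proof -
    have T: "tanh \<xi> = 1 - 2 * tanh_arg \<xi>" unfolding tanh_arg_def by (rule half_diff_identities)
    show ?thesis unfolding T by (rule half_diff_identities)
  qed
  finally show ?thesis .
qed

lemma ferrers_P_tanh:
  "ferrers_P \<nu> \<mu> (tanh \<xi>)
    = exp (\<mu> * \<xi>) / Gamma (1 - \<mu>) * hyp2F1 (- \<nu>) (\<nu> + 1) (1 - \<mu>) (tanh_arg \<xi>)"
proof -
  have "(1 + tanh \<xi>) / (1 - tanh \<xi>) = (1 - tanh_arg \<xi>) / tanh_arg \<xi>"
    by (simp add: tanh_arg_def)
  also have "\<dots> = exp \<xi> / exp (- \<xi>)"
    unfolding one_minus_tanh_arg unfolding tanh_arg_exp by (simp add: cosh_real_nonzero)
  also have "\<dots> = exp (2 * \<xi>)" by (simp flip: exp_diff)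
  finally have "((1 + tanh \<xi>) / (1 - tanh \<xi>)) powr (\<mu> / 2) = exp (\<mu> * \<xi>)"
    by (simp add: powr_def)
  then show ?thesis by (simp add: ferrers_P_def tanh_arg_def)
qed

text \<open>The derivative in \<xi> of \<open>ferrers_P \<nu> \<mu> (tanh \<xi>)\<close>, with
  \<open>- 2 * t * (1 - t)\<close> the derivative of \<open>tanh_arg\<close>. Written out in this
  way it makes the ladder relations polynomial identities in F and its derivative.\<close>

definition ferrers_D :: "real \<Rightarrow> real \<Rightarrow> real \<Rightarrow> real" where
  "ferrers_D \<nu> \<mu> \<xi> = exp (\<mu> * \<xi>) / Gamma (1 - \<mu>)
     * (\<mu> * hyp2F1 (- \<nu>) (\<nu> + 1) (1 - \<mu>) (tanh_arg \<xi>)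
        - 2 * tanh_arg \<xi> * (1 - tanh_arg \<xi>) * hyp2F1_deriv (- \<nu>) (\<nu> + 1) (1 - \<mu>) (tanh_arg \<xi>))"

context
  fixes \<nu> \<mu> :: real
  assumes mu: "\<mu> \<notin> \<int>"
begin

lemma not_nonpos_Ints_minus: "1 - \<mu> \<notin> \<int>\<^sub>\<le>\<^sub>0" (is ?g1) "1 - \<mu> - 1 \<notin> \<int>\<^sub>\<le>\<^sub>0" (is ?g2) "- \<mu> \<notin> \<int>\<^sub>\<le>\<^sub>0" (is ?g3)
  and mu_nonzero: "\<mu> \<noteq> 0" "1 - \<mu> \<noteq> 0"
proof -
  have 1: "1 - \<mu> \<notin> \<int>"
  proof
    assume "1 - \<mu> \<in> \<int>"
    then have "1 - (1 - \<mu>) \<in> \<int>" by (intro Ints_diff) auto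
    then show False using mu by simp
  qed
  have 2: "- \<mu> \<notin> \<int>" using mu by simp
  show ?g1 ?g2 ?g3
    using 1 2 nonpos_Ints_subset_Ints by auto
  show "\<mu> \<noteq> 0" "1 - \<mu> \<noteq> 0" using mu 1 by auto
qed

lemma has_real_derivative_ferrers_P_tanh:
  "((\<lambda>\<xi>. ferrers_P \<nu> \<mu> (tanh \<xi>)) has_real_derivative ferrers_D \<nu> \<mu> \<xi>) (at \<xi>)"
proof -
  have F: "((\<lambda>\<xi>. hyp2F1 (- \<nu>) (\<nu> + 1) (1 - \<mu>) (tanh_arg \<xi>)) has_real_derivative
      hyp2F1_deriv (- \<nu>) (\<nu> + 1) (1 - \<mu>) (tanh_arg \<xi>) * (- 2 * tanh_arg \<xi> * (1 - tanh_arg \<xi>))) (at \<xi>)"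
    by (rule DERIV_chain2[OF has_real_derivative_hyp2F1 has_real_derivative_tanh_arg])
      (use not_nonpos_Ints_minus tanh_arg_bounds in auto)
  have E: "((\<lambda>\<xi>. exp (\<mu> * \<xi>) / Gamma (1 - \<mu>)) has_real_derivative
      exp (\<mu> * \<xi>) / Gamma (1 - \<mu>) * \<mu>) (at \<xi>)"
    using not_nonpos_Ints_minus(1)
    by (auto intro!: derivative_eq_intros simp: Gamma_eq_zero_iff)
  show ?thesis
    unfolding ferrers_P_tanh [abs_def] ferrers_D_def
    by (rule DERIV_cong[OF DERIV_mult[OF E F]]) (simp add: algebra_simps)
qed

text \<open>Lowering \<mu> raises c = 1 - \<mu>, so this is \<open>hyp2F1_c_plus1\<close>; the
  division by c there is the quotient of the two Gamma factors. The factor exp (-\<xi>) equals both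
  \<open>2 * cosh \<xi> * t\<close> and \<open>cosh \<xi> - sinh \<xi>\<close>, which makes the rest
  algebra.\<close>

lemma ferrers_mu_minus1:
  "(\<nu> + \<mu>) * (\<nu> - \<mu> + 1) * ferrers_P \<nu> (\<mu> - 1) (tanh \<xi>)
    = cosh \<xi> * ferrers_D \<nu> \<mu> \<xi> - \<mu> * sinh \<xi> * ferrers_P \<nu> \<mu> (tanh \<xi>)"
proof -
  define t where "t = tanh_arg \<xi>"
  define F where "F = hyp2F1 (- \<nu>) (\<nu> + 1) (1 - \<mu>) t"
  define D where "D = hyp2F1_deriv (- \<nu>) (\<nu> + 1) (1 - \<mu>) t"
  define G where "G = hyp2F1 (- \<nu>) (\<nu> + 1) (1 - \<mu> + 1) t"
  define A where "A = exp (\<mu> * \<xi>) / Gamma (1 - \<mu>)"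
  have t: "\<bar>t\<bar> < 1" using tanh_arg_bounds by (simp add: t_def)
  have "(1 - \<mu> - - \<nu>) * (1 - \<mu> - (\<nu> + 1)) / (1 - \<mu>) * G = (1 - t) * D + (1 - \<mu> - - \<nu> - (\<nu> + 1)) * F"
    unfolding F_def D_def G_def by (rule hyp2F1_c_plus1[OF not_nonpos_Ints_minus(1) t])
  moreover have "(1 - \<mu> - - \<nu>) * (1 - \<mu> - (\<nu> + 1)) = - ((\<nu> + \<mu>) * (\<nu> - \<mu> + 1))" by algebra
  ultimately have cont: "(\<nu> + \<mu>) * (\<nu> - \<mu> + 1) * (G / (1 - \<mu>)) = \<mu> * F - (1 - t) * D"
    by simp
  have Gam: "Gamma (1 - \<mu> + 1) = (1 - \<mu>) * Gamma (1 - \<mu>)"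
    by (rule Gamma_plus1) (rule not_nonpos_Ints_minus)
  have P1: "ferrers_P \<nu> (\<mu> - 1) (tanh \<xi>) = A * exp (- \<xi>) * (G / (1 - \<mu>))"
    using Gam unfolding ferrers_P_tanh A_def G_def t_def
    by (simp add: algebra_simps flip: exp_add)
  have ct: "2 * cosh \<xi> * t = exp (- \<xi>)"
    unfolding t_def tanh_arg_exp by (simp add: cosh_real_nonzero)
  have cs: "exp (- \<xi>) = cosh \<xi> - sinh \<xi>" by (rule cosh_minus_sinh [symmetric])
  have "(\<nu> + \<mu>) * (\<nu> - \<mu> + 1) * ferrers_P \<nu> (\<mu> - 1) (tanh \<xi>)
      = A * exp (- \<xi>) * (\<mu> * F - (1 - t) * D)"
    unfolding P1 cont[symmetric] by (simp only: ac_simps)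
  also have "\<dots> = cosh \<xi> * (A * (\<mu> * F - 2 * t * (1 - t) * D)) - \<mu> * sinh \<xi> * (A * F)"
    using ct cs by algebra
  finally show ?thesis
    by (simp only: ferrers_D_def ferrers_P_tanh A_def F_def D_def t_def)
qed

text \<open>No factor remains on the left: Gamma (1 - \<mu>) = - \<mu> * Gamma (- \<mu>) absorbs the
  c - 1 = - \<mu> of \<open>hyp2F1_c_minus1\<close>.\<close>

lemma ferrers_mu_plus1:
  "ferrers_P \<nu> (\<mu> + 1) (tanh \<xi>)
    = - cosh \<xi> * ferrers_D \<nu> \<mu> \<xi> - \<mu> * sinh \<xi> * ferrers_P \<nu> \<mu> (tanh \<xi>)"
proof -
  define t where "t = tanh_arg \<xi>"
  define F where "F = hyp2F1 (- \<nu>) (\<nu> + 1) (1 - \<mu>) t"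
  define D where "D = hyp2F1_deriv (- \<nu>) (\<nu> + 1) (1 - \<mu>) t"
  define G where "G = hyp2F1 (- \<nu>) (\<nu> + 1) (1 - \<mu> - 1) t"
  define A where "A = exp (\<mu> * \<xi>) / Gamma (1 - \<mu>)"
  have t: "\<bar>t\<bar> < 1" using tanh_arg_bounds by (simp add: t_def)
  have "(1 - \<mu> - 1) * G = t * D + (1 - \<mu> - 1) * F"
    unfolding F_def D_def G_def
    by (rule hyp2F1_c_minus1[OF not_nonpos_Ints_minus(1) t not_nonpos_Ints_minus(2)])
  then have cont: "- \<mu> * G = t * D - \<mu> * F" by simp
  have Gam: "Gamma (1 - \<mu>) = (- \<mu>) * Gamma (- \<mu>)"
    using Gamma_plus1[OF not_nonpos_Ints_minus(3)] by simp
  have P1: "ferrers_P \<nu> (\<mu> + 1) (tanh \<xi>) = A * exp \<xi> * (- \<mu> * G)"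
    unfolding ferrers_P_tanh A_def G_def t_def Gam using mu_nonzero
    by (simp add: algebra_simps flip: exp_add)
  have ct: "2 * cosh \<xi> * (1 - t) = exp \<xi>"
    unfolding t_def one_minus_tanh_arg by (simp add: cosh_real_nonzero)
  have cs: "exp \<xi> = cosh \<xi> + sinh \<xi>" by (rule cosh_plus_sinh [symmetric])
  have "ferrers_P \<nu> (\<mu> + 1) (tanh \<xi>) = A * exp \<xi> * (t * D - \<mu> * F)"
    unfolding P1 cont ..
  also have "\<dots> = - cosh \<xi> * (A * (\<mu> * F - 2 * t * (1 - t) * D)) - \<mu> * sinh \<xi> * (A * F)"
    using ct cs by algebra
  finally show ?thesis
    by (simp only: ferrers_D_def ferrers_P_tanh A_def F_def D_def t_def)
qed

text \<open>Exchanging the first two Gauss parameters lets one contiguity relation raise \<nu> here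
  and lower it in \<open>ferrers_nu_minus1\<close>. Its condition that a is nonzero becomes \<nu>
  \<noteq> -1 here and \<nu> \<noteq> 0 there.\<close>

lemma ferrers_nu_plus1:
  assumes nu: "\<nu> \<noteq> - 1"
  shows "(\<mu> - \<nu> - 1) * ferrers_P (\<nu> + 1) \<mu> (tanh \<xi>)
    = ferrers_D \<nu> \<mu> \<xi> - (\<nu> + 1) * tanh \<xi> * ferrers_P \<nu> \<mu> (tanh \<xi>)"
proof -
  define t where "t = tanh_arg \<xi>"
  define F where "F = hyp2F1 (- \<nu>) (\<nu> + 1) (1 - \<mu>) t"
  define D where "D = hyp2F1_deriv (- \<nu>) (\<nu> + 1) (1 - \<mu>) t"
  define G where "G = hyp2F1 (- (\<nu> + 1)) (\<nu> + 1 + 1) (1 - \<mu>) t"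
  define A where "A = exp (\<mu> * \<xi>) / Gamma (1 - \<mu>)"
  have t: "\<bar>t\<bar> < 1" using tanh_arg_bounds by (simp add: t_def)
  have "(1 - (1 - \<mu>) - (\<nu> + 1)) * hyp2F1 (\<nu> + 1 + 1) (- \<nu> - 1) (1 - \<mu>) t
      = - 2 * t * (1 - t) * hyp2F1_deriv (\<nu> + 1) (- \<nu>) (1 - \<mu>) t
        + (1 - (1 - \<mu>) - (\<nu> + 1) + 2 * (\<nu> + 1) * t) * hyp2F1 (\<nu> + 1) (- \<nu>) (1 - \<mu>) t"
    by (rule hyp2F1_a_plus1_b_minus1[OF not_nonpos_Ints_minus(1) t]) (use nu in auto)
  moreover have "hyp2F1 (\<nu> + 1 + 1) (- \<nu> - 1) (1 - \<mu>) t = G"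
    unfolding G_def by (subst hyp2F1_sym) simp
  moreover have "hyp2F1 (\<nu> + 1) (- \<nu>) (1 - \<mu>) t = F" "hyp2F1_deriv (\<nu> + 1) (- \<nu>) (1 - \<mu>) t = D"
    unfolding F_def D_def by (rule hyp2F1_sym, rule hyp2F1_deriv_sym)
  ultimately have cont: "(\<mu> - \<nu> - 1) * G = - 2 * t * (1 - t) * D + (\<mu> - (\<nu> + 1) + 2 * (\<nu> + 1) * t) * F"
    by (simp add: algebra_simps)
  have P1: "ferrers_P (\<nu> + 1) \<mu> (tanh \<xi>) = A * G"
    unfolding ferrers_P_tanh A_def G_def t_def ..
  have T: "tanh \<xi> = 1 - 2 * t" by (simp add: t_def tanh_arg_def)
  have "(\<mu> - \<nu> - 1) * ferrers_P (\<nu> + 1) \<mu> (tanh \<xi>) = A * ((\<mu> - \<nu> - 1) * G)"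
    unfolding P1 by simp
  also have "\<dots> = A * (\<mu> * F - 2 * t * (1 - t) * D) - (\<nu> + 1) * tanh \<xi> * (A * F)"
    unfolding cont T by algebra
  finally show ?thesis
    by (simp only: ferrers_D_def ferrers_P_tanh A_def F_def D_def t_def)
qed

lemma ferrers_nu_minus1:
  assumes nu: "\<nu> \<noteq> 0"
  shows "(\<mu> + \<nu>) * ferrers_P (\<nu> - 1) \<mu> (tanh \<xi>)
    = ferrers_D \<nu> \<mu> \<xi> + \<nu> * tanh \<xi> * ferrers_P \<nu> \<mu> (tanh \<xi>)"
proof -
  define t where "t = tanh_arg \<xi>"
  define F where "F = hyp2F1 (- \<nu>) (\<nu> + 1) (1 - \<mu>) t"
  define D where "D = hyp2F1_deriv (- \<nu>) (\<nu> + 1) (1 - \<mu>) t"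
  define G where "G = hyp2F1 (- (\<nu> - 1)) (\<nu> - 1 + 1) (1 - \<mu>) t"
  define A where "A = exp (\<mu> * \<xi>) / Gamma (1 - \<mu>)"
  have t: "\<bar>t\<bar> < 1" using tanh_arg_bounds by (simp add: t_def)
  have "(1 - (1 - \<mu>) - - \<nu>) * hyp2F1 (- \<nu> + 1) (\<nu> + 1 - 1) (1 - \<mu>) t
      = - 2 * t * (1 - t) * D + (1 - (1 - \<mu>) - - \<nu> + 2 * - \<nu> * t) * F"
    unfolding F_def D_def
    by (rule hyp2F1_a_plus1_b_minus1[OF not_nonpos_Ints_minus(1) t]) (use nu in auto)
  moreover have "hyp2F1 (- \<nu> + 1) (\<nu> + 1 - 1) (1 - \<mu>) t = G"
    unfolding G_def by simp
  ultimately have cont: "(\<mu> + \<nu>) * G = - 2 * t * (1 - t) * D + (\<mu> + \<nu> - 2 * \<nu> * t) * F"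
    by simp
  have P1: "ferrers_P (\<nu> - 1) \<mu> (tanh \<xi>) = A * G"
    unfolding ferrers_P_tanh A_def G_def t_def ..
  have T: "tanh \<xi> = 1 - 2 * t" by (simp add: t_def tanh_arg_def)
  have "(\<mu> + \<nu>) * ferrers_P (\<nu> - 1) \<mu> (tanh \<xi>) = A * ((\<mu> + \<nu>) * G)"
    unfolding P1 by simp
  also have "\<dots> = A * (\<mu> * F - 2 * t * (1 - t) * D) + \<nu> * tanh \<xi> * (A * F)"
    unfolding cont T by algebra
  finally show ?thesis
    by (simp only: ferrers_D_def ferrers_P_tanh A_def F_def D_def t_def)
qed

end

section \<open>The octahedral uniformization of the hyperbolic variable\<close>

definition oct_u :: "real \<Rightarrow> real" where
  "oct_u \<xi> = - C_minus \<xi> / C_plus \<xi>"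

lemma abs_sinh_less_sqrt: "\<bar>s\<bar> < sqrt ((4 * s\<^sup>2 + 1) / 3)" for s :: real
proof -
  have "s\<^sup>2 < (4 * s\<^sup>2 + 1) / 3" using zero_le_power2[of s] by (simp add: add_nonneg_pos)
  then have "sqrt (s\<^sup>2) < sqrt ((4 * s\<^sup>2 + 1) / 3)" by (rule real_sqrt_less_mono)
  then show ?thesis by simp
qed

lemma C_plus_pos: "C_plus \<xi> > 0" and C_minus_pos: "C_minus \<xi> > 0"
  using abs_sinh_less_sqrt[of "sinh (\<xi> / 3)"] by (auto simp: C_plus_def C_minus_def)

text \<open>By this symmetry everything is computed for C_+ and u alone; the C_- terms are the same
  expressions at - \<xi>, where u is replaced by 1/u.\<close>

lemma C_plus_uminus [simp]: "C_plus (- \<xi>) = C_minus \<xi>" and C_minus_uminus [simp]: "C_minus (- \<xi>) = C_plus \<xi>"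
  by (simp_all add: C_plus_def C_minus_def)

lemma oct_u_neg: "oct_u \<xi> < 0"
  using C_plus_pos[of \<xi>] C_minus_pos[of \<xi>] by (simp add: oct_u_def)

lemma oct_u_times: "oct_u \<xi> * C_plus \<xi> = - C_minus \<xi>"
  and C_minus_u: "C_minus \<xi> = - oct_u \<xi> * C_plus \<xi>"
  using C_plus_pos[of \<xi>] by (simp_all add: oct_u_def)

definition oct_w :: "real \<Rightarrow> real" where
  "oct_w \<xi> = sqrt ((4 * sinh (\<xi> / 3) ^ 2 + 1) / 3)"

lemma oct_w_sq: "3 * (oct_w \<xi>)\<^sup>2 = 4 * (sinh (\<xi> / 3))\<^sup>2 + 1" and oct_w_pos: "oct_w \<xi> > 0"
  using zero_le_power2[of "sinh (\<xi> / 3)"] by (auto simp: oct_w_def real_sqrt_pow2 add_nonneg_pos)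

lemma C_plus_w: "C_plus \<xi> = sinh (\<xi> / 3) + oct_w \<xi>" and C_minus_w: "C_minus \<xi> = - sinh (\<xi> / 3) + oct_w \<xi>"
  by (simp_all add: C_plus_def C_minus_def oct_w_def)

lemma sinh_cosh_triple: "sinh (y + (y + y)) = 4 * sinh y ^ 3 + 3 * sinh y" (is ?g1)
  "cosh (y + (y + y)) = cosh y * (4 * (sinh y)\<^sup>2 + 1)" (is ?g2) for y :: real
proof -
  have e: "(cosh y)\<^sup>2 = (sinh y)\<^sup>2 + 1" by (rule cosh_square_eq)
  show ?g1
    unfolding sinh_add cosh_add using e by algebra
  show ?g2
    unfolding sinh_add cosh_add using e by algebra
qed

text \<open>The triple angle formulas. The factor 4 sinh^2 + 1 of cosh is 3 \<open>oct_w\<close>^2,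
  which is where the square root in C_+ and C_- comes from.\<close>

lemma sinh_third: "sinh \<xi> = 4 * sinh (\<xi> / 3) ^ 3 + 3 * sinh (\<xi> / 3)" (is ?g1)
  and cosh_third: "cosh \<xi> = 3 * cosh (\<xi> / 3) * (oct_w \<xi>)\<^sup>2" (is ?g2) for \<xi> :: real
proof -
  have "cosh \<xi> = cosh (\<xi> / 3 + (\<xi> / 3 + \<xi> / 3))" "sinh \<xi> = sinh (\<xi> / 3 + (\<xi> / 3 + \<xi> / 3))" by simp_all
  then have "cosh \<xi> = cosh (\<xi> / 3) * (3 * (oct_w \<xi>)\<^sup>2)" "sinh \<xi> = 4 * sinh (\<xi> / 3) ^ 3 + 3 * sinh (\<xi> / 3)"
    unfolding oct_w_sq sinh_cosh_triple by simp_all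
  then show ?g1 ?g2
    by simp_all
qed

text \<open>Multiplying by the matching power of C_+ turns a polynomial in u into a form in C_+ and
  C_-, hence into a polynomial in s and w, where \<open>oct_w_sq\<close> eliminates w^2. The
  relation for \<open>oct_pe\<close> is obtained in the same way.\<close>

lemma oct_pf_u: "oct_pf (oct_u \<xi>) * (C_plus \<xi>)\<^sup>2 = - 4"
proof -
  define s w where d: "s = sinh (\<xi> / 3)" "w = oct_w \<xi>"
  have C: "C_plus \<xi> = s + w" "C_minus \<xi> = - s + w" by (simp_all add: d C_plus_w C_minus_w)
  have w: "3 * w\<^sup>2 = 4 * s\<^sup>2 + 1" unfolding d by (rule oct_w_sq)
  have "oct_pf (oct_u \<xi>) * (C_plus \<xi>)\<^sup>2 = (C_plus \<xi>)\<^sup>2 - 14 * C_plus \<xi> * C_minus \<xi> + (C_minus \<xi>)\<^sup>2"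
    unfolding oct_pf_def C_minus_u by algebra
  also have "\<dots> = - 4 * (3 * w\<^sup>2) + 16 * s\<^sup>2" unfolding C by algebra
  finally show ?thesis unfolding w by simp
qed

lemma oct_pe_u: "oct_pe (oct_u \<xi>) * (C_plus \<xi>) ^ 3 = 8 * sinh \<xi>"
proof -
  define s w where d: "s = sinh (\<xi> / 3)" "w = oct_w \<xi>"
  have C: "C_plus \<xi> = s + w" "C_minus \<xi> = - s + w" by (simp_all add: d C_plus_w C_minus_w)
  have w: "3 * w\<^sup>2 = 4 * s\<^sup>2 + 1" unfolding d by (rule oct_w_sq)
  have "oct_pe (oct_u \<xi>) * (C_plus \<xi>) ^ 3
      = (C_plus \<xi> - C_minus \<xi>) * ((C_plus \<xi>)\<^sup>2 + 34 * C_plus \<xi> * C_minus \<xi> + (C_minus \<xi>)\<^sup>2)"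
    unfolding oct_pe_def C_minus_u by algebra
  also have "\<dots> = 2 * s * (12 * (3 * w\<^sup>2) - 32 * s\<^sup>2)" unfolding C by algebra
  also have "\<dots> = 8 * (4 * s ^ 3 + 3 * s)" unfolding w by algebra
  finally show ?thesis by (simp add: sinh_third[of \<xi>] d)
qed

lemma C_times: "3 * (C_plus \<xi> * C_minus \<xi>) = (cosh (\<xi> / 3))\<^sup>2"
  unfolding C_plus_w C_minus_w cosh_square_eq using oct_w_sq[of \<xi>] by algebra

lemma cosh_sq_oct_u:
  "16 * (cosh \<xi>)\<^sup>2 = - 27 * oct_u \<xi> * (1 - oct_u \<xi>) ^ 4 * (C_plus \<xi>) ^ 6"
proof -
  have C: "C_plus \<xi> + C_minus \<xi> = 2 * oct_w \<xi>" by (simp add: C_plus_w C_minus_w)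
  have "- 27 * oct_u \<xi> * (1 - oct_u \<xi>) ^ 4 * (C_plus \<xi>) ^ 6
      = 9 * (3 * (C_plus \<xi> * C_minus \<xi>)) * (C_plus \<xi> + C_minus \<xi>) ^ 4"
    unfolding C_minus_u by algebra
  also have "\<dots> = 16 * (3 * cosh (\<xi> / 3) * (oct_w \<xi>)\<^sup>2)\<^sup>2"
    unfolding C_times C by algebra
  finally show ?thesis unfolding cosh_third[of \<xi>] by simp
qed

lemma oct_pf_u_nonzero: "oct_pf (oct_u \<xi>) \<noteq> 0"
  using oct_pf_u[of \<xi>] by auto

lemma oct_u_den: "(1 - oct_u \<xi>) * oct_pf (oct_u \<xi>) \<noteq> 0"
  using oct_pf_u_nonzero[of \<xi>] oct_u_neg[of \<xi>] by auto

text \<open>The form in which \<open>cosh \<xi>\<close> times d/d\<xi> acts on functions of u as - u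
  (1 - u) C_+ d/du. \<open>oct_u_deriv_w\<close> compares it with the expression from the quotient
  rule.\<close>

definition oct_u_deriv :: "real \<Rightarrow> real" where
  "oct_u_deriv \<xi> = - oct_u \<xi> * (1 - oct_u \<xi>) * C_plus \<xi> / cosh \<xi>"

lemma oct_u_deriv_times: "cosh \<xi> * oct_u_deriv \<xi> = - oct_u \<xi> * (1 - oct_u \<xi>) * C_plus \<xi>"
  by (simp add: oct_u_deriv_def cosh_real_nonzero)

lemma has_real_derivative_C:
  "(oct_w has_real_derivative 4 * sinh (\<xi> / 3) * cosh (\<xi> / 3) / (9 * oct_w \<xi>)) (at \<xi>)" (is ?g1)
  "((\<lambda>\<xi>. sinh (\<xi> / 3)) has_real_derivative cosh (\<xi> / 3) / 3) (at \<xi>)" (is ?g2)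
proof -
  have pos: "0 < (4 * sinh (\<xi> / 3) ^ 2 + 1) / 3"
    using zero_le_power2[of "sinh (\<xi> / 3)"] by (simp add: add_nonneg_pos)
  show ?g2
    by (auto intro!: derivative_eq_intros)
  then have "((\<lambda>\<xi>. (4 * sinh (\<xi> / 3) ^ 2 + 1) / 3) has_real_derivative
      8 * sinh (\<xi> / 3) * cosh (\<xi> / 3) / 9) (at \<xi>)"
    by (auto intro!: derivative_eq_intros)
  from DERIV_chain2[OF DERIV_real_sqrt[OF pos] this]
  show ?g1
    unfolding oct_w_def[abs_def] by (rule DERIV_cong) (simp add: inverse_eq_divide ac_simps)
qed

lemma oct_u_deriv_w: "oct_u_deriv \<xi> = 2 * cosh (\<xi> / 3) / (9 * oct_w \<xi> * (C_plus \<xi>)\<^sup>2)"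
proof -
  define C w k u where d: "C = C_plus \<xi>" "w = oct_w \<xi>" "k = cosh (\<xi> / 3)" "u = oct_u \<xi>"
  have nz: "C \<noteq> 0" "w \<noteq> 0" "k \<noteq> 0"
    using C_plus_pos[of \<xi>] oct_w_pos[of \<xi>] by (auto simp: d cosh_real_nonzero)
  have a: "C_minus \<xi> = - u * C" and b: "3 * (C * C_minus \<xi>) = k\<^sup>2" and c: "C + C_minus \<xi> = 2 * w"
    using C_minus_u[of \<xi>] C_times[of \<xi>] by (auto simp: d C_plus_w C_minus_w)
  have "- u * (1 - u) * C * (9 * w * C\<^sup>2) = 3 * w * (C + C_minus \<xi>) * (3 * (C * C_minus \<xi>))"
    unfolding a by algebra
  also have "\<dots> = 2 * k * (3 * k * w\<^sup>2)" unfolding b c by algebra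
  finally have "- u * (1 - u) * C * (9 * w * C\<^sup>2) = 2 * k * (3 * k * w\<^sup>2)" .
  then have "- u * (1 - u) * C / (3 * k * w\<^sup>2) = 2 * k / (9 * w * C\<^sup>2)"
    by (subst frac_eq_eq) (use nz in auto)
  then show ?thesis unfolding oct_u_deriv_def cosh_third[of \<xi>] d .
qed

lemma has_real_derivative_C_plus_w:
  "(C_plus has_real_derivative cosh (\<xi> / 3) / 3 + 4 * sinh (\<xi> / 3) * cosh (\<xi> / 3) / (9 * oct_w \<xi>)) (at \<xi>)"
  unfolding C_plus_w[abs_def] by (rule DERIV_add[OF has_real_derivative_C(2,1)])

text \<open>The value is what differentiating \<open>oct_pf_u\<close> predicts: with C^2 pf = -4,
  the derivative of C is C^3 / 8 times pf'(u) times the derivative of u, and pf'(u) = 14 + 2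
  u.\<close>

lemma has_real_derivative_C_plus:
  "(C_plus has_real_derivative (C_plus \<xi>) ^ 3 / 8 * (14 + 2 * oct_u \<xi>) * oct_u_deriv \<xi>) (at \<xi>)"
proof -
  define C w k s u where d: "C = C_plus \<xi>" "w = oct_w \<xi>" "k = cosh (\<xi> / 3)" "s = sinh (\<xi> / 3)" "u = oct_u \<xi>"
  have nz: "C \<noteq> 0" "w \<noteq> 0"
    using C_plus_pos[of \<xi>] oct_w_pos[of \<xi>] by (auto simp: d)
  have D: "(C_plus has_real_derivative k / 3 + 4 * s * k / (9 * w)) (at \<xi>)"
    unfolding d by (rule has_real_derivative_C_plus_w)
  have uC: "u * C = s - w" "C = s + w"
    using oct_u_times[of \<xi>] by (auto simp: d C_plus_w C_minus_w)
  have X: "C ^ 3 / 8 * X * (2 * k / (9 * w * C\<^sup>2)) = C * X * k / (36 * w)" for X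
    using nz by (simp add: power2_eq_square power3_eq_cube field_simps)
  have e: "C * (14 + 2 * u) = 12 * w + 16 * s" using uC by algebra
  have "C ^ 3 / 8 * (14 + 2 * u) * (2 * k / (9 * w * C\<^sup>2)) = (12 * w + 16 * s) * k / (36 * w)"
    unfolding X e ..
  also have "\<dots> = k / 3 + 4 * s * k / (9 * w)"
    using nz(2) by (simp add: field_simps)
  finally show ?thesis
    using D unfolding oct_u_deriv_w d by simp
qed

lemma has_real_derivative_oct_u: "(oct_u has_real_derivative oct_u_deriv \<xi>) (at \<xi>)"
proof -
  define C w k s where d: "C = C_plus \<xi>" "w = oct_w \<xi>" "k = cosh (\<xi> / 3)" "s = sinh (\<xi> / 3)"
  have nz: "C \<noteq> 0" "w \<noteq> 0"
    using C_plus_pos[of \<xi>] oct_w_pos[of \<xi>] by (auto simp: d)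
  have Cw: "C = s + w" by (simp add: d C_plus_w)
  have P: "(C_plus has_real_derivative k / 3 + 4 * s * k / (9 * w)) (at \<xi>)"
    unfolding d by (rule has_real_derivative_C_plus_w)
  have "((\<lambda>\<xi>. - sinh (\<xi> / 3) + oct_w \<xi>) has_real_derivative - (k / 3) + 4 * s * k / (9 * w)) (at \<xi>)"
    unfolding d by (rule DERIV_add[OF DERIV_minus[OF has_real_derivative_C(2)] has_real_derivative_C(1)])
  then have M: "(C_minus has_real_derivative - (k / 3) + 4 * s * k / (9 * w)) (at \<xi>)"
    by (simp add: C_minus_w[abs_def])
  have "((\<lambda>\<xi>. - C_minus \<xi> / C_plus \<xi>) has_real_derivative
      (- (- (k / 3) + 4 * s * k / (9 * w)) * C - (- C_minus \<xi>) * (k / 3 + 4 * s * k / (9 * w))) / (C * C)) (at \<xi>)"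
    unfolding d(1) by (rule DERIV_divide[OF DERIV_minus[OF M] P]) (use nz in \<open>simp add: d\<close>)
  also have "(- (- (k / 3) + 4 * s * k / (9 * w)) * C - (- C_minus \<xi>) * (k / 3 + 4 * s * k / (9 * w))) / (C * C)
      = 2 * k / (9 * w * C\<^sup>2)"
  proof -
    have w: "3 * w\<^sup>2 = 4 * s\<^sup>2 + 1" using oct_w_sq[of \<xi>] by (simp add: d)
    have M: "C_minus \<xi> = w - s" by (simp add: d C_minus_w)
    have 1: "k / 3 + 4 * s * k / (9 * w) = k * (3 * w + 4 * s) / (9 * w)"
            "- (k / 3) + 4 * s * k / (9 * w) = k * (4 * s - 3 * w) / (9 * w)"
      using nz by (simp_all add: field_simps)
    have "- (k * (4 * s - 3 * w) / (9 * w)) * C - (- C_minus \<xi>) * (k * (3 * w + 4 * s) / (9 * w))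
        = k * (- (4 * s - 3 * w) * C + C_minus \<xi> * (3 * w + 4 * s)) / (9 * w)"
      using nz by (simp add: add_divide_distrib diff_divide_distrib algebra_simps)
    also have "- (4 * s - 3 * w) * C + C_minus \<xi> * (3 * w + 4 * s) = 2"
      unfolding Cw M using w by algebra
    finally show ?thesis unfolding 1 by (simp add: power2_eq_square)
  qed
  finally show ?thesis unfolding oct_u_def[abs_def] oct_u_deriv_w d .
qed

text \<open>The C_+ term of both formulas without its numerical factors; the C_- term is the value
  at - \<xi>. Indices are real, so that shifts by 1 need no coercions.\<close>

definition oct_H :: "real \<Rightarrow> real \<Rightarrow> (real \<Rightarrow> real) \<Rightarrow> real \<Rightarrow> real" where
  "oct_H n m \<rho> \<xi> = cosh \<xi> powr (1 / 4 - m) * C_plus \<xi> powr (1 / 4 + 3 * m + 3 * n) * \<rho> (oct_u \<xi>)"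

definition oct_H_deriv :: "real \<Rightarrow> real \<Rightarrow> (real \<Rightarrow> real) \<Rightarrow> (real \<Rightarrow> real) \<Rightarrow> real \<Rightarrow> real" where
  "oct_H_deriv n m \<rho> \<rho>' \<xi> = cosh \<xi> powr (1 / 4 - m) * C_plus \<xi> powr (1 / 4 + 3 * m + 3 * n)
     * (((1 / 4 - m) * tanh \<xi>
          + (1 / 4 + 3 * m + 3 * n) * ((C_plus \<xi>)\<^sup>2 / 8 * (14 + 2 * oct_u \<xi>) * oct_u_deriv \<xi>)) * \<rho> (oct_u \<xi>)
        + \<rho>' (oct_u \<xi>) * oct_u_deriv \<xi>)"

lemma has_real_derivative_powr_log:
  assumes "(f has_real_derivative f x * D) (at x)" "f x > 0"
  shows "((\<lambda>x. f x powr r) has_real_derivative f x powr r * (r * D)) (at x)"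
proof -
  have "((\<lambda>x. f x powr r) has_real_derivative f x powr r * (0 * ln (f x) + f x * D * r / f x)) (at x)"
    by (rule DERIV_powr[OF assms(1,2) DERIV_const])
  then show ?thesis using assms(2) by (simp add: mult.commute)
qed

lemma has_real_derivative_oct_H:
  assumes "(\<rho> has_real_derivative \<rho>' (oct_u \<xi>)) (at (oct_u \<xi>))"
  shows "(oct_H n m \<rho> has_real_derivative oct_H_deriv n m \<rho> \<rho>' \<xi>) (at \<xi>)"
proof -
  have c: "(cosh has_real_derivative cosh \<xi> * tanh \<xi>) (at \<xi>)"
    by (auto intro!: derivative_eq_intros simp: tanh_def cosh_real_nonzero)
  have C: "(C_plus has_real_derivative C_plus \<xi> * ((C_plus \<xi>)\<^sup>2 / 8 * (14 + 2 * oct_u \<xi>) * oct_u_deriv \<xi>)) (at \<xi>)"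
    by (rule DERIV_cong[OF has_real_derivative_C_plus]) (simp add: power2_eq_square power3_eq_cube)
  have r: "((\<lambda>\<xi>. \<rho> (oct_u \<xi>)) has_real_derivative \<rho>' (oct_u \<xi>) * oct_u_deriv \<xi>) (at \<xi>)"
    by (rule DERIV_chain2[OF assms has_real_derivative_oct_u])
  note D = DERIV_mult[OF DERIV_mult[OF
      has_real_derivative_powr_log[OF c, of "1 / 4 - m"]
      has_real_derivative_powr_log[OF C C_plus_pos, of "1 / 4 + 3 * m + 3 * n"]] r]
  have aux: "(A * (p * t) * B + (B * (q * v)) * A) * R + R' * w * (A * B) = A * B * ((p * t + q * v) * R + R' * w)"
    for A B R R' p q t v w :: real
    by algebra
  show ?thesis
    unfolding oct_H_def[abs_def] oct_H_deriv_def
    by (rule DERIV_cong[OF D aux]) (rule cosh_real_pos)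
qed

lemma cosh_times_oct_H_deriv:
  "cosh \<xi> * oct_H_deriv n m \<rho> \<rho>' \<xi>
    = cosh \<xi> powr (1 / 4 - m) * C_plus \<xi> powr (1 / 4 + 3 * m + 3 * n)
      * (((1 / 4 - m) * sinh \<xi>
          - (1 / 4 + 3 * m + 3 * n) * ((C_plus \<xi>) ^ 3 / 8 * (14 + 2 * oct_u \<xi>) * (oct_u \<xi> * (1 - oct_u \<xi>)))) * \<rho> (oct_u \<xi>)
        - oct_u \<xi> * (1 - oct_u \<xi>) * C_plus \<xi> * \<rho>' (oct_u \<xi>))"
proof -
  have 1: "cosh \<xi> * tanh \<xi> = sinh \<xi>" by (simp add: tanh_def cosh_real_nonzero)
  have aux: "c * (E * ((p * t + q * (C\<^sup>2 / 8 * y * v)) * r + r' * v))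
      = E * ((p * s - q * (C ^ 3 / 8 * y * (u * (1 - u)))) * r - u * (1 - u) * C * r')"
    if "c * t = s" "c * v = - u * (1 - u) * C" for c E p t q C y v r r' s u :: real
  proof -
    have "c * (E * ((p * t + q * (C\<^sup>2 / 8 * y * v)) * r + r' * v))
        = E * ((p * (c * t) + q * (C\<^sup>2 / 8 * y * (c * v))) * r + r' * (c * v))"
      by (simp add: algebra_simps)
    also have "C\<^sup>2 / 8 * y * (c * v) = - (C ^ 3 / 8 * y * (u * (1 - u)))"
      unfolding that by (simp add: power2_eq_square power3_eq_cube)
    also have "E * ((p * (c * t) + q * - (C ^ 3 / 8 * y * (u * (1 - u)))) * r + r' * (c * v))
        = E * ((p * s - q * (C ^ 3 / 8 * y * (u * (1 - u)))) * r - u * (1 - u) * C * r')"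
      unfolding that by simp
    finally show ?thesis .
  qed
  show ?thesis
    unfolding oct_H_deriv_def by (rule aux[OF 1 oct_u_deriv_times])
qed

text \<open>One operator for two directions: \<kappa> is c - b when n is raised and c - 1 when m is
  raised, because \<open>hyp2F1_b_minus1\<close> and \<open>hyp2F1_b_c_minus1\<close> have the right
  side (1 - z) z F' + (\<kappa> - a z) F in common.\<close>

definition oct_raise :: "real \<Rightarrow> real \<Rightarrow> real \<Rightarrow> (real \<Rightarrow> real) \<Rightarrow> (real \<Rightarrow> real) \<Rightarrow> real \<Rightarrow> real" where
  "oct_raise \<kappa> n m \<rho> \<rho>' u = (oct_pf u * (u * (1 - u)) * \<rho>' u
     + ((- 1 / 12 - m - n) * (u * (1 - u)) * (21 + 3 * u) + \<kappa> * oct_pe u) * \<rho> u) / \<kappa>"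

text \<open>The relation \<open>hyp2F1_a_plus1\<close> rewritten in u; the first factor is 1/a,
  since the exponent of \<open>oct_pe\<close> is 2 a.\<close>

definition oct_lower_n :: "real \<Rightarrow> real \<Rightarrow> (real \<Rightarrow> real) \<Rightarrow> (real \<Rightarrow> real) \<Rightarrow> real \<Rightarrow> real" where
  "oct_lower_n n m \<rho> \<rho>' u = 2 / (- 1 / 12 - m - n) / (oct_pf u)\<^sup>2
     * (u * (1 - u) * \<rho>' u + (- 1 / 12 - m - n) * (1 - 5 * u) / 2 * \<rho> u)"

text \<open>With \<open>a\<close>, \<open>b\<close>, \<open>c\<close> the parameters of the defining Gauss function, the factor is \<open>c / (a (c - b))\<close>.\<close>

definition oct_lower_m :: "real \<Rightarrow> real \<Rightarrow> (real \<Rightarrow> real) \<Rightarrow> (real \<Rightarrow> real) \<Rightarrow> real \<Rightarrow> real" where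
  "oct_lower_m n m \<rho> \<rho>' u = (3 / 4 - m) / ((- 1 / 24 - m / 2 - n / 2) * (7 / 24 + (n - m) / 2))
     / (108 * (1 - u) ^ 3) * ((- 1 / 12 - m - n) * (21 + 3 * u) * \<rho> u + oct_pf u * \<rho>' u)"

lemma powr_C_plus_shift:
  "C_plus \<xi> powr (1 / 4 + 3 * m + 3 * (n + 1)) = C_plus \<xi> powr (1 / 4 + 3 * m + 3 * n) * C_plus \<xi> ^ 3" (is ?g1)
  "C_plus \<xi> powr (1 / 4 + 3 * (m + 1) + 3 * n) = C_plus \<xi> powr (1 / 4 + 3 * m + 3 * n) * C_plus \<xi> ^ 3" (is ?g2)
  "C_plus \<xi> powr (1 / 4 + 3 * m + 3 * (n - 1)) = C_plus \<xi> powr (1 / 4 + 3 * m + 3 * n) / C_plus \<xi> ^ 3" (is ?g3)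
  "C_plus \<xi> powr (1 / 4 + 3 * (m - 1) + 3 * n) = C_plus \<xi> powr (1 / 4 + 3 * m + 3 * n) / C_plus \<xi> ^ 3" (is ?g4)
proof -
  have C: "C_plus \<xi> > 0" by (rule C_plus_pos)
  then have 3: "C_plus \<xi> ^ 3 = C_plus \<xi> powr 3" by simp
  show ?g1 ?g2
    unfolding 3 powr_add[symmetric] by (simp_all add: algebra_simps)
  show ?g3 ?g4
    unfolding 3 powr_diff[symmetric] by (simp_all add: algebra_simps)
qed

lemma powr_cosh_shift:
  fixes \<xi> :: real
  shows "cosh \<xi> powr (1 / 4 - m) = cosh \<xi> * cosh \<xi> powr (1 / 4 - (m + 1))" (is ?g1)
    "cosh \<xi> powr (1 / 4 - (m - 1)) = cosh \<xi> * cosh \<xi> powr (1 / 4 - m)" (is ?g2)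
proof -
  have c: "cosh \<xi> = cosh \<xi> powr 1" using cosh_real_pos[of \<xi>] by simp
  have "cosh \<xi> powr (1 / 4 - m) = cosh \<xi> powr (1 + (1 / 4 - (m + 1)))"
    "cosh \<xi> powr (1 / 4 - (m - 1)) = cosh \<xi> powr (1 + (1 / 4 - m))" by simp_all
  then show ?g1 ?g2
    unfolding powr_add using cosh_real_pos[of \<xi>] by simp_all
qed

section \<open>The four ladder relations of \<open>oct_H\<close>\<close>

context
  fixes \<xi> u C c x :: real
  defines "u \<equiv> oct_u \<xi>" and "C \<equiv> C_plus \<xi>" and "c \<equiv> cosh \<xi>" and "x \<equiv> sinh \<xi>"
begin

lemma oct_relations: "oct_pf u * C\<^sup>2 = - 4" "oct_pe u * C ^ 3 = 8 * x"
  "16 * c\<^sup>2 = - 27 * u * (1 - u) ^ 4 * C ^ 6" "C > 0" "c > 0" "1 - u > 0" "oct_pf u \<noteq> 0"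
  using oct_pf_u oct_pe_u cosh_sq_oct_u C_plus_pos cosh_real_pos oct_u_neg[of \<xi>] oct_pf_u_nonzero
  unfolding u_def C_def c_def x_def by auto

text \<open>The condition on \<kappa> compares the multiples of x: p + k on the left, and 2 \<kappa>
  on the right because C^3 pe = 8 x. The condition on q says that the exponent of C_+ is -3 times
  the exponent \<open>al\<close> of \<open>oct_pe\<close>.\<close>

lemma oct_raise_identity:
  assumes "\<kappa> = (p + k) / 2" "q = - 3 * al" "\<kappa> \<noteq> 0"
  shows "(p * x - q * (C ^ 3 / 8 * (14 + 2 * u) * (u * (1 - u)))) * r - u * (1 - u) * C * r' + k * x * r
    = \<kappa> / 4 * (C ^ 3 * ((oct_pf u * (u * (1 - u)) * r' + (al * (u * (1 - u)) * (21 + 3 * u) + \<kappa> * oct_pe u) * r) / \<kappa>))"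
proof -
  let ?X = "oct_pf u * (u * (1 - u)) * r' + (al * (u * (1 - u)) * (21 + 3 * u) + \<kappa> * oct_pe u) * r"
  have "\<kappa> / 4 * (C ^ 3 * (?X / \<kappa>)) = C ^ 3 * ?X / 4"
    using assms(3) by simp
  also have "C ^ 3 * ?X = C * (oct_pf u * C\<^sup>2) * (u * (1 - u)) * r' + C ^ 3 * (al * (u * (1 - u)) * (21 + 3 * u)) * r
        + \<kappa> * (oct_pe u * C ^ 3) * r" by algebra
  also have "\<dots> = C * (- 4) * (u * (1 - u)) * r' + C ^ 3 * (al * (u * (1 - u)) * (21 + 3 * u)) * r + \<kappa> * (8 * x) * r"
    unfolding oct_relations ..
  finally show ?thesis
    unfolding assms(1,2) by (simp add: field_simps)
qed

lemma oct_lower_n_identity: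
  assumes "q = - 3 * al" "p - k = al" "al \<noteq> 0"
  shows "(p * x - q * (C ^ 3 / 8 * (14 + 2 * u) * (u * (1 - u)))) * r - u * (1 - u) * C * r' + (- k) * x * r
    = (- 8 * al) * (1 / C ^ 3 * (2 / al / (oct_pf u)\<^sup>2 * (u * (1 - u) * r' + al * (1 - 5 * u) / 2 * r)))"
proof -
  define f where "f = oct_pf u"
  have nz: "f \<noteq> 0" "C \<noteq> 0" using oct_relations by (auto simp: f_def)
  have f: "f * C\<^sup>2 = - 4" using oct_relations(1) by (simp add: f_def)
  then have "f\<^sup>2 * C ^ 4 = 16" by algebra
  then have e: "16 / (f\<^sup>2 * C ^ 3) = C" using nz by (simp add: power_eq_if field_simps)
  have 1: "(- 8 * al) * (1 / C ^ 3 * (2 / al / f\<^sup>2 * Z)) = - (16 / (f\<^sup>2 * C ^ 3)) * Z" for Z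
    using assms(3) by (simp add: ac_simps)
  define h D where "h = al * (1 - 5 * u) / 2" and "D = C ^ 3 / 8"
  have h: "2 * h = al * (1 - 5 * u)" by (simp add: h_def)
  have x: "x = (1 + u) * (1 - 34 * u + u\<^sup>2) * D"
    using oct_relations(2) by (simp add: oct_pe_def D_def)
  have D8: "8 * D = C ^ 3" by (simp add: D_def)
  have "C = - 2 * f * D" using D8 f by algebra
  then have C: "C = - 2 * (1 + 14 * u + u\<^sup>2) * D"
    unfolding f_def oct_pf_def .
  have p: "p = al + k" using assms(2) by simp
  \<comment> \<open>Up to the factor \<open>al * D\<close> this is the identity \<open>oct_pe u + 3
    * (14 + 2 * u) * u * (1 - u) = (1 - 5 * u) * oct_pf u\<close>.\<close>
  have "al * x + 3 * al * (D * (14 + 2 * u) * (u * (1 - u))) = (1 + 14 * u + u\<^sup>2) * D * (2 * h)"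
    unfolding x h by algebra
  also have "\<dots> = - C * h" unfolding C by algebra
  finally have "al * x + 3 * al * (D * (14 + 2 * u) * (u * (1 - u))) = - C * h" .
  then have "((al + k) * x - (- 3 * al) * (D * (14 + 2 * u) * (u * (1 - u)))) * r - u * (1 - u) * C * r' + (- k) * x * r
    = - C * (u * (1 - u) * r' + h * r)" by algebra
  then show ?thesis
    unfolding f_def[symmetric] 1 e assms(1) p h_def D_def .
qed

text \<open>Choosing k = - p removes x, and what remains is divisible by u (1 - u) after C is
  rewritten as - 2 pf D. The same factor comes from c^2, which contains u (1 - u)^4; the denominator
  takes away (1 - u)^3.\<close>

lemma oct_lower_m_identity:
  assumes "q = - 3 * al" "K = - 16 / L" "L \<noteq> 0"
  shows "(p * x - q * (C ^ 3 / 8 * (14 + 2 * u) * (u * (1 - u)))) * r - u * (1 - u) * C * r' + (- p) * x * r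
    = K * (c\<^sup>2 / C ^ 3 * (L / (108 * (1 - u) ^ 3) * (al * (21 + 3 * u) * r + oct_pf u * r')))"
proof -
  define v where "v = (1 - u) ^ 3"
  have nz: "v \<noteq> 0" "C \<noteq> 0" using oct_relations by (auto simp: v_def)
  have "16 * c\<^sup>2 = - 27 * u * (1 - u) * v * C ^ 6"
    using oct_relations(3) by (simp add: v_def power_eq_if)
  then have e: "- 16 * c\<^sup>2 / (108 * v * C ^ 3) = u * (1 - u) * C ^ 3 / 4"
    using nz by (simp add: divide_eq_eq power_eq_if)
  have 1: "K * (c\<^sup>2 / C ^ 3 * (L / (108 * v) * Z)) = - 16 * c\<^sup>2 / (108 * v * C ^ 3) * Z" for Z
    unfolding assms(2) using assms(3) by simp
  define D where "D = C ^ 3 / 8"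
  have D: "u * (1 - u) * C ^ 3 / 4 = 2 * u * (1 - u) * D" by (simp add: D_def)
  have D8: "8 * D = C ^ 3" by (simp add: D_def)
  have C: "C = - 2 * oct_pf u * D" using D8 oct_relations(1) by algebra
  have "(p * x - (- 3 * al) * (D * (14 + 2 * u) * (u * (1 - u)))) * r - u * (1 - u) * C * r' + (- p) * x * r
    = 2 * u * (1 - u) * D * (al * (21 + 3 * u) * r + oct_pf u * r')" unfolding C by algebra
  then show ?thesis
    unfolding v_def[symmetric] 1 e D unfolding assms(1) D_def .
qed

lemma ladder_aux:
  fixes A B L k y s K D Z :: real
  assumes "L + k * y * s = K * (D * Z)"
  shows "A * B * L + k * y * (A * B * s) = K * (A * (B * D) * Z)"
proof -
  have "A * B * L + k * y * (A * B * s) = A * B * (L + k * y * s)" by (simp only: distrib_left ac_simps)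
  then show ?thesis unfolding assms by (simp only: ac_simps)
qed

text \<open>The operator on the left is, up to sign, the one raising \<mu> = 1/3 + n in
  \<open>ferrers_mu_plus1\<close>, and also the one lowering \<mu> = -1/3 - n in
  \<open>ferrers_mu_minus1\<close>. One relation therefore serves both families.\<close>

lemma oct_H_raise_n:
  assumes nz: "7 / 24 + (n - m) / 2 \<noteq> 0"
  shows "cosh \<xi> * oct_H_deriv n m \<rho> \<rho>' \<xi> + (1 / 3 + n) * sinh \<xi> * oct_H n m \<rho> \<xi>
    = (7 / 24 + (n - m) / 2) / 4 * oct_H (n + 1) m (oct_raise (7 / 24 + (n - m) / 2) n m \<rho> \<rho>') \<xi>"
proof -
  have "7 / 24 + (n - m) / 2 = (1 / 4 - m + (1 / 3 + n)) / 2" "1 / 4 + 3 * m + 3 * n = - 3 * (- 1 / 12 - m - n)"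
    by (simp_all add: add_divide_distrib diff_divide_distrib)
  note id = oct_raise_identity[of "7 / 24 + (n - m) / 2" "1 / 4 - m" "1 / 3 + n" "1 / 4 + 3 * m + 3 * n"
      "- 1 / 12 - m - n" "\<rho> u" "\<rho>' u", OF this nz, unfolded u_def C_def x_def]
  show ?thesis
    unfolding cosh_times_oct_H_deriv oct_H_def oct_raise_def powr_C_plus_shift
    by (rule ladder_aux, rule id)
qed

text \<open>Raising m lowers \<nu> = -3/4 - m; the operator is that of
  \<open>ferrers_nu_minus1\<close> multiplied by \<open>cosh \<xi>\<close>, which clears tanh. The
  same factor on the right makes up for the lower power of cosh in
  \<open>oct_H n (m + 1)\<close>.\<close>

lemma oct_H_raise_m:
  assumes nz: "- 1 / 4 - m \<noteq> 0"
  shows "cosh \<xi> * oct_H_deriv n m \<rho> \<rho>' \<xi> + - (3 / 4 + m) * sinh \<xi> * oct_H n m \<rho> \<xi>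
    = (- 1 / 4 - m) / 4 * (cosh \<xi> * oct_H n (m + 1) (oct_raise (- 1 / 4 - m) n m \<rho> \<rho>') \<xi>)"
proof -
  have e: "cosh \<xi> * oct_H n (m + 1) R \<xi>
      = cosh \<xi> powr (1 / 4 - m) * (C_plus \<xi> powr (1 / 4 + 3 * m + 3 * n) * C_plus \<xi> ^ 3) * R (oct_u \<xi>)" for R
    unfolding oct_H_def powr_C_plus_shift powr_cosh_shift(1)[of _ m] by (simp only: ac_simps)
  have "- 1 / 4 - m = (1 / 4 - m + - (3 / 4 + m)) / 2" "1 / 4 + 3 * m + 3 * n = - 3 * (- 1 / 12 - m - n)"
    by (simp_all add: add_divide_distrib diff_divide_distrib)
  note id = oct_raise_identity[of "- 1 / 4 - m" "1 / 4 - m" "- (3 / 4 + m)" "1 / 4 + 3 * m + 3 * n"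
      "- 1 / 12 - m - n" "\<rho> u" "\<rho>' u", OF this nz, unfolded u_def C_def x_def]
  show ?thesis
    unfolding cosh_times_oct_H_deriv e unfolding oct_H_def oct_raise_def
    by (rule ladder_aux, rule id)
qed

lemma oct_H_lower_n:
  assumes nz: "- 1 / 12 - m - n \<noteq> 0"
  shows "cosh \<xi> * oct_H_deriv n m \<rho> \<rho>' \<xi> + - (1 / 3 + n) * sinh \<xi> * oct_H n m \<rho> \<xi>
    = - 8 * (- 1 / 12 - m - n) * oct_H (n - 1) m (oct_lower_n n m \<rho> \<rho>') \<xi>"
proof -
  have e: "oct_H (n - 1) m R \<xi>
      = cosh \<xi> powr (1 / 4 - m) * (C_plus \<xi> powr (1 / 4 + 3 * m + 3 * n) * (1 / C_plus \<xi> ^ 3)) * R (oct_u \<xi>)" for R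
    unfolding oct_H_def powr_C_plus_shift by simp
  have "1 / 4 + 3 * m + 3 * n = - 3 * (- 1 / 12 - m - n)" "1 / 4 - m - (1 / 3 + n) = - 1 / 12 - m - n"
    by simp_all
  note id = oct_lower_n_identity[of "1 / 4 + 3 * m + 3 * n"
      "- 1 / 12 - m - n" "1 / 4 - m" "1 / 3 + n" "\<rho> u" "\<rho>' u", OF this nz, unfolded u_def C_def x_def]
  show ?thesis
    unfolding cosh_times_oct_H_deriv e unfolding oct_H_def oct_lower_n_def
    by (rule ladder_aux, rule id)
qed

lemma oct_H_lower_m:
  fixes n m :: real
  defines "L \<equiv> (3 / 4 - m) / ((- 1 / 24 - m / 2 - n / 2) * (7 / 24 + (n - m) / 2))"
  assumes nz: "L \<noteq> 0"
  shows "cosh \<xi> * oct_H_deriv n m \<rho> \<rho>' \<xi> + - (1 / 4 - m) * sinh \<xi> * oct_H n m \<rho> \<xi>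
    = - 16 / L * (cosh \<xi> * oct_H n (m - 1) (oct_lower_m n m \<rho> \<rho>') \<xi>)"
proof -
  have e: "cosh \<xi> * oct_H n (m - 1) R \<xi>
      = cosh \<xi> powr (1 / 4 - m) * (C_plus \<xi> powr (1 / 4 + 3 * m + 3 * n) * ((cosh \<xi>)\<^sup>2 / C_plus \<xi> ^ 3)) * R (oct_u \<xi>)" for R
    unfolding oct_H_def powr_C_plus_shift powr_cosh_shift(2)[of _ m] by (simp add: power2_eq_square)
  have "1 / 4 + 3 * m + 3 * n = - 3 * (- 1 / 12 - m - n)" by simp
  note id = oct_lower_m_identity[of "1 / 4 + 3 * m + 3 * n"
      "- 1 / 12 - m - n" "- 16 / L" L "1 / 4 - m" "\<rho> u" "\<rho>' u", OF this refl nz, unfolded u_def C_def x_def c_def]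
  show ?thesis
    unfolding cosh_times_oct_H_deriv e unfolding oct_H_def oct_lower_m_def L_def[symmetric]
    by (rule ladder_aux, rule id)
qed

end

section \<open>The Gauss function on the octahedral parametrization\<close>

text \<open>The equation that defines \<open>oct_r\<close>, with an arbitrary function in place of
  the rational one, so that it can be differentiated and transported before rationality is
  known.\<close>

definition oct_hyp :: "real \<Rightarrow> real \<Rightarrow> (real \<Rightarrow> real) \<Rightarrow> bool" where
  "oct_hyp n m \<rho> \<longleftrightarrow> (\<forall>\<^sub>F u in nhds 0.
     hyp2F1 (- 1 / 24 - m / 2 - n / 2) (11 / 24 - m / 2 - n / 2) (3 / 4 - m) (oct_R u)
       = oct_pe u powr (- 1 / 12 - m - n) * \<rho> u)"

definition oct_pe_deriv :: "real \<Rightarrow> real" where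
  "oct_pe_deriv u = - 33 - 66 * u + 3 * u\<^sup>2"

lemma has_real_derivative_oct_pe: "(oct_pe has_real_derivative oct_pe_deriv u) (at u)"
  unfolding oct_pe_def[abs_def] oct_pe_deriv_def
  by (auto intro!: derivative_eq_intros simp: power2_eq_square algebra_simps)

text \<open>Here 21 + 3 u is 3/2 of the derivative of \<open>oct_pf\<close>. This and
  \<open>oct_identity_lower\<close> express that the two forms of \<open>oct_R\<close>, through
  \<open>oct_pf\<close> and through \<open>oct_pv\<close>, have the derivative stated in
  \<open>has_real_derivative_oct_R\<close>.\<close>

lemma oct_identity_raise: "oct_pf u * oct_pe_deriv u + 54 * (1 - u) ^ 3 = (21 + 3 * u) * oct_pe u"
  unfolding oct_pf_def oct_pe_deriv_def oct_pe_def by algebra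

lemma oct_identity_lower: "2 * (u * (1 - u)) * oct_pe_deriv u + (oct_pf u)\<^sup>2 = (1 - 5 * u) * oct_pe u"
  unfolding oct_pf_def oct_pe_deriv_def oct_pe_def by algebra

lemma has_real_derivative_oct_R:
  assumes "oct_pe u \<noteq> 0"
  shows "(oct_R has_real_derivative - 108 * (1 - u) ^ 3 * (oct_pf u)\<^sup>2 / oct_pe u ^ 3) (at u)"
proof -
  have v: "(oct_pv has_real_derivative (1 - u) ^ 3 * (1 - 5 * u)) (at u)"
    unfolding oct_pv_def[abs_def]
    by (auto intro!: derivative_eq_intros simp: power_eq_if algebra_simps)
  have p2: "((\<lambda>u. oct_pe u ^ 2) has_real_derivative 2 * oct_pe u * oct_pe_deriv u) (at u)"
    by (auto intro!: derivative_eq_intros has_real_derivative_oct_pe)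
  have d: "(oct_R has_real_derivative
      (- 108 * ((1 - u) ^ 3 * (1 - 5 * u)) * oct_pe u ^ 2 - - 108 * oct_pv u * (2 * oct_pe u * oct_pe_deriv u))
        / (oct_pe u ^ 2 * oct_pe u ^ 2)) (at u)"
    unfolding oct_R_def[abs_def]
    by (rule DERIV_divide[OF DERIV_cmult[OF v] p2]) (use assms in simp)
  have e: "- 108 * ((1 - u) ^ 3 * (1 - 5 * u)) * oct_pe u ^ 2 - - 108 * oct_pv u * (2 * oct_pe u * oct_pe_deriv u)
      = oct_pe u * (- 108 * (1 - u) ^ 3 * ((1 - 5 * u) * oct_pe u - 2 * (u * (1 - u)) * oct_pe_deriv u))"
    unfolding oct_pv_def by algebra
  have e2: "(1 - 5 * u) * oct_pe u - 2 * (u * (1 - u)) * oct_pe_deriv u = (oct_pf u)\<^sup>2"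
    using oct_identity_lower[of u] by linarith
  have "oct_pe u * X / (oct_pe u ^ 2 * oct_pe u ^ 2) = X / oct_pe u ^ 3" for X
    using assms by (simp add: power2_eq_square power3_eq_cube)
  then show ?thesis using d unfolding e e2 by simp
qed

text \<open>All ladder steps only use the values at \<open>u\<close> of the Gauss function, \<open>f\<close>, and of its derivative, \<open>f'\<close>.\<close>

context
  fixes u al p f f' r r' z :: real
  assumes pe: "oct_pe u \<noteq> 0" and pf: "oct_pf u \<noteq> 0" and u1: "1 - u \<noteq> 0"
  assumes f: "f = p * r"
    and f': "f' * (- 108 * (1 - u) ^ 3 * (oct_pf u)\<^sup>2 / oct_pe u ^ 3)
      = al * (p / oct_pe u) * oct_pe_deriv u * r + p * r'"
    and z: "z = oct_R u"
begin

lemma oct_z: "z = - 108 * (u * (1 - u) * (1 - u) ^ 3) / (oct_pe u)\<^sup>2" (is ?g1) "1 - z = oct_pf u ^ 3 / (oct_pe u)\<^sup>2"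
proof -
  show ?g1
    unfolding z oct_R_def oct_pv_def by (simp add: power_eq_if)
  show "1 - z = oct_pf u ^ 3 / (oct_pe u)\<^sup>2" unfolding z oct_R_alt[OF pe] by simp
qed

lemma oct_f': "f' = p * (oct_pe u)\<^sup>2 * (al * oct_pe_deriv u * r + oct_pe u * r') / (- 108 * (1 - u) ^ 3 * (oct_pf u)\<^sup>2)"
proof -
  have aux: "x = p * P\<^sup>2 * (al * d * r + P * r') / Q"
    if "x * (Q / P ^ 3) = al * (p / P) * d * r + p * r'" "Q \<noteq> 0" "P \<noteq> 0" for x P d Q :: real
  proof -
    have "x * Q = x * (Q / P ^ 3) * P ^ 3" using that(3) by simp
    also have "\<dots> = p * P\<^sup>2 * (al * d * r + P * r')"
      unfolding that(1) using that(3) by (simp add: power2_eq_square power3_eq_cube algebra_simps)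
    finally show ?thesis using that(2) by (simp add: eq_divide_eq)
  qed
  show ?thesis by (rule aux[OF f']) (use pe pf u1 in auto)
qed

lemma oct_z_f':
  "(1 - z) * z * f' = p / (oct_pe u)\<^sup>2 * (oct_pf u * (u * (1 - u)) * (al * oct_pe_deriv u * r + oct_pe u * r'))" (is ?g1)
  "z * f' = p / (oct_pf u)\<^sup>2 * (u * (1 - u) * (al * oct_pe_deriv u * r + oct_pe u * r'))" (is ?g2)
  "(1 - z) * f' = - p * oct_pf u / (108 * (1 - u) ^ 3) * (al * oct_pe_deriv u * r + oct_pe u * r')" (is ?g3)
proof -
  have aux: "F ^ 3 / P\<^sup>2 * (- 108 * (U * v) / P\<^sup>2) * (p * P\<^sup>2 * W / (- 108 * v * F\<^sup>2)) = p / P\<^sup>2 * (F * U * W)"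
    "- 108 * (U * v) / P\<^sup>2 * (p * P\<^sup>2 * W / (- 108 * v * F\<^sup>2)) = p / F\<^sup>2 * (U * W)"
    "F ^ 3 / P\<^sup>2 * (p * P\<^sup>2 * W / (- 108 * v * F\<^sup>2)) = - p * F / (108 * v) * W"
    if "v \<noteq> 0" "F \<noteq> 0" "P \<noteq> 0" for v F P W U :: real
    using that by (simp_all add: power2_eq_square power3_eq_cube ac_simps)
  have v: "(1 - u) ^ 3 \<noteq> 0" using u1 by simp
  show ?g1
    unfolding oct_z(2) unfolding oct_z(1) oct_f' by (rule aux(1)[OF v pf pe])
  show ?g2
    unfolding oct_z(1) oct_f' by (rule aux(2)[OF v pf pe])
  show ?g3
    unfolding oct_z(2) oct_f' by (rule aux(3)[OF v pf pe])
qed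

text \<open>Over the common denominator pe^2, the identity \<open>oct_identity_raise\<close> makes
  the whole numerator divisible by pe. The one factor that stays below is the drop of the exponent
  \<open>al\<close> by 1.\<close>

lemma oct_raise_point:
  assumes a: "a = al / 2" and k: "\<kappa> \<noteq> 0" and g: "\<kappa> * g = (1 - z) * z * f' + (\<kappa> - a * z) * f"
  shows "g = p / oct_pe u * ((oct_pf u * (u * (1 - u)) * r' + (al * (u * (1 - u)) * (21 + 3 * u) + \<kappa> * oct_pe u) * r) / \<kappa>)"
proof -
  have aux: "p / P\<^sup>2 * (F * U * (al * d * r + P * r')) + (\<kappa> - a * (- 108 * (U * v) / P\<^sup>2)) * (p * r)
      = p / P * (F * U * r' + (al * U * Y + \<kappa> * P) * r)"
    if "P \<noteq> 0" "F * d + 54 * v = Y * P" for P F U d v Y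
  proof -
    \<comment> \<open>With the inverse as a variable tied by one relation, the fraction identity
      becomes polynomial and \<open>algebra\<close> applies.\<close>
    define i where "i = inverse (P\<^sup>2)"
    have i: "i * P\<^sup>2 = 1" "al = 2 * a" using that(1) a by (simp_all add: i_def)
    have "p * i * (F * U * (al * d * r + P * r')) + (\<kappa> - a * (- 108 * (U * v) * i)) * (p * r)
      = p * i * (F * U * (P * r') + (al * U * (F * d + 54 * v) + \<kappa> * P\<^sup>2) * r)"
      using i by algebra
    then have "p / P\<^sup>2 * (F * U * (al * d * r + P * r')) + (\<kappa> - a * (- 108 * (U * v) / P\<^sup>2)) * (p * r)
      = p / P\<^sup>2 * (F * U * (P * r') + (al * U * (F * d + 54 * v) + \<kappa> * P\<^sup>2) * r)"
      unfolding divide_inverse i_def .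
    also have "\<dots> = p / P\<^sup>2 * (P * (F * U * r' + (al * U * Y + \<kappa> * P) * r))"
      unfolding that(2) by (simp add: power2_eq_square algebra_simps)
    also have "\<dots> = p / P * (F * U * r' + (al * U * Y + \<kappa> * P) * r)"
      using that(1) by (simp add: power2_eq_square)
    finally show ?thesis .
  qed
  have "\<kappa> * g = p / oct_pe u * (oct_pf u * (u * (1 - u)) * r' + (al * (u * (1 - u)) * (21 + 3 * u) + \<kappa> * oct_pe u) * r)"
    unfolding g oct_z_f'(1) f unfolding oct_z(1)
    by (rule aux[OF pe oct_identity_raise])
  moreover have "y / \<kappa> * x = g" if "\<kappa> * g = y * x" for x y
    using that k by (metis nonzero_mult_div_cancel_left times_divide_eq_left)
  ultimately show ?thesis by (metis times_divide_eq_left times_divide_eq_right)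
qed

text \<open>Now \<open>oct_identity_lower\<close> brings out a factor pe in the numerator while pf^2
  stays below. So the exponent of \<open>oct_pe\<close> rises by 1 and r acquires a pole at the
  zeros of pf at most.\<close>

lemma oct_lower_n_point:
  assumes a: "a = al / 2" "al \<noteq> 0" and g: "a * g = z * f' + a * f"
  shows "g = p * oct_pe u * (2 / al / (oct_pf u)\<^sup>2 * (u * (1 - u) * r' + al * (1 - 5 * u) / 2 * r))"
proof -
  have aux: "p / F\<^sup>2 * (U * (al * d * r + P * r')) + a * (p * r)
      = a * (p * P * (2 / al / F\<^sup>2 * (U * r' + al * (Y) / 2 * r)))"
    if "F \<noteq> 0" "2 * U * d + F\<^sup>2 = Y * P" for P F U d Y
  proof -
    define i where "i = inverse (F\<^sup>2)"
    have i: "i * F\<^sup>2 = 1" "al = 2 * a" using that(1) a(1) by (simp_all add: i_def)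
    have "p * i * (U * (al * d * r + P * r')) + a * (p * r)
      = p * i * (U * P * r' + a * (2 * U * d + F\<^sup>2) * r)"
      using i by algebra
    then have "p / F\<^sup>2 * (U * (al * d * r + P * r')) + a * (p * r)
      = p / F\<^sup>2 * (U * P * r' + a * (2 * U * d + F\<^sup>2) * r)"
      unfolding divide_inverse i_def .
    also have "\<dots> = p / F\<^sup>2 * (P * (U * r' + al * Y / 2 * r))"
      unfolding that(2) a(1) by (simp add: algebra_simps)
    also have "\<dots> = a * (p * P * (2 / al / F\<^sup>2 * (U * r' + al * Y / 2 * r)))"
    proof -
      have "p / G * (P * Z) = a * (p * P * (2 / al / G * Z))" for G Z
        unfolding a(1) using a(2) by simp
      then show ?thesis .
    qed
    finally show ?thesis .
  qed
  have "a * g = a * (p * oct_pe u * (2 / al / (oct_pf u)\<^sup>2 * (u * (1 - u) * r' + al * (1 - 5 * u) / 2 * r)))"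
    using g unfolding oct_z_f'(2) f unfolding aux[OF pf oct_identity_lower] .
  moreover have "a \<noteq> 0" using a by simp
  ultimately show ?thesis by (metis mult_left_cancel)
qed

lemma oct_lower_m_point:
  assumes a: "a = al / 2" and L: "L \<noteq> 0" and g: "g / L = a * f - (1 - z) * f'"
  shows "g = p * oct_pe u * (L / (108 * (1 - u) ^ 3) * (al * (21 + 3 * u) * r + oct_pf u * r'))"
proof -
  have aux: "a * (p * r) - - p * F / (108 * v) * (al * d * r + P * r')
      = p * P * (1 / (108 * v) * (al * Y * r + F * r'))"
    if "v \<noteq> 0" "F * d + 54 * v = Y * P" for P F v d Y
  proof -
    define i where "i = inverse (108 * v)"
    have i: "i * (108 * v) = 1" "al = 2 * a" using that(1) a by (simp_all add: i_def)
    have "a * (p * r) - - p * F * i * (al * d * r + P * r')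
      = p * (1 * i * (al * (F * d + 54 * v) * r + F * P * r'))"
      using i by algebra
    then have "a * (p * r) - - p * F / (108 * v) * (al * d * r + P * r')
      = p * (1 / (108 * v) * (al * (F * d + 54 * v) * r + F * P * r'))"
      unfolding divide_inverse i_def .
    also have "\<dots> = p * P * (1 / (108 * v) * (al * Y * r + F * r'))"
    proof -
      have "p * (j * (al * (Y * P) * r + F * P * r')) = p * P * (j * (al * Y * r + F * r'))" for j by algebra
      then show ?thesis unfolding that(2) .
    qed
    finally show ?thesis .
  qed
  have v: "(1 - u) ^ 3 \<noteq> 0" using u1 by simp
  have "g / L = p * oct_pe u * (1 / (108 * (1 - u) ^ 3) * (al * (21 + 3 * u) * r + oct_pf u * r'))"
    using g unfolding oct_z_f'(3) f unfolding aux[OF v oct_identity_raise] .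
  then show ?thesis using L by (simp add: divide_eq_eq)
qed

end

section \<open>Transport of the defining equation near u = 0\<close>

lemma eventually_nhds_isCont:
  fixes f :: "real \<Rightarrow> real"
  assumes "isCont f x" "a < f x" "f x < b"
  shows "\<forall>\<^sub>F y in nhds x. a < f y \<and> f y < b"
proof -
  have "(f \<longlongrightarrow> f x) (nhds x)"
    using assms(1) unfolding isCont_def tendsto_at_iff_tendsto_nhds .
  then show ?thesis
    using assms(2,3) by (intro eventually_conj order_tendstoD)
qed

lemma eventually_oct_near_0:
  "\<forall>\<^sub>F u in nhds 0. oct_pe u > 0 \<and> oct_pf u \<noteq> 0 \<and> 1 - u \<noteq> 0 \<and> \<bar>oct_R u\<bar> < 1"
proof -
  have 1: "isCont oct_pe 0" by (rule DERIV_isCont[OF has_real_derivative_oct_pe])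
  have 2: "isCont oct_pf 0" unfolding oct_pf_def[abs_def] by (intro continuous_intros)
  have 3: "isCont (\<lambda>u::real. 1 - u) 0" by (intro continuous_intros)
  have 4: "isCont oct_R 0" by (rule DERIV_isCont[OF has_real_derivative_oct_R]) (simp add: oct_pe_def)
  have "\<forall>\<^sub>F u in nhds 0. 0 < oct_pe u \<and> oct_pe u < 2" "\<forall>\<^sub>F u in nhds 0. 0 < oct_pf u \<and> oct_pf u < 2"
    "\<forall>\<^sub>F u in nhds 0. 0 < 1 - u \<and> 1 - u < (2::real)" "\<forall>\<^sub>F u in nhds 0. - 1 < oct_R u \<and> oct_R u < 1"
    by (rule eventually_nhds_isCont[OF 1] eventually_nhds_isCont[OF 2]
        eventually_nhds_isCont[OF 3] eventually_nhds_isCont[OF 4];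
      simp add: oct_pe_def oct_pf_def oct_R_def oct_pv_def)+
  then show ?thesis by eventually_elim auto
qed

context
  fixes n m :: real and \<rho> \<rho>' :: "real \<Rightarrow> real"
  assumes hyp: "oct_hyp n m \<rho>"
    and der: "\<forall>\<^sub>F u in nhds 0. (\<rho> has_real_derivative \<rho>' u) (at u)"
    and c: "3 / 4 - m \<notin> \<int>\<^sub>\<le>\<^sub>0"
begin

abbreviation (input) "oct_a \<equiv> - 1 / 24 - m / 2 - n / 2"
abbreviation (input) "oct_b \<equiv> 11 / 24 - m / 2 - n / 2"
abbreviation (input) "oct_c \<equiv> 3 / 4 - m"

text \<open>Differentiating the equation at a point needs it in a neighbourhood of that point; the
  nested \<open>eventually\<close> supplies this for all u near 0. Uniqueness of the derivative then
  compares the chain rule on one side with the product rule on the other.\<close>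

lemma oct_hyp_deriv:
  defines "al \<equiv> - 1 / 12 - m - n"
  shows "\<forall>\<^sub>F u in nhds 0. oct_pe u > 0 \<and> oct_pf u \<noteq> 0 \<and> 1 - u \<noteq> 0 \<and> \<bar>oct_R u\<bar> < 1
    \<and> hyp2F1 oct_a oct_b oct_c (oct_R u) = oct_pe u powr al * \<rho> u
    \<and> hyp2F1_deriv oct_a oct_b oct_c (oct_R u)
        * (- 108 * (1 - u) ^ 3 * (oct_pf u)\<^sup>2 / oct_pe u ^ 3)
      = al * (oct_pe u powr al / oct_pe u) * oct_pe_deriv u * \<rho> u + oct_pe u powr al * \<rho>' u"
proof -
  let ?F = "hyp2F1 oct_a oct_b oct_c" and ?D = "hyp2F1_deriv oct_a oct_b oct_c"
  have h: "\<forall>\<^sub>F u in nhds 0. ?F (oct_R u) = oct_pe u powr al * \<rho> u"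
    using hyp unfolding oct_hyp_def al_def .
  have "\<forall>\<^sub>F u in nhds 0. \<forall>\<^sub>F v in nhds u. ?F (oct_R v) = oct_pe v powr al * \<rho> v"
    using h by (simp add: eventually_eventually)
  with h der eventually_oct_near_0 show ?thesis
  proof eventually_elim
    case (elim u)
    have pe: "oct_pe u > 0" "oct_pe u \<noteq> 0" using elim by auto
    have l: "((\<lambda>u. ?F (oct_R u)) has_real_derivative
        ?D (oct_R u) * (- 108 * (1 - u) ^ 3 * (oct_pf u)\<^sup>2 / oct_pe u ^ 3)) (at u)"
      by (rule DERIV_chain2[OF has_real_derivative_hyp2F1[OF c] has_real_derivative_oct_R[OF pe(2)]])
        (use elim in auto)
    have "(oct_pe has_real_derivative oct_pe u * (oct_pe_deriv u / oct_pe u)) (at u)"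
      using has_real_derivative_oct_pe[of u] pe by simp
    from has_real_derivative_powr_log[OF this pe(1), of al]
    have p: "((\<lambda>u. oct_pe u powr al) has_real_derivative
        oct_pe u powr al * (al * (oct_pe_deriv u / oct_pe u))) (at u)" .
    have r: "((\<lambda>u. oct_pe u powr al * \<rho> u) has_real_derivative
        oct_pe u powr al * (al * (oct_pe_deriv u / oct_pe u)) * \<rho> u + \<rho>' u * oct_pe u powr al) (at u)"
      by (rule DERIV_mult[OF p]) (use elim in auto)
    have "((\<lambda>u. ?F (oct_R u)) has_real_derivative
        oct_pe u powr al * (al * (oct_pe_deriv u / oct_pe u)) * \<rho> u + \<rho>' u * oct_pe u powr al) (at u)"
      using r elim(4) by (subst DERIV_cong_ev[OF refl _ refl]) auto
    from DERIV_unique[OF l this] show ?case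
      using elim by (simp add: ac_simps)
  qed
qed

text \<open>A step in n or m moves a and b both by one half. As b - a = 1/2, this is up to order a
  step by 1 in a single entry: {a, b} becomes {b - 1, a} or {b, a + 1}. So first order contiguity
  relations suffice, followed by \<open>hyp2F1_sym\<close>.\<close>

lemma oct_params:
  "- 1 / 24 - m / 2 - (n + 1) / 2 = 11 / 24 - m / 2 - n / 2 - 1"
  "11 / 24 - m / 2 - (n + 1) / 2 = - 1 / 24 - m / 2 - n / 2"
  "- 1 / 24 - (m + 1) / 2 - n / 2 = 11 / 24 - m / 2 - n / 2 - 1"
  "11 / 24 - (m + 1) / 2 - n / 2 = - 1 / 24 - m / 2 - n / 2"
  "- 1 / 24 - m / 2 - (n - 1) / 2 = 11 / 24 - m / 2 - n / 2"
  "11 / 24 - m / 2 - (n - 1) / 2 = - 1 / 24 - m / 2 - n / 2 + 1"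
  "- 1 / 24 - (m - 1) / 2 - n / 2 = 11 / 24 - m / 2 - n / 2"
  "11 / 24 - (m - 1) / 2 - n / 2 = - 1 / 24 - m / 2 - n / 2 + 1"
  "3 / 4 - (m + 1) = 3 / 4 - m - 1" "3 / 4 - (m - 1) = 3 / 4 - m + 1"
  by (simp_all add: add_divide_distrib diff_divide_distrib)

lemma oct_a_half: "- 1 / 24 - m / 2 - n / 2 = (- 1 / 12 - m - n) / 2"
  by (simp add: diff_divide_distrib)

lemma powr_oct_pe_shift:
  assumes "oct_pe u > 0"
  shows "oct_pe u powr (- 1 / 12 - m - (n + 1)) = oct_pe u powr (- 1 / 12 - m - n) / oct_pe u" (is ?g1)
    "oct_pe u powr (- 1 / 12 - (m + 1) - n) = oct_pe u powr (- 1 / 12 - m - n) / oct_pe u" (is ?g2)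
    "oct_pe u powr (- 1 / 12 - m - (n - 1)) = oct_pe u powr (- 1 / 12 - m - n) * oct_pe u" (is ?g3)
    "oct_pe u powr (- 1 / 12 - (m - 1) - n) = oct_pe u powr (- 1 / 12 - m - n) * oct_pe u" (is ?g4)
proof -
  have 1: "- 1 / 12 - m - (n + 1) = - 1 / 12 - m - n - 1" "- 1 / 12 - (m + 1) - n = - 1 / 12 - m - n - 1"
    "- 1 / 12 - m - (n - 1) = - 1 / 12 - m - n + 1" "- 1 / 12 - (m - 1) - n = - 1 / 12 - m - n + 1" by simp_all
  show ?g1 ?g2 ?g3 ?g4
    unfolding 1 powr_add powr_diff using assms by simp_all
qed

lemma oct_hyp_raise_n:
  assumes nz: "7 / 24 + (n - m) / 2 \<noteq> 0"
  shows "oct_hyp (n + 1) m (oct_raise (7 / 24 + (n - m) / 2) n m \<rho> \<rho>')"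
  unfolding oct_hyp_def using oct_hyp_deriv
proof eventually_elim
  case (elim u)
  then have h: "oct_pe u > 0" "oct_pe u \<noteq> 0" "oct_pf u \<noteq> 0" "1 - u \<noteq> 0" "\<bar>oct_R u\<bar> < 1" by auto
  let ?z = "oct_R u"
  have k: "7 / 24 + (n - m) / 2 = oct_c - oct_b" by (simp add: diff_divide_distrib)
  have "(7 / 24 + (n - m) / 2) * hyp2F1 oct_a (oct_b - 1) oct_c ?z = (1 - ?z) * ?z * hyp2F1_deriv oct_a oct_b oct_c ?z
      + ((7 / 24 + (n - m) / 2) - oct_a * ?z) * hyp2F1 oct_a oct_b oct_c ?z"
    using hyp2F1_b_minus1[OF c h(5), of oct_b oct_a] unfolding k by (simp add: algebra_simps)
  from oct_raise_point[OF h(2-4) _ _ refl oct_a_half nz this] elim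
  have "hyp2F1 oct_a (oct_b - 1) oct_c ?z = oct_pe u powr (- 1 / 12 - m - n) / oct_pe u
      * oct_raise (7 / 24 + (n - m) / 2) n m \<rho> \<rho>' u"
    unfolding oct_raise_def by blast
  then show ?case
    unfolding oct_params powr_oct_pe_shift[OF h(1)] hyp2F1_sym[of "oct_b - 1"] .
qed

lemma oct_hyp_raise_m:
  assumes nz: "- 1 / 4 - m \<notin> \<int>\<^sub>\<le>\<^sub>0"
  shows "oct_hyp n (m + 1) (oct_raise (- 1 / 4 - m) n m \<rho> \<rho>')"
  unfolding oct_hyp_def using oct_hyp_deriv
proof eventually_elim
  case (elim u)
  then have h: "oct_pe u > 0" "oct_pe u \<noteq> 0" "oct_pf u \<noteq> 0" "1 - u \<noteq> 0" "\<bar>oct_R u\<bar> < 1" by auto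
  let ?z = "oct_R u"
  have k: "- 1 / 4 - m = oct_c - 1" by simp
  have nz': "- 1 / 4 - m \<noteq> 0" using nz by auto
  have "(- 1 / 4 - m) * hyp2F1 oct_a (oct_b - 1) (oct_c - 1) ?z = (1 - ?z) * ?z * hyp2F1_deriv oct_a oct_b oct_c ?z
      + ((- 1 / 4 - m) - oct_a * ?z) * hyp2F1 oct_a oct_b oct_c ?z"
    unfolding k by (rule hyp2F1_b_c_minus1[OF c h(5)]) (use nz k in simp)
  from oct_raise_point[OF h(2-4) _ _ refl oct_a_half nz' this] elim
  have "hyp2F1 oct_a (oct_b - 1) (oct_c - 1) ?z = oct_pe u powr (- 1 / 12 - m - n) / oct_pe u
      * oct_raise (- 1 / 4 - m) n m \<rho> \<rho>' u"
    unfolding oct_raise_def by blast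
  then show ?case
    unfolding oct_params powr_oct_pe_shift[OF h(1)] hyp2F1_sym[of "oct_b - 1"] .
qed

lemma oct_hyp_lower_n:
  assumes nz: "- 1 / 12 - m - n \<noteq> 0"
  shows "oct_hyp (n - 1) m (oct_lower_n n m \<rho> \<rho>')"
  unfolding oct_hyp_def using oct_hyp_deriv
proof eventually_elim
  case (elim u)
  then have h: "oct_pe u > 0" "oct_pe u \<noteq> 0" "oct_pf u \<noteq> 0" "1 - u \<noteq> 0" "\<bar>oct_R u\<bar> < 1" by auto
  let ?z = "oct_R u"
  from oct_lower_n_point[OF h(2-4) _ _ refl oct_a_half nz hyp2F1_a_plus1[OF c h(5), of oct_a oct_b]] elim
  have "hyp2F1 (oct_a + 1) oct_b oct_c ?z = oct_pe u powr (- 1 / 12 - m - n) * oct_pe u * oct_lower_n n m \<rho> \<rho>' u"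
    unfolding oct_lower_n_def by blast
  then show ?case
    unfolding oct_params powr_oct_pe_shift[OF h(1)] hyp2F1_sym[of oct_b] .
qed

lemma oct_hyp_lower_m:
  assumes nz: "- 1 / 12 - m - n \<noteq> 0" "7 / 24 + (n - m) / 2 \<noteq> 0"
  shows "oct_hyp n (m - 1) (oct_lower_m n m \<rho> \<rho>')"
  unfolding oct_hyp_def using oct_hyp_deriv
proof eventually_elim
  case (elim u)
  then have h: "oct_pe u > 0" "oct_pe u \<noteq> 0" "oct_pf u \<noteq> 0" "1 - u \<noteq> 0" "\<bar>oct_R u\<bar> < 1" by auto
  let ?z = "oct_R u"
  let ?L = "oct_c / (oct_a * (7 / 24 + (n - m) / 2))"
  have k: "7 / 24 + (n - m) / 2 = oct_c - oct_b" by (simp add: diff_divide_distrib)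
  have "oct_c \<noteq> 0" using not_nonpos_Int_add_nat[OF c, of 0] by simp
  moreover have "oct_a \<noteq> 0" unfolding oct_a_half using nz(1) by simp
  ultimately have L: "?L \<noteq> 0" using nz(2) by simp
  have "hyp2F1 (oct_a + 1) oct_b (oct_c + 1) ?z / ?L = oct_a * (oct_c - oct_b) / oct_c * hyp2F1 (oct_a + 1) oct_b (oct_c + 1) ?z"
  proof -
    have "X / (p / q) = q / p * X" for X p q :: real by simp
    then show ?thesis unfolding k .
  qed
  also have "\<dots> = oct_a * hyp2F1 oct_a oct_b oct_c ?z - (1 - ?z) * hyp2F1_deriv oct_a oct_b oct_c ?z"
    by (rule hyp2F1_a_c_plus1[OF c h(5)])
  finally have e: "hyp2F1 (oct_a + 1) oct_b (oct_c + 1) ?z / ?L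
    = oct_a * hyp2F1 oct_a oct_b oct_c ?z - (1 - ?z) * hyp2F1_deriv oct_a oct_b oct_c ?z" .
  from oct_lower_m_point[OF h(2-4) _ _ refl oct_a_half L e] elim
  have "hyp2F1 (oct_a + 1) oct_b (oct_c + 1) ?z = oct_pe u powr (- 1 / 12 - m - n) * oct_pe u * oct_lower_m n m \<rho> \<rho>' u"
    unfolding oct_lower_m_def by blast
  then show ?case
    unfolding oct_params powr_oct_pe_shift[OF h(1)] hyp2F1_sym[of oct_b] .
qed

end

section \<open>Rational functions with poles at the zeros of \<open>1 - u\<close> and \<open>1 + 14 u + u\<^sup>2\<close>\<close>

text \<open>The only denominators that the ladder operators introduce: \<open>oct_lower_n\<close>
  divides by pf^2 and \<open>oct_lower_m\<close> by (1 - u)^3. It vanishes neither at 0 nor on the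
  range of \<open>oct_u\<close>.\<close>

definition oct_den :: "real poly" where
  "oct_den = [:1, -1:] * [:1, 14, 1:]"

lemma poly_oct_den: "poly oct_den u = (1 - u) * oct_pf u"
  by (simp add: oct_den_def oct_pf_def power2_eq_square algebra_simps)

text \<open>Real functions rather than elements of the fraction field, since they have to be
  differentiated. At the zeros of \<open>oct_den\<close> the value is left open.\<close>

definition oct_rat :: "(real \<Rightarrow> real) \<Rightarrow> bool" where
  "oct_rat f \<longleftrightarrow> (\<exists>p k. \<forall>u. poly oct_den u \<noteq> 0 \<longrightarrow> f u = poly p u / poly oct_den u ^ k)"

lemma oct_ratI: "(\<And>u. poly oct_den u \<noteq> 0 \<Longrightarrow> f u = poly p u / poly oct_den u ^ k) \<Longrightarrow> oct_rat f"
  unfolding oct_rat_def by blast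

lemma oct_rat_const: "oct_rat (\<lambda>u. c)"
  by (rule oct_ratI[of _ "[:c:]" 0]) simp

lemma oct_rat_ident: "oct_rat (\<lambda>u. u)"
  by (rule oct_ratI[of _ "[:0, 1:]" 0]) simp

lemma oct_rat_mult: "oct_rat f \<Longrightarrow> oct_rat g \<Longrightarrow> oct_rat (\<lambda>u. f u * g u)"
proof -
  assume "oct_rat f" "oct_rat g"
  then obtain p k q l where
    "\<And>u. poly oct_den u \<noteq> 0 \<Longrightarrow> f u = poly p u / poly oct_den u ^ k"
    "\<And>u. poly oct_den u \<noteq> 0 \<Longrightarrow> g u = poly q u / poly oct_den u ^ l"
    unfolding oct_rat_def by blast
  then show ?thesis
    by (intro oct_ratI[of _ "p * q" "k + l"]) (simp add: power_add)
qed

lemma oct_rat_add: "oct_rat f \<Longrightarrow> oct_rat g \<Longrightarrow> oct_rat (\<lambda>u. f u + g u)"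
proof -
  assume "oct_rat f" "oct_rat g"
  then obtain p k q l where
    "\<And>u. poly oct_den u \<noteq> 0 \<Longrightarrow> f u = poly p u / poly oct_den u ^ k"
    "\<And>u. poly oct_den u \<noteq> 0 \<Longrightarrow> g u = poly q u / poly oct_den u ^ l"
    unfolding oct_rat_def by blast
  then show ?thesis
    by (intro oct_ratI[of _ "p * oct_den ^ l + q * oct_den ^ k" "k + l"])
      (simp add: power_add add_divide_distrib)
qed

lemma oct_rat_diff: "oct_rat f \<Longrightarrow> oct_rat g \<Longrightarrow> oct_rat (\<lambda>u. f u - g u)"
  using oct_rat_add[OF _ oct_rat_mult[OF oct_rat_const[of "-1"]], of f g] by simp

lemma oct_rat_power: "oct_rat f \<Longrightarrow> oct_rat (\<lambda>u. f u ^ k)"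
  by (induction k) (auto intro: oct_rat_const oct_rat_mult)

lemma oct_rat_oct_pf: "oct_rat oct_pf" and oct_rat_oct_pe: "oct_rat oct_pe"
  unfolding oct_pf_def[abs_def] oct_pe_def[abs_def]
  by (intro oct_rat_add oct_rat_diff oct_rat_mult oct_rat_const oct_rat_ident oct_rat_power)+

lemma oct_rat_inverse: "oct_rat (\<lambda>u. 1 / (1 - u))" "oct_rat (\<lambda>u. 1 / oct_pf u)"
proof -
  show "oct_rat (\<lambda>u. 1 / (1 - u))"
  proof (rule oct_ratI[of _ "[:1, 14, 1:]" 1])
    fix u :: real
    have "poly [:1, 14, 1:] u = oct_pf u" by (simp add: oct_pf_def power2_eq_square algebra_simps)
    then show "poly oct_den u \<noteq> 0 \<Longrightarrow> 1 / (1 - u) = poly [:1, 14, 1:] u / poly oct_den u ^ 1"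
      by (simp add: poly_oct_den)
  qed
  show "oct_rat (\<lambda>u. 1 / oct_pf u)"
    by (rule oct_ratI[of _ "[:1, -1:]" 1])
      (auto simp: poly_oct_den)
qed

lemma oct_rat_divide_power: "oct_rat f \<Longrightarrow> oct_rat (\<lambda>u. f u / (1 - u) ^ k)"
  "oct_rat f \<Longrightarrow> oct_rat (\<lambda>u. f u / oct_pf u ^ k)"
  using oct_rat_mult[OF _ oct_rat_power[OF oct_rat_inverse(1)], of f k]
    oct_rat_mult[OF _ oct_rat_power[OF oct_rat_inverse(2)], of f k]
  by (simp_all add: power_divide)

lemma oct_rat_derivative:
  assumes "oct_rat f"
  obtains f' where "oct_rat f'"
    "\<And>u. poly oct_den u \<noteq> 0 \<Longrightarrow> (f has_real_derivative f' u) (at u)"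
proof -
  obtain p k where f: "\<And>u. poly oct_den u \<noteq> 0 \<Longrightarrow> f u = poly p u / poly oct_den u ^ k"
    using assms unfolding oct_rat_def by blast
  define q where "q = pderiv p * oct_den ^ k - p * pderiv (oct_den ^ k)"
  define f' where "f' = (\<lambda>u. poly q u / poly oct_den u ^ (k + k))"
  have "oct_rat f'" by (rule oct_ratI[of _ q "k + k"]) (simp add: f'_def)
  moreover have "(f has_real_derivative f' u) (at u)" if u: "poly oct_den u \<noteq> 0" for u
  proof -
    have "((\<lambda>u. poly p u / poly (oct_den ^ k) u) has_real_derivative
        (poly (pderiv p) u * poly (oct_den ^ k) u - poly p u * poly (pderiv (oct_den ^ k)) u)
          / (poly (oct_den ^ k) u * poly (oct_den ^ k) u)) (at u)"
      by (rule DERIV_divide[OF poly_DERIV poly_DERIV]) (use u in simp)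
    then have d: "((\<lambda>u. poly p u / poly oct_den u ^ k) has_real_derivative f' u) (at u)"
      by (simp add: f'_def q_def power_add)
    have "isCont (poly oct_den) u" by (rule poly_isCont)
    then have "\<forall>\<^sub>F v in at u. poly oct_den v \<noteq> 0"
      using u by (simp add: isCont_def tendsto_imp_eventually_ne)
    then have "\<forall>\<^sub>F v in nhds u. poly oct_den v \<noteq> 0"
      using u by (simp add: eventually_nhds_conv_at)
    then have "\<forall>\<^sub>F v in nhds u. f v = poly p v / poly oct_den v ^ k"
      by eventually_elim (rule f)
    then show ?thesis using d by (subst DERIV_cong_ev[OF refl _ refl]) auto
  qed
  ultimately show thesis by (rule that)
qed

lemma eventually_oct_den: "\<forall>\<^sub>F u in nhds 0. poly oct_den u \<noteq> 0"
  using eventually_oct_near_0 by eventually_elim (simp add: poly_oct_den)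

lemma oct_rat_oct_raise:
  assumes "oct_rat f" "oct_rat f'"
  shows "oct_rat (oct_raise \<kappa> n m f f')"
proof -
  have "oct_rat (\<lambda>u. (oct_pf u * (u * (1 - u)) * f' u
     + ((- 1 / 12 - m - n) * (u * (1 - u)) * (21 + 3 * u) + \<kappa> * oct_pe u) * f u) * (1 / \<kappa>))"
    by (intro oct_rat_add oct_rat_diff oct_rat_mult oct_rat_const oct_rat_ident oct_rat_oct_pf
        oct_rat_oct_pe assms)
  then show ?thesis unfolding oct_raise_def[abs_def] by simp
qed

lemma oct_rat_oct_lower_n:
  assumes "oct_rat f" "oct_rat f'"
  shows "oct_rat (oct_lower_n n m f f')"
proof -
  have "oct_rat (\<lambda>u. 2 / (- 1 / 12 - m - n)
     * (u * (1 - u) * f' u + (- 1 / 12 - m - n) * (1 - 5 * u) * (1 / 2) * f u) / oct_pf u ^ 2)"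
    by (intro oct_rat_divide_power oct_rat_add oct_rat_diff oct_rat_mult oct_rat_const oct_rat_ident assms)
  then show ?thesis unfolding oct_lower_n_def[abs_def] by simp
qed

lemma oct_rat_oct_lower_m:
  assumes "oct_rat f" "oct_rat f'"
  shows "oct_rat (oct_lower_m n m f f')"
proof -
  define L where "L = (3 / 4 - m) / ((- 1 / 24 - m / 2 - n / 2) * (7 / 24 + (n - m) / 2))"
  have "oct_rat (\<lambda>u. L * (1 / 108)
     * ((- 1 / 12 - m - n) * (21 + 3 * u) * f u + oct_pf u * f' u) / (1 - u) ^ 3)"
    by (intro oct_rat_divide_power oct_rat_add oct_rat_diff oct_rat_mult oct_rat_const oct_rat_ident
        oct_rat_oct_pf assms)
  then show ?thesis unfolding oct_lower_m_def[abs_def] L_def[symmetric] by simp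
qed

text \<open>Reduction to lowest terms can only lose zeros of the denominator: q is coprime to p and
  divides p D, hence divides D.\<close>

lemma eval_ratfun_Fract:
  assumes "poly D u \<noteq> 0"
  shows "eval_ratfun (Fract P D) u = poly P u / poly D u"
proof -
  define p q where "p = fst (quot_of_fract (Fract P D))" and "q = snd (quot_of_fract (Fract P D))"
  have D: "D \<noteq> 0" using assms by auto
  have q0: "q \<noteq> 0" unfolding q_def by (rule snd_quot_of_fract_nonzero)
  have "Fract p q = Fract P D" unfolding p_def q_def by (rule Fract_quot_of_fract)
  then have e: "p * D = P * q" using D q0 by (simp add: eq_fract)
  have "coprime p q" unfolding p_def q_def by (rule coprime_quot_of_fract)
  moreover have "q dvd p * D" unfolding e by simp
  ultimately have "q dvd D" by (simp add: coprime_commute coprime_dvd_mult_right_iff)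
  then have "poly q u \<noteq> 0" using assms by (auto elim!: dvdE)
  moreover have "poly p u * poly D u = poly P u * poly q u"
    using arg_cong[OF e, of "\<lambda>p. poly p u"] by simp
  ultimately show ?thesis
    using assms unfolding eval_ratfun_def
    by (simp add: case_prod_beta p_def[symmetric] q_def[symmetric] frac_eq_eq)
qed

lemma eval_ratfun_inject:
  assumes "\<forall>\<^sub>F u in nhds a. eval_ratfun r u = eval_ratfun s u"
  shows "r = s"
proof -
  obtain p q where r: "r = Fract p q" "q \<noteq> 0" by (cases r) auto
  obtain p' q' where s: "s = Fract p' q'" "q' \<noteq> 0" by (cases s) auto
  obtain e where e: "e > 0" "\<And>u. dist u a < e \<Longrightarrow> eval_ratfun r u = eval_ratfun s u"
    using assms unfolding eventually_nhds_metric by blast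
  \<comment> \<open>The factor \<open>q * q'\<close> makes the zeros of the denominators roots of h
    too, as \<open>eval_ratfun\<close> gives no information there. So h has a whole interval of
    roots.\<close>
  define h where "h = (p * q' - p' * q) * q * q'"
  have "poly h u = 0" if u: "u \<in> {a<..<a + e}" for u
  proof (cases "poly q u = 0 \<or> poly q' u = 0")
    case False
    then have "poly p u / poly q u = poly p' u / poly q' u"
      using e(2)[of u] u unfolding r s by (simp add: eval_ratfun_Fract dist_real_def)
    with False show ?thesis by (simp add: h_def frac_eq_eq)
  qed (auto simp: h_def)
  then have "{a<..<a + e} \<subseteq> {u. poly h u = 0}" by blast
  then have "infinite {u. poly h u = 0}"
    using e(1) by (meson finite_subset infinite_Ioo less_add_same_cancel1)
  then have "h = 0" using poly_roots_finite by blast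
  then have "p * q' = p' * q" using r(2) s(2) by (simp add: h_def)
  then show ?thesis using r s by (simp add: eq_fract)
qed

text \<open>The passage from the local definition of \<open>oct_r\<close> to far away points: near 0
  the rational function is unique, and off the zeros of \<open>oct_den\<close> it is given by the
  same quotient as \<rho> everywhere.\<close>

lemma eval_ratfun_oct_r:
  assumes \<rho>: "oct_rat \<rho>" "oct_hyp (of_int n) (of_int m) \<rho>" and u: "poly oct_den u \<noteq> 0"
  shows "eval_ratfun (oct_r n m) u = \<rho> u"
proof -
  obtain p k where f: "\<And>u. poly oct_den u \<noteq> 0 \<Longrightarrow> \<rho> u = poly p u / poly oct_den u ^ k"
    using \<rho>(1) unfolding oct_rat_def by blast
  define r where "r = Fract p (oct_den ^ k)"
  have r: "eval_ratfun r u = \<rho> u" if "poly oct_den u \<noteq> 0" for u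
    using that by (simp add: r_def eval_ratfun_Fract f)
  let ?F = "\<lambda>u. hyp2F1 (- 1 / 24 - of_int m / 2 - of_int n / 2) (11 / 24 - of_int m / 2 - of_int n / 2)
         (3 / 4 - of_int m) (oct_R u)"
  let ?p = "\<lambda>u. oct_pe u powr (- 1 / 12 - of_int m - of_int n)"
  have Fr: "\<forall>\<^sub>F u in nhds 0. ?F u = ?p u * eval_ratfun r u"
    using \<rho>(2) eventually_oct_den unfolding oct_hyp_def by eventually_elim (simp add: r)
  have "oct_r n m = r"
    unfolding oct_r_def
  proof (rule the_equality)
    show "\<forall>\<^sub>F u in nhds 0. ?F u = ?p u * eval_ratfun r u" by (rule Fr)
  next
    fix s assume "\<forall>\<^sub>F u in nhds 0. ?F u = ?p u * eval_ratfun s u"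
    with Fr eventually_oct_near_0 have "\<forall>\<^sub>F u in nhds 0. eval_ratfun s u = eval_ratfun r u"
      by eventually_elim auto
    then show "s = r" by (rule eval_ratfun_inject)
  qed
  then show ?thesis using r[OF u] by simp
qed

text \<open>Because g \<le> 1/2, V^2/u is nonincreasing. It equals u (V/u)^2, which tends to 0 at 0
  from the right since V is differentiable at 0 with V 0 = 0. Being nonnegative as well, it
  vanishes.\<close>

lemma singular_ode_unique_pos:
  fixes V V' g :: "real \<Rightarrow> real"
  assumes der: "\<And>u. 0 \<le> u \<Longrightarrow> u < e \<Longrightarrow> (V has_real_derivative V' u) (at u)"
    and ode: "\<And>u. 0 < u \<Longrightarrow> u < e \<Longrightarrow> u * V' u = g u * V u"
    and g: "\<And>u. 0 < u \<Longrightarrow> u < e \<Longrightarrow> g u \<le> 1 / 2"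
    and V0: "V 0 = 0" and x: "0 < x" "x < e"
  shows "V x = 0"
proof -
  define h where "h = (\<lambda>u. (V u)\<^sup>2 / u)"
  have hd: "(h has_real_derivative (2 * g u - 1) * (V u)\<^sup>2 / u\<^sup>2) (at u)" if u: "0 < u" "u < e" for u
  proof -
    have "(h has_real_derivative (2 * V u * V' u * u - (V u)\<^sup>2 * 1) / (u * u)) (at u)"
      unfolding h_def using der[of u] u by (auto intro!: derivative_eq_intros)
    moreover have "2 * V u * V' u * u - (V u)\<^sup>2 * 1 = (2 * g u - 1) * (V u)\<^sup>2"
      using ode[OF u] by algebra
    ultimately show ?thesis by (simp add: power2_eq_square)
  qed
  have mono: "h x \<le> h t" if t: "0 < t" "t \<le> x" for t
  proof (rule DERIV_nonpos_imp_nonincreasing[OF t(2)])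
    fix u assume u: "t \<le> u" "u \<le> x"
    then have "0 < u" "u < e" using t x by auto
    moreover from this have "(2 * g u - 1) * (V u)\<^sup>2 / u\<^sup>2 \<le> 0"
      using g[of u] by (intro divide_nonpos_nonneg mult_nonpos_nonneg) auto
    ultimately show "\<exists>y. DERIV h u :> y \<and> y \<le> 0" using hd by blast
  qed
  have "((\<lambda>t. (V t - V 0) / (t - 0)) \<longlongrightarrow> V' 0) (at 0)"
    using der[of 0] x by (simp add: has_field_derivative_iff)
  then have "((\<lambda>t. V t / t) \<longlongrightarrow> V' 0) (at_right 0)"
    using V0 by (auto intro: filterlim_at_split[THEN iffD1, THEN conjunct2])
  then have "((\<lambda>t. t * (V t / t)\<^sup>2) \<longlongrightarrow> 0 * (V' 0)\<^sup>2) (at_right 0)"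
    by (intro tendsto_intros)
  then have lim: "((\<lambda>t. t * (V t / t)\<^sup>2) \<longlongrightarrow> 0) (at_right 0)" by simp
  have "h x \<le> 0"
  proof (rule tendsto_lowerbound[OF lim])
    show "\<forall>\<^sub>F t in at_right 0. h x \<le> t * (V t / t)\<^sup>2"
      unfolding eventually_at_right_field
    proof (intro exI conjI allI impI)
      fix t assume "0 < t" "t < x"
      then show "h x \<le> t * (V t / t)\<^sup>2"
        using mono[of t] by (simp add: h_def power2_eq_square)
    qed (use x in auto)
  qed simp
  then have "(V x)\<^sup>2 \<le> 0" using x unfolding h_def by (simp add: divide_le_0_iff)
  then show ?thesis by simp
qed

lemma singular_ode_unique:
  fixes V V' g :: "real \<Rightarrow> real"
  assumes der: "\<And>u. \<bar>u\<bar> < e \<Longrightarrow> (V has_real_derivative V' u) (at u)"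
    and ode: "\<And>u. \<bar>u\<bar> < e \<Longrightarrow> u * V' u = g u * V u"
    and g: "\<And>u. \<bar>u\<bar> < e \<Longrightarrow> g u \<le> 1 / 2"
    and V0: "V 0 = 0" and x: "\<bar>x\<bar> < e"
  shows "V x = 0"
proof -
  consider "x = 0" | "0 < x" | "0 < - x" by linarith
  then show ?thesis
  proof cases
    case 2
    show ?thesis
      by (rule singular_ode_unique_pos[of e V V' g]) (use assms 2 in auto)
  next
    case 3
    have "(\<lambda>u. V (- u)) (- x) = 0"
    proof (rule singular_ode_unique_pos[of e "\<lambda>u. V (- u)" "\<lambda>u. - V' (- u)" "\<lambda>u. g (- u)"])
      fix u assume "0 \<le> u" "u < e"
      then have "(V has_real_derivative V' (- u)) (at (- u))" using der[of "- u"] by simp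
      then have "((\<lambda>u. V (- u)) has_real_derivative V' (- u) * - 1) (at u)"
        by (rule DERIV_chain2) (auto intro!: derivative_eq_intros)
      then show "((\<lambda>u. V (- u)) has_real_derivative - V' (- u)) (at u)" by simp
    next
      fix u assume u: "0 < u" "u < e"
      show "u * - V' (- u) = g (- u) * V (- u)" using ode[of "- u"] u by simp
      show "g (- u) \<le> 1 / 2" using g[of "- u"] u by simp
    qed (use V0 x 3 in auto)
    then show ?thesis by simp
  qed (use V0 in simp)
qed

section \<open>The defining equation at n = m = 0\<close>

lemma oct_hyp_exists:
  assumes c: "3 / 4 - m \<notin> \<int>\<^sub>\<le>\<^sub>0"
  obtains \<rho> \<rho>' where "oct_hyp n m \<rho>" "\<forall>\<^sub>F u in nhds 0. (\<rho> has_real_derivative \<rho>' u) (at u)"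
proof -
  let ?F = "hyp2F1 (- 1 / 24 - m / 2 - n / 2) (11 / 24 - m / 2 - n / 2) (3 / 4 - m)"
  define \<rho> where "\<rho> = (\<lambda>u. ?F (oct_R u) / oct_pe u powr (- 1 / 12 - m - n))"
  have 1: "oct_hyp n m \<rho>"
    unfolding oct_hyp_def using eventually_oct_near_0 by eventually_elim (simp add: \<rho>_def)
  have "\<forall>\<^sub>F u in nhds 0. \<exists>D. (\<rho> has_real_derivative D) (at u)"
    using eventually_oct_near_0
  proof eventually_elim
    case (elim u)
    then have pe: "oct_pe u > 0" "oct_pe u \<noteq> 0" by auto
    note F = DERIV_chain2[OF has_real_derivative_hyp2F1[OF c] has_real_derivative_oct_R[OF pe(2)]]
    have "(oct_pe has_real_derivative oct_pe u * (oct_pe_deriv u / oct_pe u)) (at u)"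
      using has_real_derivative_oct_pe[of u] pe by simp
    note p = has_real_derivative_powr_log[OF this pe(1)]
    show ?case unfolding \<rho>_def
      by (rule exI, rule DERIV_divide[OF F p]) (use elim in auto)
  qed
  then have "\<forall>\<^sub>F u in nhds 0. (\<rho> has_real_derivative (SOME D. (\<rho> has_real_derivative D) (at u))) (at u)"
    by eventually_elim (rule someI_ex)
  with 1 show thesis by (rule that)
qed

lemma oct_hyp_unique:
  assumes "oct_hyp n m \<rho>" "oct_hyp n m \<sigma>"
  shows "\<forall>\<^sub>F u in nhds 0. \<rho> u = \<sigma> u"
  using assms eventually_oct_near_0 unfolding oct_hyp_def by eventually_elim auto

lemma three_quarters_minus_not_nonpos_Int: "3 / 4 - real_of_int m \<notin> \<int>\<^sub>\<le>\<^sub>0"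
proof
  assume "3 / 4 - real_of_int m \<in> \<int>\<^sub>\<le>\<^sub>0"
  then obtain k where "3 / 4 - real_of_int m = of_int k" by (auto elim: nonpos_Ints_cases)
  then have "real_of_int 3 = real_of_int (4 * (m + k))" by simp
  then have "3 = 4 * (m + k)" by (simp only: of_int_eq_iff)
  then show False by presburger
qed

text \<open>The quotient \<open>\<rho>\<close> of the Gauss function by \<open>oct_pe powr (-1/12)\<close> and its image \<open>\<sigma>\<close> under the
  ladder operator form a first order system which \<open>(1, r)\<close> solves too. Hence
  \<open>V = \<sigma> - r \<rho>\<close> solves a first order equation with exponent \<open>1/4\<close> at \<open>0\<close>, so \<open>V = 0\<close>, as \<open>V\<close> is differentiable there.\<close>

lemma oct_hyp_base: "oct_hyp 0 0 (\<lambda>u. 1)"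
proof -
  have c: "3 / 4 - 0 \<notin> (\<int>\<^sub>\<le>\<^sub>0 :: real set)" using three_quarters_minus_not_nonpos_Int[of 0] by simp
  obtain \<rho> \<rho>' where \<rho>: "oct_hyp 0 0 \<rho>" "\<forall>\<^sub>F u in nhds 0. (\<rho> has_real_derivative \<rho>' u) (at u)"
    using oct_hyp_exists[OF c] by blast
  obtain \<sigma> \<sigma>' where \<sigma>: "oct_hyp 1 0 \<sigma>" "\<forall>\<^sub>F u in nhds 0. (\<sigma> has_real_derivative \<sigma>' u) (at u)"
    using oct_hyp_exists[OF c] by blast
  define \<kappa> :: real where "\<kappa> = 7 / 24"
  have "oct_hyp (0 + 1) 0 (oct_raise (7 / 24 + (0 - 0) / 2) 0 0 \<rho> \<rho>')"
    by (rule oct_hyp_raise_n[OF \<rho> c]) simp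
  then have e1: "\<forall>\<^sub>F u in nhds 0. \<sigma> u = oct_raise \<kappa> 0 0 \<rho> \<rho>' u"
    using oct_hyp_unique[OF \<sigma>(1)] by (simp add: \<kappa>_def)
  have "oct_hyp (1 - 1) 0 (oct_lower_n 1 0 \<sigma> \<sigma>')"
    by (rule oct_hyp_lower_n[OF \<sigma> c]) simp
  then have e2: "\<forall>\<^sub>F u in nhds 0. \<rho> u = oct_lower_n 1 0 \<sigma> \<sigma>' u"
    using oct_hyp_unique[OF \<rho>(1)] by simp
  \<comment> \<open>The image of the constant 1 under \<open>oct_raise \<kappa> 0 0\<close>, so the
    pair (1, r) obeys the raising relation by construction.\<close>
  define r where "r = (\<lambda>u::real. 1 - 39 * u - 195 / 7 * u\<^sup>2 + 13 / 7 * u ^ 3)"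
  define r' where "r' = (\<lambda>u::real. - 39 - 390 / 7 * u + 39 / 7 * u\<^sup>2)"
  define V where "V = (\<lambda>u. \<sigma> u - r u * \<rho> u)"
  define V' where "V' = (\<lambda>u. \<sigma>' u - (r' u * \<rho> u + r u * \<rho>' u))"
  \<comment> \<open>Obtained by eliminating the derivative of \<rho> from the two ladder relations.
    Its value at 0 is 13/24 - 7/24 = 1/4, hence below 1/2 nearby.\<close>
  define g where "g = (\<lambda>u. (13 / 24 * (1 - 5 * u) - \<kappa> * r u / oct_pf u) / (1 - u))"
  have rd: "(r has_real_derivative r' u) (at u)" for u
    unfolding r_def r'_def by (auto intro!: derivative_eq_intros simp: power2_eq_square)
  have "isCont g 0" unfolding g_def r_def oct_pf_def by (intro continuous_intros) auto
  then have g: "\<forall>\<^sub>F u in nhds 0. 0 < g u \<and> g u < 1 / 2"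
    by (rule eventually_nhds_isCont) (auto simp: g_def r_def oct_pf_def \<kappa>_def)
  have "\<forall>\<^sub>F u in nhds 0. (V has_real_derivative V' u) (at u) \<and> (\<rho> has_real_derivative \<rho>' u) (at u)
    \<and> u * V' u = g u * V u \<and> g u \<le> 1 / 2 \<and> \<kappa> * V u = oct_pf u * (u * (1 - u)) * \<rho>' u
    \<and> oct_pf u * (1 - u) \<noteq> 0"
    using \<rho>(2) \<sigma>(2) e1 e2 g eventually_oct_near_0
  proof eventually_elim
    case (elim u)
    have nz: "oct_pf u \<noteq> 0" "1 - u \<noteq> 0" using elim by auto
    have 1: "(V has_real_derivative V' u) (at u)"
      unfolding V_def V'_def
      by (rule DERIV_diff[OF elim(2) DERIV_cong[OF DERIV_mult[OF rd elim(1)]]]) simp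
    have "\<kappa> * \<sigma> u = oct_pf u * (u * (1 - u)) * \<rho>' u
        + ((- 1 / 12) * (u * (1 - u)) * (21 + 3 * u) + \<kappa> * oct_pe u) * \<rho> u"
      unfolding elim(3) by (simp add: oct_raise_def \<kappa>_def)
    moreover have "(- 1 / 12) * (u * (1 - u)) * (21 + 3 * u) + \<kappa> * oct_pe u = \<kappa> * r u"
      by (simp add: \<kappa>_def r_def oct_pe_def power2_eq_square power3_eq_cube field_simps)
    ultimately have "\<kappa> * \<sigma> u = oct_pf u * (u * (1 - u)) * \<rho>' u + \<kappa> * r u * \<rho> u" by simp
    then have 2: "\<kappa> * V u = oct_pf u * (u * (1 - u)) * \<rho>' u"
      by (simp add: V_def algebra_simps)
    define k where "k = 13 / 24 * (1 - 5 * u)"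
    have aux: "2 / (- 1 / 12 - 0 - 1) / F\<^sup>2 * (W + (- 1 / 12 - 0 - 1) * Y / 2 * t) * (- 13 / 24 * F\<^sup>2)
        = W - 13 / 24 * Y * t" if "F \<noteq> 0" for F W Y t :: real
      using that by (simp add: field_simps)
    have A: "\<rho> u * (- 13 / 24 * (oct_pf u)\<^sup>2) = u * (1 - u) * \<sigma>' u - k * \<sigma> u"
      unfolding elim(4) oct_lower_n_def k_def by (rule aux[OF nz(1)])
    \<comment> \<open>That (1, r) obeys the lowering relation as well. Subtracting \<rho> times this
      from A leaves an equation in V.\<close>
    have B: "- 13 / 24 * (oct_pf u)\<^sup>2 = u * (1 - u) * r' u - k * r u"
      by (simp add: r_def r'_def k_def oct_pf_def power2_eq_square power3_eq_cube field_simps)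
    have "\<rho> u * (u * (1 - u) * r' u - k * r u) = u * (1 - u) * \<sigma>' u - k * \<sigma> u"
      using A unfolding B .
    then have "u * (1 - u) * V' u = k * V u - r u * (u * (1 - u) * \<rho>' u)"
      unfolding V_def V'_def by algebra
    also have "u * (1 - u) * \<rho>' u = \<kappa> * V u / oct_pf u"
      using 2 nz by (simp add: eq_divide_eq ac_simps)
    finally have "(1 - u) * (u * V' u) = (k - \<kappa> * r u / oct_pf u) * V u"
      by (simp add: algebra_simps)
    then have 4: "u * V' u = g u * V u"
      unfolding g_def k_def[symmetric] by (metis nonzero_mult_div_cancel_left times_divide_eq_left nz(2))
    show ?case using 1 2 4 nz elim by auto
  qed
  then obtain e where e: "e > 0" and
    E: "\<And>u. \<bar>u\<bar> < e \<Longrightarrow> (V has_real_derivative V' u) (at u) \<and> (\<rho> has_real_derivative \<rho>' u) (at u)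
      \<and> u * V' u = g u * V u \<and> g u \<le> 1 / 2 \<and> \<kappa> * V u = oct_pf u * (u * (1 - u)) * \<rho>' u
      \<and> oct_pf u * (1 - u) \<noteq> 0"
    unfolding eventually_nhds_metric dist_real_def by (metis diff_zero)
  \<comment> \<open>The raising relation for V carries the factor u, so it forces V to vanish at 0
    whatever the derivative of \<rho> is there.\<close>
  have V0: "V 0 = 0" using E[of 0] e by (simp add: \<kappa>_def)
  have V: "V u = 0" if "\<bar>u\<bar> < e" for u
    by (rule singular_ode_unique[of e V V' g]) (use E V0 that in auto)
  have \<rho>': "\<rho>' u = 0" if "\<bar>u\<bar> < e" "u \<noteq> 0" for u
    using E[OF that(1)] V[OF that(1)] that(2) by auto
  have "oct_pe 0 = 1" "oct_R 0 = 0" by (simp_all add: oct_pe_def oct_R_def oct_pv_def)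
  then have \<rho>0: "\<rho> 0 = 1"
    using eventually_nhds_x_imp_x[OF \<rho>(1)[unfolded oct_hyp_def]] by simp
  \<comment> \<open>Nothing is known about \<open>\<rho>' 0\<close>, but the intermediate points of
    the mean value theorem lie strictly between 0 and u.\<close>
  have const: "\<rho> u = 1" if u: "\<bar>u\<bar> < e" for u
  proof -
    consider "u = 0" | "0 < u" | "u < 0" by linarith
    then show ?thesis
    proof cases
      case 2
      obtain z where "z > 0" "z < u" "\<rho> u - \<rho> 0 = (u - 0) * \<rho>' z"
        using MVT2[of 0 u \<rho> \<rho>'] 2 E u by auto
      then show ?thesis using \<rho>'[of z] u \<rho>0 by auto
    next
      case 3
      obtain z where "z > u" "z < 0" "\<rho> 0 - \<rho> u = (0 - u) * \<rho>' z"
        using MVT2[of u 0 \<rho> \<rho>'] 3 E u by auto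
      then show ?thesis using \<rho>'[of z] u \<rho>0 by auto
    qed (use \<rho>0 in simp)
  qed
  have "\<forall>\<^sub>F u in nhds 0. \<rho> u = 1"
    unfolding eventually_nhds_metric dist_real_def using const e by auto
  with \<rho>(1) show ?thesis
    unfolding oct_hyp_def by eventually_elim simp
qed

section \<open>The base case for the Ferrers functions\<close>

text \<open>The first order system behind the Legendre equation for \<open>\<nu> = -3/4\<close>, \<open>\<mu> = \<plusminus>1/3\<close>.\<close>

definition ferrers_system :: "(real \<Rightarrow> real) \<Rightarrow> (real \<Rightarrow> real) \<Rightarrow> bool" where
  "ferrers_system f f' \<longleftrightarrow> (\<exists>g'. \<forall>\<xi>. (f has_real_derivative f' \<xi>) (at \<xi>)
     \<and> ((\<lambda>\<xi>. cosh \<xi> * f' \<xi> + sinh \<xi> / 3 * f \<xi>) has_real_derivative g' \<xi>) (at \<xi>)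
     \<and> cosh \<xi> * g' \<xi> - 4 / 3 * sinh \<xi> * (cosh \<xi> * f' \<xi> + sinh \<xi> / 3 * f \<xi>) = 91 / 144 * f \<xi>)"

lemma ferrers_systemI:
  assumes "\<And>\<xi>. (f has_real_derivative f' \<xi>) (at \<xi>)"
    and "\<And>\<xi>. g \<xi> = cosh \<xi> * f' \<xi> + sinh \<xi> / 3 * f \<xi>"
    and "\<And>\<xi>. (g has_real_derivative g' \<xi>) (at \<xi>)"
    and "\<And>\<xi>. cosh \<xi> * g' \<xi> - 4 / 3 * sinh \<xi> * g \<xi> = 91 / 144 * f \<xi>"
  shows "ferrers_system f f'"
proof -
  have "g = (\<lambda>\<xi>. cosh \<xi> * f' \<xi> + sinh \<xi> / 3 * f \<xi>)" using assms(2) by auto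
  then show ?thesis using assms unfolding ferrers_system_def by blast
qed

lemma ferrers_system_lincomb:
  assumes "ferrers_system f f'" "ferrers_system h h'"
  shows "ferrers_system (\<lambda>\<xi>. a * f \<xi> + b * h \<xi>) (\<lambda>\<xi>. a * f' \<xi> + b * h' \<xi>)"
proof -
  define G where "G = (\<lambda>f f' \<xi>. cosh \<xi> * f' \<xi> + sinh \<xi> / 3 * f \<xi> :: real)"
  obtain g' where f: "\<And>\<xi>. (f has_real_derivative f' \<xi>) (at \<xi>)"
    "\<And>\<xi>. (G f f' has_real_derivative g' \<xi>) (at \<xi>)"
    "\<And>\<xi>. cosh \<xi> * g' \<xi> - 4 / 3 * sinh \<xi> * G f f' \<xi> = 91 / 144 * f \<xi>"
    using assms(1) unfolding ferrers_system_def G_def by blast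
  obtain k' where h: "\<And>\<xi>. (h has_real_derivative h' \<xi>) (at \<xi>)"
    "\<And>\<xi>. (G h h' has_real_derivative k' \<xi>) (at \<xi>)"
    "\<And>\<xi>. cosh \<xi> * k' \<xi> - 4 / 3 * sinh \<xi> * G h h' \<xi> = 91 / 144 * h \<xi>"
    using assms(2) unfolding ferrers_system_def G_def by blast
  show ?thesis
  proof (rule ferrers_systemI[where g = "\<lambda>\<xi>. a * G f f' \<xi> + b * G h h' \<xi>" and g' = "\<lambda>\<xi>. a * g' \<xi> + b * k' \<xi>"])
    fix \<xi>
    show "((\<lambda>\<xi>. a * f \<xi> + b * h \<xi>) has_real_derivative a * f' \<xi> + b * h' \<xi>) (at \<xi>)"
      by (intro DERIV_add DERIV_cmult f h)
    show "a * G f f' \<xi> + b * G h h' \<xi> = cosh \<xi> * (a * f' \<xi> + b * h' \<xi>) + sinh \<xi> / 3 * (a * f \<xi> + b * h \<xi>)"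
      by (simp add: G_def algebra_simps)
    show "((\<lambda>\<xi>. a * G f f' \<xi> + b * G h h' \<xi>) has_real_derivative a * g' \<xi> + b * k' \<xi>) (at \<xi>)"
      by (intro DERIV_add DERIV_cmult f h)
    show "cosh \<xi> * (a * g' \<xi> + b * k' \<xi>) - 4 / 3 * sinh \<xi> * (a * G f f' \<xi> + b * G h h' \<xi>)
        = 91 / 144 * (a * f \<xi> + b * h \<xi>)"
    proof -
      have "cosh \<xi> * (a * g' \<xi> + b * k' \<xi>) - 4 / 3 * sinh \<xi> * (a * G f f' \<xi> + b * G h h' \<xi>)
        = a * (cosh \<xi> * g' \<xi> - 4 / 3 * sinh \<xi> * G f f' \<xi>) + b * (cosh \<xi> * k' \<xi> - 4 / 3 * sinh \<xi> * G h h' \<xi>)"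
        by (simp add: algebra_simps)
      then show ?thesis unfolding f(3) h(3) by simp
    qed
  qed
qed

text \<open>This supplies the second solution, the C_- term. cosh is even and sinh odd, so the
  auxiliary function g has to change its sign.\<close>

lemma ferrers_system_reflect:
  assumes "ferrers_system f f'"
  shows "ferrers_system (\<lambda>\<xi>. f (- \<xi>)) (\<lambda>\<xi>. - f' (- \<xi>))"
proof -
  define g where "g = (\<lambda>\<xi>. cosh \<xi> * f' \<xi> + sinh \<xi> / 3 * f \<xi>)"
  obtain g' where f: "\<And>\<xi>. (f has_real_derivative f' \<xi>) (at \<xi>)"
    "\<And>\<xi>. (g has_real_derivative g' \<xi>) (at \<xi>)"
    "\<And>\<xi>. cosh \<xi> * g' \<xi> - 4 / 3 * sinh \<xi> * g \<xi> = 91 / 144 * f \<xi>"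
    using assms(1) unfolding ferrers_system_def g_def by blast
  have refl: "((\<lambda>\<xi>. F (- \<xi>)) has_real_derivative - F' (- \<xi>)) (at \<xi>)"
    if "\<And>\<xi>. (F has_real_derivative F' \<xi>) (at \<xi>)" for F F' \<xi>
  proof -
    have "((\<lambda>\<xi>. F (- \<xi>)) has_real_derivative F' (- \<xi>) * - 1) (at \<xi>)"
      by (rule DERIV_chain2[OF that]) (auto intro!: derivative_eq_intros)
    then show ?thesis by simp
  qed
  show ?thesis
  proof (rule ferrers_systemI[where g = "\<lambda>\<xi>. - g (- \<xi>)" and g' = "\<lambda>\<xi>. g' (- \<xi>)"])
    fix \<xi>
    show "((\<lambda>\<xi>. f (- \<xi>)) has_real_derivative - f' (- \<xi>)) (at \<xi>)" by (rule refl[OF f(1)])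
    show "- g (- \<xi>) = cosh \<xi> * - f' (- \<xi>) + sinh \<xi> / 3 * f (- \<xi>)" by (simp add: g_def)
    show "((\<lambda>\<xi>. - g (- \<xi>)) has_real_derivative g' (- \<xi>)) (at \<xi>)"
      using DERIV_minus[OF refl[OF f(2)], of \<xi>] by simp
    show "cosh \<xi> * g' (- \<xi>) - 4 / 3 * sinh \<xi> * - g (- \<xi>) = 91 / 144 * f (- \<xi>)"
      using f(3)[of "- \<xi>"] by simp
  qed
qed

text \<open>Abel's identity without second derivatives: w, which is cosh times the Wronskian,
  satisfies w' cosh = w sinh by the system, so w / cosh is constant. In the variable \<xi>
  Legendre's equation has no first order term.\<close>

lemma wronskian_const:
  assumes "ferrers_system f f'" "ferrers_system h h'"
  shows "f x * h' x - h x * f' x = f y * h' y - h y * f' y"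
proof -
  define G where "G = (\<lambda>f f' \<xi>. cosh \<xi> * f' \<xi> + sinh \<xi> / 3 * f \<xi> :: real)"
  obtain g' where f: "\<And>\<xi>. (f has_real_derivative f' \<xi>) (at \<xi>)"
    "\<And>\<xi>. (G f f' has_real_derivative g' \<xi>) (at \<xi>)"
    "\<And>\<xi>. cosh \<xi> * g' \<xi> - 4 / 3 * sinh \<xi> * G f f' \<xi> = 91 / 144 * f \<xi>"
    using assms(1) unfolding ferrers_system_def G_def by blast
  obtain k' where h: "\<And>\<xi>. (h has_real_derivative h' \<xi>) (at \<xi>)"
    "\<And>\<xi>. (G h h' has_real_derivative k' \<xi>) (at \<xi>)"
    "\<And>\<xi>. cosh \<xi> * k' \<xi> - 4 / 3 * sinh \<xi> * G h h' \<xi> = 91 / 144 * h \<xi>"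
    using assms(2) unfolding ferrers_system_def G_def by blast
  define w where "w = (\<lambda>\<xi>. f \<xi> * G h h' \<xi> - h \<xi> * G f f' \<xi>)"
  have w: "f \<xi> * h' \<xi> - h \<xi> * f' \<xi> = w \<xi> / cosh \<xi>" for \<xi>
  proof -
    have "w \<xi> = cosh \<xi> * (f \<xi> * h' \<xi> - h \<xi> * f' \<xi>)" unfolding w_def G_def by (simp add: algebra_simps)
    then show ?thesis by (simp add: cosh_real_nonzero)
  qed
  have "((\<lambda>\<xi>. w \<xi> / cosh \<xi>) has_real_derivative 0) (at \<xi>)" for \<xi>
  proof -
    define w' where "w' = (f' \<xi> * G h h' \<xi> + k' \<xi> * f \<xi>) - (h' \<xi> * G f f' \<xi> + g' \<xi> * h \<xi>)"
    have wd: "(w has_real_derivative w') (at \<xi>)"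
      unfolding w_def w'_def by (intro DERIV_diff DERIV_mult f h)
    define c s F F' H H' A B where d: "c = cosh \<xi>" "s = sinh \<xi>" "F = f \<xi>" "F' = f' \<xi>" "H = h \<xi>" "H' = h' \<xi>"
      "A = G f f' \<xi>" "B = G h h' \<xi>"
    have 1: "c * F' = A - s / 3 * F" "c * H' = B - s / 3 * H" by (simp_all add: d G_def)
    have 2: "c * g' \<xi> = 91 / 144 * F + 4 / 3 * s * A" "c * k' \<xi> = 91 / 144 * H + 4 / 3 * s * B"
      using f(3)[of \<xi>] h(3)[of \<xi>] by (simp_all add: d)
    have "w' * c = (c * F') * B + (c * k' \<xi>) * F - (c * H') * A - (c * g' \<xi>) * H"
      unfolding w'_def d by (simp add: algebra_simps)
    also have "\<dots> = s * (F * B - H * A)" unfolding 1 2 by (simp add: algebra_simps)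
    finally have e: "w' * cosh \<xi> - w \<xi> * sinh \<xi> = 0" by (simp add: d w_def)
    have "(cosh has_real_derivative sinh \<xi>) (at \<xi>)" by (auto intro!: derivative_eq_intros)
    from DERIV_divide[OF wd this] have "((\<lambda>\<xi>. w \<xi> / cosh \<xi>) has_real_derivative
        (w' * cosh \<xi> - w \<xi> * sinh \<xi>) / (cosh \<xi> * cosh \<xi>)) (at \<xi>)"
      by (simp add: cosh_real_nonzero)
    then show ?thesis using e by simp
  qed
  then have "w x / cosh x = w y / cosh y" by (intro DERIV_isconst_all) auto
  then show ?thesis unfolding w .
qed

text \<open>For \<open>f \<xi> = exp (\<xi>/3) * A (exp (-2\<xi>/3))\<close> with \<open>A\<close> of class \<open>C\<^sup>1\<close> at \<open>0\<close>, these limits are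
  \<open>A 0\<close> and \<open>-2/3 * A' 0\<close>.\<close>

definition asymp_at_top :: "(real \<Rightarrow> real) \<Rightarrow> (real \<Rightarrow> real) \<Rightarrow> real \<Rightarrow> real \<Rightarrow> bool" where
  "asymp_at_top f f' a b \<longleftrightarrow> ((\<lambda>\<xi>. exp (- \<xi> / 3) * f \<xi>) \<longlongrightarrow> a) at_top
     \<and> ((\<lambda>\<xi>. exp (\<xi> / 3) * (f' \<xi> - f \<xi> / 3)) \<longlongrightarrow> b) at_top"

lemma asymp_at_top_lincomb:
  assumes "asymp_at_top f f' a b" "asymp_at_top h h' c d"
  shows "asymp_at_top (\<lambda>\<xi>. x * f \<xi> + y * h \<xi>) (\<lambda>\<xi>. x * f' \<xi> + y * h' \<xi>) (x * a + y * c) (x * b + y * d)"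
proof -
  have 1: "exp (- \<xi> / 3) * (x * f \<xi> + y * h \<xi>) = x * (exp (- \<xi> / 3) * f \<xi>) + y * (exp (- \<xi> / 3) * h \<xi>)"
    "exp (\<xi> / 3) * (x * f' \<xi> + y * h' \<xi> - (x * f \<xi> + y * h \<xi>) / 3)
      = x * (exp (\<xi> / 3) * (f' \<xi> - f \<xi> / 3)) + y * (exp (\<xi> / 3) * (h' \<xi> - h \<xi> / 3))" for \<xi>
    by (simp_all add: algebra_simps add_divide_distrib)
  show ?thesis
    using assms unfolding asymp_at_top_def 1 by (auto intro!: tendsto_intros)
qed

text \<open>The two exponential factors are inverse to each other and the terms f h / 3 cancel, so
  the Wronskian is a bilinear expression in the quantities that have limits. Being constant, it
  equals its limit.\<close>

lemma wronskian_asymp: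
  assumes "ferrers_system f f'" "ferrers_system h h'" "asymp_at_top f f' a b" "asymp_at_top h h' c d"
  shows "f x * h' x - h x * f' x = a * d - c * b"
proof -
  have e: "f \<xi> * h' \<xi> - h \<xi> * f' \<xi> = exp (- \<xi> / 3) * f \<xi> * (exp (\<xi> / 3) * (h' \<xi> - h \<xi> / 3))
     - exp (- \<xi> / 3) * h \<xi> * (exp (\<xi> / 3) * (f' \<xi> - f \<xi> / 3))" for \<xi>
  proof -
    have E: "exp (- \<xi> / 3) * exp (\<xi> / 3) = 1" by (simp flip: exp_add)
    show ?thesis using E by algebra
  qed
  have "((\<lambda>\<xi>. f \<xi> * h' \<xi> - h \<xi> * f' \<xi>) \<longlongrightarrow> a * d - c * b) at_top"
    unfolding e using assms(3,4) unfolding asymp_at_top_def by (intro tendsto_diff tendsto_mult) auto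
  moreover have "(\<lambda>\<xi>. f \<xi> * h' \<xi> - h \<xi> * f' \<xi>) = (\<lambda>\<xi>. f x * h' x - h x * f' x)"
    using wronskian_const[OF assms(1,2)] by blast
  ultimately show ?thesis
    by (metis tendsto_const tendsto_unique trivial_limit_at_top_linorder)
qed

text \<open>The difference d has zero limits, hence zero Wronskian with p and with r. As p and r
  have nonzero Wronskian, d is 0 at the given point by linear algebra.\<close>

lemma ferrers_system_eqI:
  assumes f: "ferrers_system f f'" "asymp_at_top f f' a b"
    and h: "ferrers_system h h'" "asymp_at_top h h' a b"
    and p: "ferrers_system p p'" "asymp_at_top p p' a1 b1"
    and r: "ferrers_system r r'" "asymp_at_top r r' a2 b2"
    and nz: "a1 * b2 - a2 * b1 \<noteq> 0"
  shows "f x = h x"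
proof -
  define d where "d = (\<lambda>\<xi>. 1 * f \<xi> + (- 1) * h \<xi>)"
  define d' where "d' = (\<lambda>\<xi>. 1 * f' \<xi> + (- 1) * h' \<xi>)"
  have 1: "ferrers_system d d'" unfolding d_def d'_def by (rule ferrers_system_lincomb[OF f(1) h(1)])
  have 2: "asymp_at_top d d' 0 0"
    using asymp_at_top_lincomb[OF f(2) h(2), of 1 "-1"] unfolding d_def d'_def by simp
  have "d x * p' x - p x * d' x = 0" "d x * r' x - r x * d' x = 0"
    "p x * r' x - r x * p' x \<noteq> 0"
    using wronskian_asymp[OF 1 p(1) 2 p(2), of x] wronskian_asymp[OF 1 r(1) 2 r(2), of x]
      wronskian_asymp[OF p(1) r(1) p(2) r(2), of x] nz by simp_all
  moreover have "d x * (p x * r' x - r x * p' x) = p x * (d x * r' x - r x * d' x) - r x * (d x * p' x - p x * d' x)"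
    by algebra
  ultimately have "d x = 0" by simp
  then show ?thesis by (simp add: d_def)
qed

section \<open>Ferrers functions with \<nu> = -3/4 and \<mu> = 1/3 or -1/3\<close>

lemma third_plus_not_Int: "1 / 3 + real_of_int n \<notin> \<int>" "- 1 / 3 - real_of_int n \<notin> \<int>"
proof -
  show 1: "1 / 3 + real_of_int n \<notin> \<int>"
  proof
    assume "1 / 3 + real_of_int n \<in> \<int>"
    then obtain k where "1 / 3 + real_of_int n = of_int k" by (auto elim: Ints_cases)
    then have "real_of_int 1 = real_of_int (3 * (k - n))" by simp
    then have "1 = 3 * (k - n)" by (simp only: of_int_eq_iff)
    then show False by presburger
  qed
  have "- 1 / 3 - real_of_int n = - (1 / 3 + real_of_int n)" by simp
  then show "- 1 / 3 - real_of_int n \<notin> \<int>" using 1 by (metis minus_in_Ints_iff)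
qed

abbreviation "base_P \<mu> \<equiv> \<lambda>\<xi>. ferrers_P (- 3 / 4) \<mu> (tanh \<xi>)"
abbreviation "base_D \<mu> \<equiv> ferrers_D (- 3 / 4) \<mu>"

text \<open>The system is a ladder step followed by its inverse: from 1/3 to 4/3 and back, or from
  -1/3 to -4/3 and back. The factor (\<nu> + \<mu>) (\<nu> - \<mu> + 1) is - 91/144 both for \<mu> =
  4/3 and for \<mu> = -1/3.\<close>

lemma ferrers_system_base_P: "ferrers_system (base_P (1 / 3)) (base_D (1 / 3))" (is ?g1)
  "ferrers_system (base_P (- 1 / 3)) (base_D (- 1 / 3))" (is ?g2)
proof -
  have i: "(1 / 3 :: real) \<notin> \<int>" "(- 1 / 3 :: real) \<notin> \<int>" "(4 / 3 :: real) \<notin> \<int>" "(- 4 / 3 :: real) \<notin> \<int>"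
    using third_plus_not_Int[of 0] third_plus_not_Int[of 1] by simp_all
  show ?g1
  proof (rule ferrers_systemI[where g = "\<lambda>\<xi>. - base_P (4 / 3) \<xi>" and g' = "\<lambda>\<xi>. - base_D (4 / 3) \<xi>"])
    fix \<xi> :: real
    show "(base_P (1 / 3) has_real_derivative base_D (1 / 3) \<xi>) (at \<xi>)"
      by (rule has_real_derivative_ferrers_P_tanh[OF i(1)])
    show "((\<lambda>\<xi>. - base_P (4 / 3) \<xi>) has_real_derivative - base_D (4 / 3) \<xi>) (at \<xi>)"
      by (rule DERIV_minus[OF has_real_derivative_ferrers_P_tanh[OF i(3)]])
    show "- base_P (4 / 3) \<xi> = cosh \<xi> * base_D (1 / 3) \<xi> + sinh \<xi> / 3 * base_P (1 / 3) \<xi>"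
      using ferrers_mu_plus1[OF i(1), of "- 3 / 4" \<xi>] by simp
    show "cosh \<xi> * - base_D (4 / 3) \<xi> - 4 / 3 * sinh \<xi> * - base_P (4 / 3) \<xi> = 91 / 144 * base_P (1 / 3) \<xi>"
      using ferrers_mu_minus1[OF i(3), of "- 3 / 4" \<xi>] by simp
  qed
  show ?g2
  proof (rule ferrers_systemI[where g = "\<lambda>\<xi>. - 91 / 144 * base_P (- 4 / 3) \<xi>" and g' = "\<lambda>\<xi>. - 91 / 144 * base_D (- 4 / 3) \<xi>"])
    fix \<xi> :: real
    show "(base_P (- 1 / 3) has_real_derivative base_D (- 1 / 3) \<xi>) (at \<xi>)"
      by (rule has_real_derivative_ferrers_P_tanh[OF i(2)])
    show "((\<lambda>\<xi>. - 91 / 144 * base_P (- 4 / 3) \<xi>) has_real_derivative - 91 / 144 * base_D (- 4 / 3) \<xi>) (at \<xi>)"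
      by (rule DERIV_cmult[OF has_real_derivative_ferrers_P_tanh[OF i(4)]])
    show "- 91 / 144 * base_P (- 4 / 3) \<xi> = cosh \<xi> * base_D (- 1 / 3) \<xi> + sinh \<xi> / 3 * base_P (- 1 / 3) \<xi>"
      using ferrers_mu_minus1[OF i(2), of "- 3 / 4" \<xi>] by simp
    show "cosh \<xi> * (- 91 / 144 * base_D (- 4 / 3) \<xi>) - 4 / 3 * sinh \<xi> * (- 91 / 144 * base_P (- 4 / 3) \<xi>)
        = 91 / 144 * base_P (- 1 / 3) \<xi>"
      using ferrers_mu_plus1[OF i(4), of "- 3 / 4" \<xi>] by simp
  qed
qed

lemma tanh_arg_exp2: "tanh_arg \<xi> = exp (- 2 * \<xi>) / (1 + exp (- 2 * \<xi>))"
proof -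
  have "2 * cosh \<xi> = exp \<xi> * (1 + exp (- 2 * \<xi>))"
    by (simp add: cosh_def distrib_left flip: exp_add)
  then show ?thesis
    unfolding tanh_arg_exp by (simp add: divide_simps add_pos_pos flip: exp_add)
qed

lemma tendsto_tanh_arg: "(tanh_arg \<longlongrightarrow> 0) at_top" "((\<lambda>\<xi>. exp (2 * \<xi> / 3) * tanh_arg \<xi>) \<longlongrightarrow> 0) at_top"
  unfolding tanh_arg_exp2[abs_def] by real_asymp+

lemma isCont_hyp2F1_0:
  assumes "c \<notin> \<int>\<^sub>\<le>\<^sub>0"
  shows "isCont (hyp2F1 a b c) 0" "isCont (hyp2F1_deriv a b c) 0"
proof -
  show "isCont (hyp2F1 a b c) 0"
    by (rule DERIV_isCont[OF has_real_derivative_hyp2F1[OF assms]]) simp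
  have "0 < fps_conv_radius (fps_hypergeo [a, b] [c] 1)"
    using fps_conv_radius_hypergeo21[OF assms, of a b] by (rule less_le_trans[rotated]) simp
  then have "0 < fps_conv_radius (fps_deriv (fps_hypergeo [a, b] [c] 1))"
    using fps_conv_radius_deriv by (meson less_le_trans)
  then show "isCont (hyp2F1_deriv a b c) 0"
    unfolding hyp2F1_deriv_def[abs_def] by (intro continuous_eval_fps) (auto simp: zero_ereal_def)
qed

text \<open>\<open>tanh_arg\<close> decays like exp (-2 \<xi>), faster than the ratio exp (-2 \<xi>
  / 3) of the two solutions. So in both limits the Gauss function may be replaced by its value 1 at
  0, leaving the pure exponential exp (\<mu> \<xi>).\<close>

lemma asymp_base_P: "asymp_at_top (base_P (1 / 3)) (base_D (1 / 3)) (1 / Gamma (2 / 3)) 0" (is ?g1)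
  "asymp_at_top (base_P (- 1 / 3)) (base_D (- 1 / 3)) 0 (- 2 / 3 / Gamma (4 / 3))" (is ?g2)
proof -
  define F where "F = (\<lambda>\<mu> \<xi>. hyp2F1 (3 / 4) (1 / 4) (1 - \<mu>) (tanh_arg \<xi>))"
  define D where "D = (\<lambda>\<mu> \<xi>. hyp2F1_deriv (3 / 4) (1 / 4) (1 - \<mu>) (tanh_arg \<xi>))"
  define t where "t = tanh_arg"
  have F: "(F \<mu> \<longlongrightarrow> 1) at_top" and D: "(D \<mu> \<longlongrightarrow> hyp2F1_deriv (3 / 4) (1 / 4) (1 - \<mu>) 0) at_top"
    if "\<mu> \<notin> \<int>" for \<mu>
    unfolding F_def D_def
    using isCont_tendsto_compose[OF isCont_hyp2F1_0(1)[OF not_nonpos_Ints_minus(1)[OF that]] tendsto_tanh_arg(1)]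
      isCont_tendsto_compose[OF isCont_hyp2F1_0(2)[OF not_nonpos_Ints_minus(1)[OF that]] tendsto_tanh_arg(1)]
    by simp_all
  have i: "(1 / 3 :: real) \<notin> \<int>" "(- 1 / 3 :: real) \<notin> \<int>"
    using third_plus_not_Int[of 0] by simp_all
  have t: "(t \<longlongrightarrow> 0) at_top" "((\<lambda>\<xi>. exp (2 * \<xi> / 3) * t \<xi>) \<longlongrightarrow> 0) at_top"
    unfolding t_def by (rule tendsto_tanh_arg)+
  have P: "base_P \<mu> \<xi> = exp (\<mu> * \<xi>) / Gamma (1 - \<mu>) * F \<mu> \<xi>"
    "base_D \<mu> \<xi> = exp (\<mu> * \<xi>) / Gamma (1 - \<mu>) * (\<mu> * F \<mu> \<xi> - 2 * t \<xi> * (1 - t \<xi>) * D \<mu> \<xi>)" for \<mu> \<xi>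
    unfolding ferrers_P_tanh ferrers_D_def F_def D_def t_def by simp_all
  have E: "exp (- \<xi> / 3) * exp (1 / 3 * \<xi>) = 1" "exp (\<xi> / 3) * exp (1 / 3 * \<xi>) = exp (2 * \<xi> / 3)"
    "exp (- \<xi> / 3) * exp (- 1 / 3 * \<xi>) = exp (- 2 * \<xi> / 3)" "exp (\<xi> / 3) * exp (- 1 / 3 * \<xi>) = 1" for \<xi> :: real
    by (simp_all flip: exp_add)
  show ?g1
  proof -
    have 1: "exp (- \<xi> / 3) * base_P (1 / 3) \<xi> = 1 / Gamma (2 / 3) * F (1 / 3) \<xi>" for \<xi>
      unfolding P using E(1)[of \<xi>] by simp
    have 2: "exp (\<xi> / 3) * (base_D (1 / 3) \<xi> - base_P (1 / 3) \<xi> / 3)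
      = - 2 / Gamma (2 / 3) * (exp (2 * \<xi> / 3) * t \<xi>) * ((1 - t \<xi>) * D (1 / 3) \<xi>)" for \<xi>
    proof -
      have "e * (A / G * (1 / 3 * X - 2 * y * (1 - y) * Y) - A / G * X / 3) = - 2 / G * (e * A * y) * ((1 - y) * Y)"
        for e A G X Y y :: real
        by (simp add: right_diff_distrib)
      from this[of "exp (\<xi> / 3)" "exp (1 / 3 * \<xi>)" "Gamma (2 / 3)"] show ?thesis unfolding P E(2) by simp
    qed

    have "((\<lambda>\<xi>. 1 / Gamma (2 / 3) * F (1 / 3) \<xi>) \<longlongrightarrow> 1 / Gamma (2 / 3) * 1) at_top"
      by (intro tendsto_intros F i)
    moreover have "((\<lambda>\<xi>. - 2 / Gamma (2 / 3) * (exp (2 * \<xi> / 3) * t \<xi>) * ((1 - t \<xi>) * D (1 / 3) \<xi>))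
      \<longlongrightarrow> - 2 / Gamma (2 / 3) * 0 * ((1 - 0) * hyp2F1_deriv (3 / 4) (1 / 4) (1 - 1 / 3) 0)) at_top"
      by (intro tendsto_mult tendsto_diff tendsto_const t D i)
    ultimately show ?thesis unfolding asymp_at_top_def 1 2 by simp
  qed
  show ?g2
  proof -
    have 1: "exp (- \<xi> / 3) * base_P (- 1 / 3) \<xi> = exp (- 2 * \<xi> / 3) * (1 / Gamma (4 / 3) * F (- 1 / 3) \<xi>)" for \<xi>
      unfolding P using E(3)[of \<xi>] by simp
    have 2: "exp (\<xi> / 3) * (base_D (- 1 / 3) \<xi> - base_P (- 1 / 3) \<xi> / 3)
      = 1 / Gamma (4 / 3) * (- 2 / 3 * F (- 1 / 3) \<xi> - 2 * t \<xi> * ((1 - t \<xi>) * D (- 1 / 3) \<xi>))" for \<xi>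
    proof -
      have "e * (A / G * (- 1 / 3 * X - 2 * y * (1 - y) * Y) - A / G * X / 3)
          = 1 / G * (- 2 / 3 * X - 2 * y * ((1 - y) * Y))"
        if "e * A = 1" for e A G X Y y :: real
      proof -
        have "e * (k * (- 1 / 3 * X - 2 * y * (1 - y) * Y) - k * X / 3)
          = (e * k) * (- 2 / 3 * X - 2 * y * ((1 - y) * Y))" for k
          by (simp add: algebra_simps)
        from this[of "A / G"] have "e * (A / G * (- 1 / 3 * X - 2 * y * (1 - y) * Y) - A / G * X / 3)
          = (e * A) / G * (- 2 / 3 * X - 2 * y * ((1 - y) * Y))" unfolding times_divide_eq_right[of e A G] .
        then show ?thesis unfolding that .
      qed
      from this[OF E(4)] show ?thesis unfolding P by simp
    qed
    have e: "((\<lambda>\<xi>::real. exp (- 2 * \<xi> / 3)) \<longlongrightarrow> 0) at_top" by real_asymp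
    have "((\<lambda>\<xi>. exp (- 2 * \<xi> / 3) * (1 / Gamma (4 / 3) * F (- 1 / 3) \<xi>)) \<longlongrightarrow> 0 * (1 / Gamma (4 / 3) * 1)) at_top"
      by (intro tendsto_mult tendsto_const e F i)
    moreover have "((\<lambda>\<xi>. 1 / Gamma (4 / 3) * (- 2 / 3 * F (- 1 / 3) \<xi> - 2 * t \<xi> * ((1 - t \<xi>) * D (- 1 / 3) \<xi>)))
      \<longlongrightarrow> 1 / Gamma (4 / 3) * (- 2 / 3 * 1 - 2 * 0 * ((1 - 0) * hyp2F1_deriv (3 / 4) (1 / 4) (1 - (- 1 / 3)) 0))) at_top"
      by (intro tendsto_mult tendsto_diff tendsto_const t D F i)
    ultimately show ?thesis unfolding asymp_at_top_def 1 2 by (simp add: mult.commute)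
  qed
qed

text \<open>The logarithmic derivative of \<open>C_plus\<close> for \<epsilon> = 1 and of
  \<open>C_minus\<close> for \<epsilon> = -1.\<close>

definition base_L :: "real \<Rightarrow> real \<Rightarrow> real" where
  "base_L \<epsilon> \<xi> = (\<epsilon> * (cosh (\<xi> / 3) / 3) + 4 * sinh (\<xi> / 3) * cosh (\<xi> / 3) / (9 * oct_w \<xi>))
     / (\<epsilon> * sinh (\<xi> / 3) + oct_w \<xi>)"

lemma C_plus_log_deriv: "(C_plus \<xi>)\<^sup>2 / 8 * (14 + 2 * oct_u \<xi>) * oct_u_deriv \<xi> = base_L 1 \<xi>"
proof -
  note e = DERIV_unique[OF has_real_derivative_C_plus_w has_real_derivative_C_plus]
  have "base_L 1 \<xi> = (cosh (\<xi> / 3) / 3 + 4 * sinh (\<xi> / 3) * cosh (\<xi> / 3) / (9 * oct_w \<xi>)) / C_plus \<xi>"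
    by (simp add: base_L_def C_plus_w)
  also have "\<dots> = (C_plus \<xi>)\<^sup>2 / 8 * (14 + 2 * oct_u \<xi>) * oct_u_deriv \<xi>"
    unfolding e using C_plus_pos[of \<xi>] by (simp add: power2_eq_square power3_eq_cube)
  finally show ?thesis ..
qed

section \<open>Expansion of C_+ and C_- in q = exp (-2 \<xi> / 3)\<close>

context
  fixes q \<omega> :: "real \<Rightarrow> real"
  defines "q \<equiv> \<lambda>\<xi>. exp (- 2 * \<xi> / 3)" and "\<omega> \<equiv> \<lambda>\<xi>. sqrt ((1 - exp (- 2 * \<xi> / 3) + (exp (- 2 * \<xi> / 3))\<^sup>2) / 3)"
begin

text \<open>Once exp (\<xi> / 3) is split off, all functions of \<xi> / 3 depend on q only, which
  tends to 0.\<close>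

lemma exp_third_identities:
  "exp (\<xi> / 3) * exp (\<xi> / 3) * q \<xi> = 1"
  "sinh (\<xi> / 3) = exp (\<xi> / 3) * (1 - q \<xi>) / 2" "cosh (\<xi> / 3) = exp (\<xi> / 3) * (1 + q \<xi>) / 2"
  "oct_w \<xi> = exp (\<xi> / 3) * \<omega> \<xi>" (is ?g1) "3 * (\<omega> \<xi>)\<^sup>2 = 1 - q \<xi> + (q \<xi>)\<^sup>2" "\<omega> \<xi> > 0"
proof -
  show 1: "exp (\<xi> / 3) * exp (\<xi> / 3) * q \<xi> = 1" by (simp add: q_def flip: exp_add)
  have 2: "exp (\<xi> / 3) * q \<xi> = exp (- (\<xi> / 3))" by (simp add: q_def flip: exp_add)
  show s: "sinh (\<xi> / 3) = exp (\<xi> / 3) * (1 - q \<xi>) / 2" "cosh (\<xi> / 3) = exp (\<xi> / 3) * (1 + q \<xi>) / 2"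
    unfolding right_diff_distrib distrib_left 2 by (simp_all add: sinh_def cosh_def)
  have "1 - q \<xi> + (q \<xi>)\<^sup>2 = (q \<xi> - 1 / 2)\<^sup>2 + 3 / 4" by (simp add: power2_eq_square algebra_simps)
  then have p: "1 - q \<xi> + (q \<xi>)\<^sup>2 > 0" by (simp add: add_nonneg_pos)
  then show w: "3 * (\<omega> \<xi>)\<^sup>2 = 1 - q \<xi> + (q \<xi>)\<^sup>2" "\<omega> \<xi> > 0"
    unfolding \<omega>_def q_def by (simp_all add: real_sqrt_pow2)
  have "4 * (x / 2)\<^sup>2 = x\<^sup>2" for x :: real by (simp add: power_divide)
  then have "4 * (exp (\<xi> / 3) * (1 - q \<xi>) / 2)\<^sup>2 + 1 = (exp (\<xi> / 3) * (1 - q \<xi>))\<^sup>2 + exp (\<xi> / 3) * exp (\<xi> / 3) * q \<xi>"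
    unfolding 1 by simp
  also have "\<dots> = (exp (\<xi> / 3))\<^sup>2 * (1 - q \<xi> + (q \<xi>)\<^sup>2)" by algebra
  finally have "(4 * sinh (\<xi> / 3) ^ 2 + 1) / 3 = (exp (\<xi> / 3))\<^sup>2 * ((1 - q \<xi> + (q \<xi>)\<^sup>2) / 3)"
    unfolding s by simp
  then have "oct_w \<xi> = sqrt ((exp (\<xi> / 3))\<^sup>2 * ((1 - q \<xi> + (q \<xi>)\<^sup>2) / 3))"
    by (simp only: oct_w_def)
  then show ?g1
    unfolding \<omega>_def q_def by (simp only: real_sqrt_mult real_sqrt_abs abs_exp_cancel)
qed

lemma tendsto_q: "(q \<longlongrightarrow> 0) at_top" "(\<omega> \<longlongrightarrow> 1 / sqrt 3) at_top" (is ?g1)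
proof -
  show q: "(q \<longlongrightarrow> 0) at_top" unfolding q_def by real_asymp
  have "((\<lambda>\<xi>. sqrt ((1 - q \<xi> + (q \<xi>)\<^sup>2) / 3)) \<longlongrightarrow> sqrt ((1 - 0 + 0\<^sup>2) / 3)) at_top"
    by (intro tendsto_intros q) simp
  then show ?g1 unfolding \<omega>_def q_def by (simp add: real_sqrt_divide)
qed

context
  fixes \<epsilon> :: real
  assumes eps: "\<epsilon> = 1 \<or> \<epsilon> = - 1"
begin

lemma eps_sqrt3_pos: "\<epsilon> / 2 + 1 / sqrt 3 > 0" "2 + \<epsilon> * sqrt 3 > 0"
proof -
  have "sqrt 3 < sqrt 4" by (rule real_sqrt_less_mono) simp
  then have 1: "sqrt 3 < 2" by simp
  show "2 + \<epsilon> * sqrt 3 > 0"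
    using eps
  proof
    assume "\<epsilon> = 1"
    then show ?thesis by (simp add: add_pos_nonneg)
  qed (use 1 in simp)
  moreover have "\<epsilon> / 2 + 1 / sqrt 3 = (2 + \<epsilon> * sqrt 3) / (2 * sqrt 3)"
    by (simp add: field_simps)
  ultimately show "\<epsilon> / 2 + 1 / sqrt 3 > 0" by simp
qed

lemma C_eps_pos: "\<epsilon> * sinh (\<xi> / 3) + oct_w \<xi> > 0"
  using eps C_plus_pos[of \<xi>] C_minus_pos[of \<xi>] by (auto simp: C_plus_w C_minus_w)

lemma tendsto_C_eps: "((\<lambda>\<xi>. exp (- \<xi> / 3) * (\<epsilon> * sinh (\<xi> / 3) + oct_w \<xi>)) \<longlongrightarrow> \<epsilon> / 2 + 1 / sqrt 3) at_top"
proof -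
  have "exp (- \<xi> / 3) * (\<epsilon> * sinh (\<xi> / 3) + oct_w \<xi>) = \<epsilon> * (1 - q \<xi>) / 2 + \<omega> \<xi>" for \<xi>
  proof -
    have "exp (- \<xi> / 3) * exp (\<xi> / 3) = 1" by (simp flip: exp_add)
    then have "exp (- \<xi> / 3) * (\<epsilon> * (exp (\<xi> / 3) * a / 2) + exp (\<xi> / 3) * b) = \<epsilon> * a / 2 + b" for a b
      by algebra
    then show ?thesis unfolding exp_third_identities .
  qed
  moreover have "((\<lambda>\<xi>. \<epsilon> * (1 - q \<xi>) / 2 + \<omega> \<xi>) \<longlongrightarrow> \<epsilon> * (1 - 0) / 2 + 1 / sqrt 3) at_top"
    by (intro tendsto_intros tendsto_q) simp
  ultimately show ?thesis by simp
qed

lemma base_L_q: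
  "exp (2 * \<xi> / 3) * (base_L \<epsilon> \<xi> - 1 / 3)
    = 2 * (1 - 2 * q \<xi> + 3 * \<epsilon> * \<omega> \<xi>) / (9 * \<omega> \<xi> * (\<epsilon> * (1 - q \<xi>) + 2 * \<omega> \<xi>))"
proof -
  define E where "E = exp (\<xi> / 3)"
  define x where "x = q \<xi>"
  define y where "y = \<omega> \<xi>"
  note id = exp_third_identities[of \<xi>, folded E_def x_def y_def]
  have E: "E > 0" by (simp add: E_def)
  have y: "y > 0" "3 * y\<^sup>2 = 1 - x + x\<^sup>2" by (rule id)+
  define z where "z = \<epsilon> * (1 - x) + 2 * y"
  have Ez: "\<epsilon> * (E * (1 - x) / 2) + E * y = E * z / 2" by (simp add: z_def algebra_simps add_divide_distrib)
  have "\<epsilon> * (E * (1 - x) / 2) + E * y > 0" using C_eps_pos[of \<xi>] unfolding id .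
  then have z0: "z \<noteq> 0" unfolding Ez by auto
  have ex: "exp (2 * \<xi> / 3) * x = 1" by (simp add: x_def q_def flip: exp_add)
  have "base_L \<epsilon> \<xi> = (\<epsilon> * (E * (1 + x) / 2 / 3) + 4 * (E * (1 - x) / 2) * (E * (1 + x) / 2) / (9 * (E * y)))
     / (\<epsilon> * (E * (1 - x) / 2) + E * y)"
    unfolding base_L_def id ..
  also note Ez
  also have "\<epsilon> * (E * (1 + x) / 2 / 3) + 4 * (E * (1 - x) / 2) * (E * (1 + x) / 2) / (9 * (E * y))
      = E * ((1 + x) * (3 * \<epsilon> * y + 2 * (1 - x))) / (18 * y)"
    using E y(1) by (simp add: field_simps)
  also have "E * ((1 + x) * (3 * \<epsilon> * y + 2 * (1 - x))) / (18 * y) / (E * z / 2)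
      = (1 + x) * (3 * \<epsilon> * y + 2 * (1 - x)) / (9 * y * z)"
    using E by simp
  finally have "base_L \<epsilon> \<xi> - 1 / 3 = ((1 + x) * (3 * \<epsilon> * y + 2 * (1 - x)) - 3 * y * z) / (9 * y * z)"
    using y(1) z0 by (simp add: diff_divide_distrib)
  \<comment> \<open>The terms free of x cancel by \<open>3 * y\<^sup>2 = 1 - x + x\<^sup>2\<close>.
    The factor x that comes out is absorbed by exp (2 \<xi> / 3).\<close>
  also have "(1 + x) * (3 * \<epsilon> * y + 2 * (1 - x)) - 3 * y * z = x * (2 * (1 - 2 * x + 3 * \<epsilon> * y))"
    unfolding z_def using y(2) by algebra
  finally have "exp (2 * \<xi> / 3) * (base_L \<epsilon> \<xi> - 1 / 3)
      = (exp (2 * \<xi> / 3) * x) * (2 * (1 - 2 * x + 3 * \<epsilon> * y)) / (9 * y * z)" by simp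
  from this[unfolded ex] show ?thesis unfolding z_def x_def y_def by simp
qed

lemma tendsto_base_L:
  "((\<lambda>\<xi>. exp (2 * \<xi> / 3) * (base_L \<epsilon> \<xi> - 1 / 3)) \<longlongrightarrow> 2 / 3 * (1 + \<epsilon> * sqrt 3) / (2 + \<epsilon> * sqrt 3)) at_top"
proof -
  define r :: real where "r = sqrt 3"
  have r: "r * r = 3" "r > 0" by (simp_all add: r_def)
  have nz: "2 + \<epsilon> * r \<noteq> 0" using eps_sqrt3_pos(2) by (simp add: r_def)
  have "1 / r = r / 3" by (subst frac_eq_eq) (use r in auto)
  then have w: "(\<omega> \<longlongrightarrow> r / 3) at_top" using tendsto_q(2) by (simp only: r_def)
  have den: "9 * (r / 3) * (\<epsilon> * (1 - 0) + 2 * (r / 3)) = 3 * (2 + \<epsilon> * r)"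
  proof -
    have "9 * (r / 3) * (\<epsilon> * (1 - 0) + 2 * (r / 3)) = 3 * \<epsilon> * r + 2 * (r * r)" by (simp add: algebra_simps)
    then show ?thesis unfolding r(1) by simp
  qed
  have "((\<lambda>\<xi>. 2 * (1 - 2 * q \<xi> + 3 * \<epsilon> * \<omega> \<xi>) / (9 * \<omega> \<xi> * (\<epsilon> * (1 - q \<xi>) + 2 * \<omega> \<xi>)))
      \<longlongrightarrow> 2 * (1 - 2 * 0 + 3 * \<epsilon> * (r / 3)) / (9 * (r / 3) * (\<epsilon> * (1 - 0) + 2 * (r / 3)))) at_top"
  proof (intro tendsto_intros tendsto_q(1) w)
    show "9 * (r / 3) * (\<epsilon> * (1 - 0) + 2 * (r / 3)) \<noteq> 0" unfolding den using nz by simp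
  qed
  moreover have "2 * (1 - 2 * 0 + 3 * \<epsilon> * (r / 3)) / (3 * (2 + \<epsilon> * r)) = 2 / 3 * (1 + \<epsilon> * r) / (2 + \<epsilon> * r)"
    by simp
  ultimately show ?thesis unfolding base_L_q den r_def[symmetric] by simp
qed

text \<open>The growth exp (\<xi> / 3) is exp (\<xi>) times exp (\<xi> / 3) to the power 1/4.
  Accordingly f' - f / 3 is f / 4 times the sum of tanh - 1, which decays too fast to contribute,
  and \<open>base_L\<close> - 1/3.\<close>

lemma asymp_eps:
  assumes f: "\<And>\<xi>. f \<xi> = cosh \<xi> powr (1 / 4) * (\<epsilon> * sinh (\<xi> / 3) + oct_w \<xi>) powr (1 / 4)"
    and f': "\<And>\<xi>. f' \<xi> = f \<xi> * (1 / 4 * (tanh \<xi> + base_L \<epsilon> \<xi>))"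
  defines "a \<equiv> (1 / 2 * (\<epsilon> / 2 + 1 / sqrt 3)) powr (1 / 4)"
  shows "asymp_at_top f f' a (a * (1 / 4 * (2 / 3 * (1 + \<epsilon> * sqrt 3) / (2 + \<epsilon> * sqrt 3))))"
proof -
  have P: "exp (- \<xi> / 3) * f \<xi> = ((1 + exp (- 2 * \<xi>)) / 2 * (exp (- \<xi> / 3) * (\<epsilon> * sinh (\<xi> / 3) + oct_w \<xi>))) powr (1 / 4)" for \<xi>
  proof -
    have c: "exp (- \<xi>) * cosh \<xi> = (1 + exp (- 2 * \<xi>)) / 2"
      by (simp add: cosh_def distrib_left flip: exp_add)
    have "exp (- \<xi> / 3) = exp (- \<xi>) powr (1 / 4) * exp (- \<xi> / 3) powr (1 / 4)"
      by (simp add: exp_powr_real flip: exp_add)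
    then show ?thesis
      unfolding f c[symmetric] using C_eps_pos[of \<xi>] cosh_real_pos[of \<xi>]
      by (simp add: powr_mult ac_simps)
  qed
  have 1: "((\<lambda>\<xi>. exp (- \<xi> / 3) * f \<xi>) \<longlongrightarrow> a) at_top"
    unfolding P a_def
  proof (intro tendsto_powr tendsto_mult tendsto_C_eps tendsto_const)
    show "((\<lambda>\<xi>::real. (1 + exp (- 2 * \<xi>)) / 2) \<longlongrightarrow> 1 / 2) at_top" by real_asymp
    show "1 / 2 * (\<epsilon> / 2 + 1 / sqrt 3) \<noteq> 0" using eps_sqrt3_pos by simp
  qed
  have Q: "exp (\<xi> / 3) * (f' \<xi> - f \<xi> / 3) = (exp (- \<xi> / 3) * f \<xi>)
    * (1 / 4 * (- 2 * (exp (2 * \<xi> / 3) * tanh_arg \<xi>) + exp (2 * \<xi> / 3) * (base_L \<epsilon> \<xi> - 1 / 3)))" for \<xi>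
  proof -
    have t: "tanh \<xi> = 1 - 2 * tanh_arg \<xi>" unfolding tanh_arg_def by (rule half_diff_identities)
    have e: "exp (\<xi> / 3) = exp (- \<xi> / 3) * exp (2 * \<xi> / 3)" by (simp flip: exp_add)
    have "e * k * (F * (1 / 4 * (1 - 2 * s + L)) - F / 3) = e * F * (1 / 4 * (- 2 * (k * s) + k * (L - 1 / 3)))"
      for e k F s L :: real by (simp add: algebra_simps)
    then show ?thesis unfolding f' t e .
  qed
  have "((\<lambda>\<xi>. exp (\<xi> / 3) * (f' \<xi> - f \<xi> / 3)) \<longlongrightarrow>
     a * (1 / 4 * (- 2 * 0 + 2 / 3 * (1 + \<epsilon> * sqrt 3) / (2 + \<epsilon> * sqrt 3)))) at_top"
    unfolding Q by (intro tendsto_mult tendsto_add tendsto_const tendsto_base_L 1 tendsto_tanh_arg)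
  with 1 show ?thesis unfolding asymp_at_top_def by simp
qed

end

end

section \<open>The octahedral solution at n = m = 0 and its asymptotics\<close>

abbreviation "base_H \<equiv> oct_H 0 0 (\<lambda>u. 1)"
abbreviation "base_H' \<equiv> oct_H_deriv 0 0 (\<lambda>u. 1) (\<lambda>u. 0)"

text \<open>Again a step up in n and back down: 7/96 is \<kappa>/4 with \<kappa> = 7/24, and 7/96
  times the factor 8 * 13/12 of \<open>oct_H_lower_n\<close> is 91/144, as for the Ferrers
  functions.\<close>

lemma ferrers_system_base_H: "ferrers_system base_H base_H'"
proof -
  define r where "r = oct_raise (7 / 24) 0 0 (\<lambda>u. 1) (\<lambda>u. 0)"
  define r' where "r' = (\<lambda>u::real. - 39 - 390 / 7 * u + 39 / 7 * u\<^sup>2)"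
  have r: "r u = 1 - 39 * u - 195 / 7 * u\<^sup>2 + 13 / 7 * u ^ 3" for u
    by (simp add: r_def oct_raise_def oct_pe_def power2_eq_square power3_eq_cube field_simps)
  have rd: "(r has_real_derivative r' u) (at u)" for u
    unfolding r[abs_def] r'_def by (auto intro!: derivative_eq_intros simp: power2_eq_square)
  have low: "oct_H 0 0 (oct_lower_n 1 0 r r') \<xi> = base_H \<xi>" for \<xi>
  proof -
    have aux: "2 / (- 1 / 12 - 0 - 1) / F\<^sup>2 * X = 1"
      if "F \<noteq> 0" "X = - 13 / 24 * F\<^sup>2" for F X :: real
      unfolding that(2) using that(1) by simp
    have "oct_lower_n 1 0 r r' (oct_u \<xi>) = 1"
      unfolding oct_lower_n_def
      by (rule aux[OF oct_pf_u_nonzero])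
        (simp add: r r'_def oct_pf_def power2_eq_square power3_eq_cube field_simps)
    then show ?thesis by (simp add: oct_H_def)
  qed
  show ?thesis
  proof (rule ferrers_systemI[where g = "\<lambda>\<xi>. 7 / 96 * oct_H 1 0 r \<xi>" and g' = "\<lambda>\<xi>. 7 / 96 * oct_H_deriv 1 0 r r' \<xi>"])
    fix \<xi>
    show "(base_H has_real_derivative base_H' \<xi>) (at \<xi>)"
      by (rule has_real_derivative_oct_H) simp
    show "((\<lambda>\<xi>. 7 / 96 * oct_H 1 0 r \<xi>) has_real_derivative 7 / 96 * oct_H_deriv 1 0 r r' \<xi>) (at \<xi>)"
      by (rule DERIV_cmult[OF has_real_derivative_oct_H]) (rule rd)
    show "7 / 96 * oct_H 1 0 r \<xi> = cosh \<xi> * base_H' \<xi> + sinh \<xi> / 3 * base_H \<xi>"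
      using oct_H_raise_n[of 0 0 \<xi> "\<lambda>u. 1" "\<lambda>u. 0"] by (simp add: r_def)
    show "cosh \<xi> * (7 / 96 * oct_H_deriv 1 0 r r' \<xi>) - 4 / 3 * sinh \<xi> * (7 / 96 * oct_H 1 0 r \<xi>)
        = 91 / 144 * base_H \<xi>"
      using oct_H_lower_n[of 0 1 \<xi> r r'] low[of \<xi>] by simp
  qed
qed

lemma asymp_base_H:
  defines "a1 \<equiv> (1 / 2 * (1 / 2 + 1 / sqrt 3)) powr (1 / 4)"
    and "a2 \<equiv> (1 / 2 * (- 1 / 2 + 1 / sqrt 3)) powr (1 / 4)"
  shows "asymp_at_top base_H base_H' a1 (a1 * (1 / 4 * (2 / 3 * (1 + 1 * sqrt 3) / (2 + 1 * sqrt 3))))" (is ?g1)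
    "asymp_at_top (\<lambda>\<xi>. base_H (- \<xi>)) (\<lambda>\<xi>. - base_H' (- \<xi>)) a2
      (a2 * (1 / 4 * (2 / 3 * (1 + (- 1) * sqrt 3) / (2 + (- 1) * sqrt 3))))" (is ?g2)
proof -
  have H': "base_H' \<xi> = base_H \<xi> * (1 / 4 * (tanh \<xi> + base_L 1 \<xi>))" for \<xi>
    unfolding oct_H_deriv_def oct_H_def C_plus_log_deriv by simp
  show ?g1
    unfolding a1_def a2_def by (rule asymp_eps) (simp_all add: H', simp add: oct_H_def C_plus_w)
  have L: "base_L 1 (- \<xi>) = - base_L (- 1) \<xi>" for \<xi>
    by (simp add: base_L_def oct_w_def diff_divide_distrib)
  show ?g2
    unfolding a1_def a2_def by (rule asymp_eps) (simp_all add: H' L, simp_all add: oct_H_def C_minus_w algebra_simps)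
qed

section \<open>Constants involving the square root of 3\<close>

context
  fixes r :: real
  defines "r \<equiv> sqrt 3"
begin

lemma sqrt3_facts: "r * r = 3" "1 < r" "r < 2" "1 / r = r / 3" "1 / sqrt 3 = r / 3"
proof -
  have "sqrt 3 < sqrt 4" by (rule real_sqrt_less_mono) simp
  then show "r < 2" by (simp add: r_def)
  show 1: "r * r = 3" "1 < r" by (simp_all add: r_def)
  show "1 / r = r / 3" by (subst frac_eq_eq) (use 1 in auto)
  then show "1 / sqrt 3 = r / 3" by (simp only: r_def)
qed

lemma sqrt_eq_powr_quarter: "x > 0 \<Longrightarrow> sqrt x = (x * x) powr (1 / 4)" for x :: real
proof -
  assume x: "x > 0"
  then have "(x * x) powr (1 / 4) = x powr (1 / 4) * x powr (1 / 4)" by (simp add: powr_mult)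
  also have "\<dots> = x powr (1 / 4 + 1 / 4)" by (simp only: powr_add)
  also have "\<dots> = sqrt x" using x by (simp add: powr_half_sqrt)
  finally show "sqrt x = (x * x) powr (1 / 4)" ..
qed

lemma powr_minus_half: "3 powr (- 1 / 2) = 1 / r" "2 powr (- 1 / 2) = 1 / sqrt (2::real)"
  using powr_minus_divide[of 3 "1 / 2 :: real"] powr_minus_divide[of 2 "1 / 2 :: real"]
  by (simp_all add: powr_half_sqrt r_def)

lemma powr_quarter_K: "(r / 6) powr (1 / 4) = 2 powr (- 1 / 4) * 3 powr (- 1 / 8)"
proof -
  have "r / 6 = 2 powr (- 1) * 3 powr (- 1 / 2)"
    unfolding powr_minus_half sqrt3_facts by (simp add: powr_minus_divide)
  then have "(r / 6) powr (1 / 4) = (2 powr (- 1)) powr (1 / 4) * (3 powr (- 1 / 2)) powr (1 / 4)"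
    by (simp only: powr_mult powr_ge_zero)
  then show ?thesis unfolding powr_powr by simp
qed

text \<open>The two radicals of the theorem are inversely proportional to the leading coefficients
  of \<open>base_H\<close> and of its reflection. Written as fourth roots, both products have the
  radicand r / 6.\<close>

lemma sqrt3_products:
  "sqrt (r - 1) * (1 / 2 * (1 / 2 + 1 / sqrt 3)) powr (1 / 4) = (r / 6) powr (1 / 4)" (is ?g1)
  "sqrt (r + 1) * (1 / 2 * (- 1 / 2 + 1 / sqrt 3)) powr (1 / 4) = (r / 6) powr (1 / 4)" (is ?g2)
proof -
  have sq: "(r - 1) * (r - 1) = 4 - 2 * r" "(r + 1) * (r + 1) = 4 + 2 * r"
    "(4 - 2 * r) * r = 4 * r - 6" "(4 + 2 * r) * r = 4 * r + 6"
    using sqrt3_facts(1) by (simp_all add: algebra_simps)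
  have d: "x * (1 / 2 * (1 / 2 + r / 3)) = (3 * x + 2 * (x * r)) / 12"
    "x * (1 / 2 * (- 1 / 2 + r / 3)) = (2 * (x * r) - 3 * x) / 12" for x
    by (simp_all add: distrib_left right_diff_distrib add_divide_distrib diff_divide_distrib)
  have e1: "(r - 1) * (r - 1) * (1 / 2 * (1 / 2 + r / 3)) = r / 6"
    unfolding sq(1) d sq(3) by simp
  have e2: "(r + 1) * (r + 1) * (1 / 2 * (- 1 / 2 + r / 3)) = r / 6"
    unfolding sq(2) d sq(4) by simp
  note e = e1 e2
  have pos: "r - 1 > 0" "r + 1 > 0" using sqrt3_facts by auto
  show ?g1 ?g2
    unfolding sqrt3_facts(5) sqrt_eq_powr_quarter[OF pos(1)] sqrt_eq_powr_quarter[OF pos(2)] powr_mult[symmetric] e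
    by (rule refl)+
qed

end

lemma base_constants:
  fixes r K a1 a2 :: real
  defines "r \<equiv> sqrt 3" and "K \<equiv> 2 powr (- 1 / 4) * 3 powr (- 1 / 8)"
    and "a1 \<equiv> (1 / 2 * (1 / 2 + 1 / sqrt 3)) powr (1 / 4)" and "a2 \<equiv> (1 / 2 * (- 1 / 2 + 1 / sqrt 3)) powr (1 / 4)"
  shows "sqrt (r - 1) * a1 = K" "sqrt (r + 1) * a2 = K"
    "2 powr (5 / 4) * 3 powr (- 3 / 8) * K = 2 / r" (is ?g1)
    "2 powr (- 1 / 4) * 3 powr (- 3 / 8) * K = 1 / (sqrt 2 * r)" (is ?g2)
    "(1 + 1 * r) / (2 + 1 * r) = r - 1" "(1 + (- 1) * r) / (2 + (- 1) * r) = - 1 - r" (is ?g3)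
    "sqrt (r - 1) * sqrt (r + 1) = sqrt 2" "(sqrt (r - 1))\<^sup>2 = r - 1" "(sqrt (r + 1))\<^sup>2 = r + 1"
    "r > 0" "sqrt (r - 1) > 0" "sqrt (r + 1) > 0"
proof -
  note f = sqrt3_facts[folded r_def]
  show "r > 0" "sqrt (r - 1) > 0" "sqrt (r + 1) > 0" "(sqrt (r - 1))\<^sup>2 = r - 1" "(sqrt (r + 1))\<^sup>2 = r + 1"
    using f(2) by simp_all
  show "sqrt (r - 1) * a1 = K" "sqrt (r + 1) * a2 = K"
    unfolding a1_def a2_def K_def powr_quarter_K[symmetric] r_def by (rule sqrt3_products)+
  have "x * y * (z * w) = (x * z) * (y * w)" for x y z w :: real by simp
  then have "2 powr (5 / 4) * 3 powr (- 3 / 8) * K = 2 powr (5 / 4 + - 1 / 4) * 3 powr (- 3 / 8 + - 1 / 8)"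
    "2 powr (- 1 / 4) * 3 powr (- 3 / 8) * K = 2 powr (- 1 / 4 + - 1 / 4) * 3 powr (- 3 / 8 + - 1 / 8)"
    unfolding K_def powr_add by blast+
  then show ?g1 ?g2
    using powr_minus_half unfolding r_def by simp_all
  have nz: "2 + 1 * r \<noteq> 0" "2 + (- 1) * r \<noteq> 0" using f by simp_all
  have "1 + 1 * r = (r - 1) * (2 + 1 * r)" "1 + (- 1) * r = (- 1 - r) * (2 + (- 1) * r)"
    using f(1) by (simp_all add: algebra_simps)
  then show "(1 + 1 * r) / (2 + 1 * r) = r - 1" ?g3
    unfolding divide_eq_eq using nz by simp_all
  have "sqrt (r - 1) * sqrt (r + 1) = sqrt ((r - 1) * (r + 1))" by (rule real_sqrt_mult[symmetric])
  also have "(r - 1) * (r + 1) = 2" using f(1) by (simp add: algebra_simps)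
  finally show "sqrt (r - 1) * sqrt (r + 1) = sqrt 2" .
qed

lemma ferrers_base:
  "base_P (- 1 / 3) \<xi> = 2 powr (5 / 4) * 3 powr (- 3 / 8) / Gamma (4 / 3)
     * (- sqrt (sqrt 3 - 1) * base_H \<xi> + sqrt (sqrt 3 + 1) * base_H (- \<xi>))" (is ?g1)
  "base_P (1 / 3) \<xi> = 2 powr (- 1 / 4) * 3 powr (- 3 / 8) / Gamma (2 / 3)
     * (sqrt (sqrt 3 + 1) * base_H \<xi> + sqrt (sqrt 3 - 1) * base_H (- \<xi>))" (is ?g2)
proof -
  define r where "r = sqrt (3::real)"
  define s where "s = sqrt (r - 1)"
  define t where "t = sqrt (r + 1)"
  define K :: real where "K = 2 powr (- 1 / 4) * 3 powr (- 1 / 8)"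
  define a1 :: real where "a1 = (1 / 2 * (1 / 2 + 1 / sqrt 3)) powr (1 / 4)"
  define a2 :: real where "a2 = (1 / 2 * (- 1 / 2 + 1 / sqrt 3)) powr (1 / 4)"
  define \<alpha> :: real where "\<alpha> = 2 powr (5 / 4) * 3 powr (- 3 / 8)"
  define \<beta> :: real where "\<beta> = 2 powr (- 1 / 4) * 3 powr (- 3 / 8)"
  note const = base_constants[folded a1_def a2_def r_def K_def, folded s_def t_def, folded \<alpha>_def \<beta>_def]
  define b1 where "b1 = a1 * (1 / 4 * (2 / 3 * (r - 1)))"
  define b2 where "b2 = a2 * (1 / 4 * (2 / 3 * (- 1 - r)))"
  have asy: "asymp_at_top base_H base_H' a1 b1"
    "asymp_at_top (\<lambda>\<xi>. base_H (- \<xi>)) (\<lambda>\<xi>. - base_H' (- \<xi>)) a2 b2"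
  proof -
    have e: "2 / 3 * (1 + 1 * r) / (2 + 1 * r) = 2 / 3 * (r - 1)" "2 / 3 * (1 + (- 1) * r) / (2 + (- 1) * r) = 2 / 3 * (- 1 - r)"
      using const(5,6) by (metis times_divide_eq_right)+
    note b = asymp_base_H[folded a1_def a2_def r_def, unfolded e, folded b1_def b2_def]
    show "asymp_at_top base_H base_H' a1 b1"
      "asymp_at_top (\<lambda>\<xi>. base_H (- \<xi>)) (\<lambda>\<xi>. - base_H' (- \<xi>)) a2 b2"
      by (rule b(1), rule b(2))
  qed
  \<comment> \<open>The limit form of the Wronskian of the Ferrers functions with \<mu> = -1/3 and
    \<mu> = 1/3, which serve as the independent pair.\<close>
  have nz: "0 * 0 - 1 / Gamma (2 / 3) * (- 2 / 3 / Gamma (4 / 3)) \<noteq> (0::real)"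
  proof -
    have "Gamma (2 / 3 :: real) > 0" "Gamma (4 / 3 :: real) > 0" by (simp_all add: Gamma_real_pos)
    then have "Gamma (2 / 3 :: real) \<noteq> 0" "Gamma (4 / 3 :: real) \<noteq> 0" by linarith+
    then show ?thesis by simp
  qed
  note eqI = ferrers_system_eqI[OF _ _ ferrers_system_lincomb[OF ferrers_system_base_H ferrers_system_reflect[OF ferrers_system_base_H]]
      _ ferrers_system_base_P(2) asymp_base_P(2) ferrers_system_base_P(1) asymp_base_P(1) nz]
  show ?g1
  proof -
    define c where "c = \<alpha> / Gamma (4 / 3)"
    have "- (c * s) * a1 + c * t * a2 = c * (t * a2 - s * a1)" by (simp add: algebra_simps)
    \<comment> \<open>The parts growing like exp (\<xi> / 3) cancel, as they must: the Ferrers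
      function with \<mu> = -1/3 decays.\<close>
    then have 1: "- (c * s) * a1 + c * t * a2 = 0" unfolding const(1,2) by simp
    have "- (c * s) * b1 + c * t * b2 = c * (1 / 6) * ((t * a2) * (- 1 - r) - (s * a1) * (r - 1))"
      by (simp add: b1_def b2_def algebra_simps)
    also have "\<dots> = - 1 / 3 * (\<alpha> * K) * r / Gamma (4 / 3)"
      unfolding const(1,2) c_def by (simp add: algebra_simps)
    also have "\<dots> = - 2 / 3 / Gamma (4 / 3)" unfolding const(3) using const(10) by simp
    finally have 2: "- (c * s) * b1 + c * t * b2 = - 2 / 3 / Gamma (4 / 3)" .
    have "base_P (- 1 / 3) \<xi> = - (c * s) * base_H \<xi> + c * t * base_H (- \<xi>)"
      by (rule eqI[OF ferrers_system_base_P(2) asymp_base_P(2)])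
        (rule asymp_at_top_lincomb[OF asy, of "- (c * s)" "c * t", unfolded 1 2])
    also have "\<dots> = c * (- s * base_H \<xi> + t * base_H (- \<xi>))" by (simp add: algebra_simps)
    finally show ?thesis unfolding c_def \<alpha>_def s_def t_def r_def .
  qed
  show ?g2
  proof -
    define c where "c = \<beta> / Gamma (2 / 3)"
    have st: "s * t = sqrt 2" "s * s = r - 1" "t * t = r + 1" "s > 0" "t > 0"
      using const by (simp_all add: power2_eq_square)
    have aK: "a1 = K / s" "a2 = K / t" using const(1,2) st by (auto simp: eq_divide_eq mult.commute)
    have "c * t * a1 + c * s * a2 = c * K * ((t * t + s * s) / (s * t))"
      unfolding aK using st(4,5) by (simp add: field_simps)
    also have "(t * t + s * s) / (s * t) = sqrt 2 * r"
    proof -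
      have "2 * r = sqrt 2 * r * sqrt 2" by simp
      then show ?thesis unfolding st(1-3) by (simp add: divide_eq_eq)
    qed
    also have "c * K * (sqrt 2 * r) = (\<beta> * K) * (sqrt 2 * r) / Gamma (2 / 3)" by (simp add: c_def)
    also have "\<dots> = 1 / Gamma (2 / 3)" unfolding const(4) using const(10) by simp
    finally have 1: "c * t * a1 + c * s * a2 = 1 / Gamma (2 / 3)" .
    have rs: "r - 1 = s * s" "- 1 - r = - (t * t)" using st(2,3) by simp_all
    have "b1 = K * s / 6" "b2 = - (K * t / 6)"
      unfolding b1_def b2_def aK rs using st(4,5) by simp_all
    \<comment> \<open>Here the second coefficients cancel instead: \<open>t * b1\<close> and
      \<open>s * b2\<close> are K s t / 6 with opposite signs.\<close>
    then have "c * t * b1 + c * s * b2 = 0" by simp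
    then have 2: "c * t * b1 + c * s * b2 = 0" .
    have "base_P (1 / 3) \<xi> = c * t * base_H \<xi> + c * s * base_H (- \<xi>)"
      by (rule eqI[OF ferrers_system_base_P(1) asymp_base_P(1)])
        (rule asymp_at_top_lincomb[OF asy, of "c * t" "c * s", unfolded 1 2])
    also have "\<dots> = c * (t * base_H \<xi> + s * base_H (- \<xi>))" by (simp add: algebra_simps)
    finally show ?thesis unfolding c_def \<beta>_def s_def t_def r_def .
  qed
qed

section \<open>Induction over the lattice of parameters\<close>

text \<open>All linear factors that the lattice steps divide by are of this form, so no step
  degenerates.\<close>

lemma twelfths_nonzero:
  assumes "\<not> 12 dvd j"
  shows "real_of_int j / 12 + real_of_int k \<notin> \<int>" "real_of_int j / 12 + real_of_int k \<noteq> 0" (is ?g1)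
proof -
  show 1: "real_of_int j / 12 + real_of_int k \<notin> \<int>"
  proof
    assume "real_of_int j / 12 + real_of_int k \<in> \<int>"
    then obtain l where "real_of_int j / 12 + real_of_int k = of_int l" unfolding Ints_def by blast
    then have "real_of_int j = real_of_int (12 * (l - k))" by simp
    then have "j = 12 * (l - k)" by (simp only: of_int_eq_iff)
    then show False using assms by simp
  qed
  then show ?g1 by (metis Ints_0)
qed

lemma rising_plus1:
  assumes d: "d \<notin> \<int>"
  shows "rising d (k + 1) = rising d k * (d + of_int k)"
proof (cases "k \<ge> 0")
  case True
  then have "nat (k + 1) = Suc (nat k)" by simp
  then show ?thesis using True by (simp add: rising_def pochhammer_Suc)
next
  case False
  define j where "j = nat (- (k + 1))"
  have k: "k = - int j - 1" using False by (simp add: j_def)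
  have nk: "nat (- k) = Suc j" by (simp add: k)
  have p: "pochhammer (d - real (Suc j)) (Suc j) = (d + of_int k) * pochhammer (d - real j) j"
    by (simp add: pochhammer_rec k)
  have nz: "d + of_int k \<noteq> 0"
  proof
    assume "d + of_int k = 0"
    then have "d = of_int (- k)" by simp
    then show False using d by (metis Ints_of_int)
  qed
  have r: "rising d k = inverse ((d + of_int k) * pochhammer (d - real j) j)"
    using False unfolding rising_def nk p by simp
  \<comment> \<open>For j = 0 the index k + 1 is 0, where \<open>rising\<close> takes its other
    branch.\<close>
  have "rising d (k + 1) = inverse (pochhammer (d - real j) j)"
    by (cases "j = 0") (auto simp: rising_def k)
  then show ?thesis unfolding r using nz by simp
qed

lemma rising_minus1:
  assumes d: "d \<notin> \<int>"
  shows "rising d (k - 1) = rising d k / (d + of_int k - 1)"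
proof -
  have "d + of_int (k - 1) \<noteq> 0"
  proof
    assume "d + of_int (k - 1) = 0"
    then have "d = of_int (1 - k)" by simp
    then show False using d by (metis Ints_of_int)
  qed
  then show ?thesis using rising_plus1[OF d, of "k - 1"] by (simp add: eq_divide_eq algebra_simps)
qed

section \<open>The constants of the theorem under shifts of n and m\<close>

definition oct_const_minus :: "int \<Rightarrow> int \<Rightarrow> real" where
  "oct_const_minus n m = 2 powr (5 / 4 - 2 * of_int m - 3 * of_int n) * 3 powr (- 3 / 8)
     * rising (1 / 4) m * inverse (rising (13 / 12) (m + n)) * inverse (Gamma (4 / 3))"

definition oct_const_plus :: "int \<Rightarrow> int \<Rightarrow> real" where
  "oct_const_plus n m = (- 1) powi n * 2 powr (- 1 / 4 - 2 * of_int m - 3 * of_int n) * 3 powr (- 3 / 8)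
     * rising (1 / 4) m * inverse (rising (5 / 12) (m - n)) * inverse (Gamma (2 / 3))"

lemma rising_params_not_Int: "(1 / 4 :: real) \<notin> \<int>" "(13 / 12 :: real) \<notin> \<int>" "(5 / 12 :: real) \<notin> \<int>"
  using twelfths_nonzero(1)[of 3 0] twelfths_nonzero(1)[of 13 0] twelfths_nonzero(1)[of 5 0] by simp_all

lemma powr_2_shift:
  "(2::real) powr (a - 2 * of_int m - 3 * of_int (n + 1)) = 2 powr (a - 2 * of_int m - 3 * of_int n) / 8"
  "(2::real) powr (a - 2 * of_int m - 3 * of_int (n - 1)) = 2 powr (a - 2 * of_int m - 3 * of_int n) * 8"
  "(2::real) powr (a - 2 * of_int (m + 1) - 3 * of_int n) = 2 powr (a - 2 * of_int m - 3 * of_int n) / 4"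
  "(2::real) powr (a - 2 * of_int (m - 1) - 3 * of_int n) = 2 powr (a - 2 * of_int m - 3 * of_int n) * 4"
proof -
  let ?b = "a - 2 * of_int m - 3 * of_int n"
  have e: "a - 2 * of_int m - 3 * of_int (n + 1) = ?b - 3" "a - 2 * of_int m - 3 * of_int (n - 1) = ?b + 3"
    "a - 2 * of_int (m + 1) - 3 * of_int n = ?b - 2" "a - 2 * of_int (m - 1) - 3 * of_int n = ?b + 2"
    by simp_all
  show "(2::real) powr (a - 2 * of_int m - 3 * of_int (n + 1)) = 2 powr ?b / 8"
    "(2::real) powr (a - 2 * of_int m - 3 * of_int (n - 1)) = 2 powr ?b * 8"
    "(2::real) powr (a - 2 * of_int (m + 1) - 3 * of_int n) = 2 powr ?b / 4"
    "(2::real) powr (a - 2 * of_int (m - 1) - 3 * of_int n) = 2 powr ?b * 4"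
    unfolding e powr_add powr_diff by simp_all
qed

lemma powi_minus1_shift: "(- 1 :: real) powi (n + 1) = - ((- 1) powi n)" "(- 1 :: real) powi (n - 1) = - ((- 1) powi n)"
  by (simp_all add: power_int_add_1 power_int_diff)

lemma const_aux:
  fixes P T R S G s x y z :: real
  shows "P / 8 * T * R * inverse (S * x) * G = P * T * R * inverse S * G / (8 * x)"
    "- s * (P / 8) * T * R * inverse (S / - y) * G = s * P * T * R * inverse S * G * (y / 8)"
    "P * 8 * T * R * inverse (S / x) * G = P * T * R * inverse S * G * (8 * x)"
    "- s * (P * 8) * T * R * inverse (S * x) * G = - (s * P * T * R * inverse S * G) * 8 / x"
    "P / 4 * T * (R * z) * inverse (S * x) * G = P * T * R * inverse S * G * (z / 4) / x"
    "s * (P / 4) * T * (R * z) * inverse (S * x) * G = s * P * T * R * inverse S * G * (z / 4) / x"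
    "P * 4 * T * (R / - z) * inverse (S / x) * G = P * T * R * inverse S * G * (- 4) * x / z"
    "s * (P * 4) * T * (R / - z) * inverse (S / - y) * G = s * P * T * R * inverse S * G * 4 * y / z"
  by (simp_all only: divide_inverse inverse_mult_distrib inverse_minus_eq inverse_inverse_eq
      mult_minus_left mult_minus_right minus_minus mult.assoc mult.commute mult.left_commute)

text \<open>Raising n lowers the index m - n, which divides by 5/12 + m - n - 1 = - (7/12 + n - m);
  its sign is cancelled by that of \<open>(- 1) powi n\<close>.\<close>

lemma oct_const_n_plus1:
  "oct_const_minus (n + 1) m = oct_const_minus n m / (8 * (13 / 12 + of_int (m + n)))" (is ?g1)
  "oct_const_plus (n + 1) m = oct_const_plus n m * ((7 / 12 + of_int (n - m)) / 8)" (is ?g2)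
proof -
  have 1: "m + (n + 1) = m + n + 1" "m - (n + 1) = m - n - 1" by simp_all
  have "5 / 12 + of_int (m - n) - 1 = - (7 / 12 + real_of_int (n - m))" by simp
  note 2 = rising_minus1[OF rising_params_not_Int(3), of "m - n", unfolded this]
  show ?g1
    unfolding oct_const_minus_def powr_2_shift 1 rising_plus1[OF rising_params_not_Int(2)]
    by (rule const_aux(1))
  show ?g2
    unfolding oct_const_plus_def powr_2_shift 1 2 powi_minus1_shift
    by (rule const_aux(2))
qed

lemma oct_const_n_minus1:
  "oct_const_minus (n - 1) m = oct_const_minus n m * (8 * (1 / 12 + of_int (m + n)))" (is ?g1)
  "oct_const_plus (n - 1) m = - oct_const_plus n m * 8 / (5 / 12 + of_int (m - n))" (is ?g2)
proof -
  have 1: "m + (n - 1) = m + n - 1" "m - (n - 1) = m - n + 1" by simp_all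
  have "13 / 12 + of_int (m + n) - 1 = 1 / 12 + real_of_int (m + n)" by simp
  note 2 = rising_minus1[OF rising_params_not_Int(2), of "m + n", unfolded this]
  show ?g1
    unfolding oct_const_minus_def powr_2_shift 1 2
    by (rule const_aux(3))
  show ?g2
    unfolding oct_const_plus_def powr_2_shift 1 rising_plus1[OF rising_params_not_Int(3)] powi_minus1_shift
    by (rule const_aux(4))
qed

lemma oct_const_m_plus1:
  "oct_const_minus n (m + 1) = oct_const_minus n m * ((1 / 4 + of_int m) / 4) / (13 / 12 + of_int (m + n))" (is ?g1)
  "oct_const_plus n (m + 1) = oct_const_plus n m * ((1 / 4 + of_int m) / 4) / (5 / 12 + of_int (m - n))" (is ?g2)
proof -
  have 1: "m + 1 + n = m + n + 1" "m + 1 - n = m - n + 1" by simp_all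
  show ?g1 ?g2
    unfolding oct_const_minus_def oct_const_plus_def powr_2_shift 1 rising_params_not_Int[THEN rising_plus1]
    by (rule const_aux(5), rule const_aux(6))
qed

lemma oct_const_m_minus1:
  "oct_const_minus n (m - 1) = oct_const_minus n m * (- 4) * (1 / 12 + of_int (m + n)) / (3 / 4 - of_int m)" (is ?g1)
  "oct_const_plus n (m - 1) = oct_const_plus n m * 4 * (7 / 12 + of_int (n - m)) / (3 / 4 - of_int m)" (is ?g2)
proof -
  have 1: "m - 1 + n = m + n - 1" "m - 1 - n = m - n - 1" by simp_all
  have e: "13 / 12 + of_int (m + n) - 1 = 1 / 12 + real_of_int (m + n)"
    "5 / 12 + of_int (m - n) - 1 = - (7 / 12 + real_of_int (n - m))"
    "1 / 4 + real_of_int m - 1 = - (3 / 4 - of_int m)" by simp_all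
  note 2 = rising_minus1[OF rising_params_not_Int(2), of "m + n", unfolded e]
    rising_minus1[OF rising_params_not_Int(3), of "m - n", unfolded e]
    rising_minus1[OF rising_params_not_Int(1), of m, unfolded e]
  show ?g1 ?g2
    unfolding oct_const_minus_def oct_const_plus_def powr_2_shift 1 2
    by (rule const_aux(7), rule const_aux(8))
qed

section \<open>The invariant and its four steps\<close>

abbreviation (input) "oct_s \<equiv> sqrt (sqrt 3 - 1)"
abbreviation (input) "oct_t \<equiv> sqrt (sqrt 3 + 1)"

abbreviation (input) "P_minus n m \<xi> \<equiv> ferrers_P (- 3 / 4 - of_int m) (- 1 / 3 - of_int n) (tanh \<xi>)"
abbreviation (input) "P_plus n m \<xi> \<equiv> ferrers_P (- 3 / 4 - of_int m) (1 / 3 + of_int n) (tanh \<xi>)"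
abbreviation (input) "D_minus n m \<equiv> ferrers_D (- 3 / 4 - of_int m) (- 1 / 3 - of_int n)"
abbreviation (input) "D_plus n m \<equiv> ferrers_D (- 3 / 4 - of_int m) (1 / 3 + of_int n)"
abbreviation (input) "comb_minus n m H \<xi> \<equiv> - ((- 1) powi n) * oct_s * H \<xi> + (- 1) powi m * oct_t * H (- \<xi>)"
abbreviation (input) "comb_plus n m H \<xi> \<equiv> (- 1) powi n * oct_t * H \<xi> + (- 1) powi m * oct_s * H (- \<xi>)"

text \<open>The induction invariant. The same \<rho> has to obey the equation near 0 and both
  formulas on the whole line; the formulas alone would not tie it to \<open>oct_r\<close>, whose
  definition refers to 0 only.\<close>

definition oct_rep :: "int \<Rightarrow> int \<Rightarrow> (real \<Rightarrow> real) \<Rightarrow> bool" where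
  "oct_rep n m \<rho> \<longleftrightarrow> oct_rat \<rho> \<and> oct_hyp (of_int n) (of_int m) \<rho>
    \<and> (\<forall>\<xi>. P_minus n m \<xi> = oct_const_minus n m
        * (comb_minus n m (oct_H (of_int n) (of_int m) \<rho>) \<xi>))
    \<and> (\<forall>\<xi>. P_plus n m \<xi> = oct_const_plus n m
        * (comb_plus n m (oct_H (of_int n) (of_int m) \<rho>) \<xi>))"

text \<open>The operator on the left anticommutes with the reflection of \<xi>, hence the minus sign
  in front of q.\<close>

lemma ladder_lincomb:
  fixes f D H H' G :: "real \<Rightarrow> real"
  assumes f: "\<And>\<xi>. f \<xi> = A * (p * H \<xi> + q * H (- \<xi>))"
    and fD: "\<And>\<xi>. (f has_real_derivative D \<xi>) (at \<xi>)"
    and H: "\<And>\<xi>. (H has_real_derivative H' \<xi>) (at \<xi>)"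
    and ladder: "\<And>\<xi>. cosh \<xi> * H' \<xi> + k * sinh \<xi> * H \<xi> = K * G \<xi>"
  shows "cosh \<xi> * D \<xi> + k * sinh \<xi> * f \<xi> = A * K * (p * G \<xi> - q * G (- \<xi>))"
proof -
  have R: "((\<lambda>\<xi>. H (- \<xi>)) has_real_derivative H' (- \<xi>) * - 1) (at \<xi>)"
    by (rule DERIV_chain2[OF H]) (auto intro!: derivative_eq_intros)
  have "(f has_real_derivative A * (p * H' \<xi> + q * (H' (- \<xi>) * - 1))) (at \<xi>)"
    unfolding f[abs_def] by (intro DERIV_cmult DERIV_add H R)
  note D = DERIV_unique[OF fD this]
  have "cosh \<xi> * D \<xi> + k * sinh \<xi> * f \<xi>
      = A * (p * (cosh \<xi> * H' \<xi> + k * sinh \<xi> * H \<xi>) - q * (cosh (- \<xi>) * H' (- \<xi>) + k * sinh (- \<xi>) * H (- \<xi>)))"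
    unfolding D f by (simp add: algebra_simps)
  also have "\<dots> = A * K * (p * G \<xi> - q * G (- \<xi>))"
    unfolding ladder by (simp add: algebra_simps)
  finally show ?thesis .
qed

context
  fixes n m :: int and \<rho> \<rho>' :: "real \<Rightarrow> real"
  assumes rep: "oct_rep n m \<rho>"
    and rat': "oct_rat \<rho>'"
    and der: "\<And>u. poly oct_den u \<noteq> 0 \<Longrightarrow> (\<rho> has_real_derivative \<rho>' u) (at u)"
begin

lemma rep_facts:
  "oct_rat \<rho>" "oct_hyp (of_int n) (of_int m) \<rho>"
  "\<forall>\<^sub>F u in nhds 0. (\<rho> has_real_derivative \<rho>' u) (at u)" (is ?g1)
  "(oct_H (of_int n) (of_int m) \<rho> has_real_derivative oct_H_deriv (of_int n) (of_int m) \<rho> \<rho>' \<xi>) (at \<xi>)" (is ?g2)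
proof -
  show "oct_rat \<rho>" "oct_hyp (of_int n) (of_int m) \<rho>" using rep unfolding oct_rep_def by blast+
  show ?g1
    using eventually_oct_den by eventually_elim (rule der)
  show ?g2
    by (rule has_real_derivative_oct_H, rule der) (unfold poly_oct_den, rule oct_u_den)
qed

lemma oct_params_nonzero:
  "7 / 12 + real_of_int (n - m) \<noteq> 0" "1 / 12 + real_of_int (m + n) \<noteq> 0"
  "13 / 12 + real_of_int (m + n) \<noteq> 0" "5 / 12 + real_of_int (m - n) \<noteq> 0"
  "3 / 4 - real_of_int m \<noteq> 0" "1 / 4 + real_of_int m \<noteq> 0"
  "- 1 / 4 - real_of_int m \<notin> \<int>\<^sub>\<le>\<^sub>0"
  using twelfths_nonzero(2)[of 7 "n - m"] twelfths_nonzero(2)[of 1 "m + n"]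
    twelfths_nonzero(2)[of 13 "m + n"] twelfths_nonzero(2)[of 5 "m - n"]
    twelfths_nonzero(2)[of 9 "- m"] twelfths_nonzero(2)[of 3 m]
    three_quarters_minus_not_nonpos_Int[of "m + 1"]
  by simp_all

lemma ladder_minus:
  assumes "\<And>\<xi>. cosh \<xi> * oct_H_deriv (of_int n) (of_int m) \<rho> \<rho>' \<xi>
      + k * sinh \<xi> * oct_H (of_int n) (of_int m) \<rho> \<xi> = K * G \<xi>"
  shows "cosh \<xi> * D_minus n m \<xi>
      + k * sinh \<xi> * P_minus n m \<xi>
    = oct_const_minus n m * K * (- ((- 1) powi n) * oct_s * G \<xi> - (- 1) powi m * oct_t * G (- \<xi>))"
  by (rule ladder_lincomb[where f = "\<lambda>\<xi>. P_minus n m \<xi>",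
        OF _ has_real_derivative_ferrers_P_tanh[OF third_plus_not_Int(2)] rep_facts(4) assms])
    (use rep in \<open>unfold oct_rep_def, blast\<close>)

lemma ladder_plus:
  assumes "\<And>\<xi>. cosh \<xi> * oct_H_deriv (of_int n) (of_int m) \<rho> \<rho>' \<xi>
      + k * sinh \<xi> * oct_H (of_int n) (of_int m) \<rho> \<xi> = K * G \<xi>"
  shows "cosh \<xi> * D_plus n m \<xi>
      + k * sinh \<xi> * P_plus n m \<xi>
    = oct_const_plus n m * K * ((- 1) powi n * oct_t * G \<xi> - (- 1) powi m * oct_s * G (- \<xi>))"
  by (rule ladder_lincomb[where f = "\<lambda>\<xi>. P_plus n m \<xi>",
        OF _ has_real_derivative_ferrers_P_tanh[OF third_plus_not_Int(1)] rep_facts(4) assms])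
    (use rep in \<open>unfold oct_rep_def, blast\<close>)

text \<open>c is the factor from the Ferrers ladder, K the one from the \<open>oct_H\<close> ladder,
  and e the sign or cosh by which the combination changes. Only the scalar identity between the
  constants remains to be checked in each case.\<close>

lemma ladder_finish:
  fixes c F R A K Y e X A' :: real
  assumes "c * F = R" "R = A * K * Y" "Y = e * X" "c * A' = A * K * e" "c \<noteq> 0"
  shows "F = A' * X"
proof -
  have "c * F = c * A' * X" unfolding assms(1,2,3,4) by simp
  then show ?thesis using assms(5) by simp
qed

text \<open>The operator lowers \<mu> = -1/3 - n with the factor \<open>- x * y\<close> and raises
  \<mu> = 1/3 + n with the factor -1. So one factor y / 8 on the octahedral side yields different
  changes of the two constants.\<close>

lemma oct_rep_raise_n: "oct_rep (n + 1) m (oct_raise (7 / 24 + (of_int n - of_int m) / 2) (of_int n) (of_int m) \<rho> \<rho>')"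
proof -
  let ?k = "7 / 24 + (real_of_int n - real_of_int m) / 2"
  let ?r = "oct_raise ?k (of_int n) (of_int m) \<rho> \<rho>'"
  define H where "H = oct_H (of_int (n + 1)) (of_int m) ?r"
  define x y where "x = 13 / 12 + real_of_int (m + n)" and "y = 7 / 12 + real_of_int (n - m)"
  have xy: "x \<noteq> 0" "y \<noteq> 0" using oct_params_nonzero by (simp_all only: x_def y_def not_False_eq_True)
  have k: "?k = y / 2" by (simp add: y_def add_divide_distrib diff_divide_distrib)
  have nz: "?k \<noteq> 0" unfolding k using xy by simp
  have i: "real_of_int (n + 1) = of_int n + 1" by simp
  have rh: "oct_rat ?r" "oct_hyp (of_int (n + 1)) (of_int m) ?r"
    unfolding i by (rule oct_rat_oct_raise[OF rep_facts(1) rat'],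
        rule oct_hyp_raise_n[OF rep_facts(2,3) three_quarters_minus_not_nonpos_Int nz])
  have lad: "cosh \<xi> * oct_H_deriv (of_int n) (of_int m) \<rho> \<rho>' \<xi>
      + (1 / 3 + of_int n) * sinh \<xi> * oct_H (of_int n) (of_int m) \<rho> \<xi> = y / 2 / 4 * H \<xi>" for \<xi>
    using oct_H_raise_n[OF nz, of \<xi> \<rho> \<rho>'] unfolding H_def i k .
  have "P_minus (n + 1) m \<xi> = oct_const_minus (n + 1) m
        * (comb_minus (n + 1) m H \<xi>)" for \<xi>
  proof (rule ladder_finish[OF _ ladder_minus[OF lad]])
    have mu: "- 1 / 3 - real_of_int (n + 1) = - 1 / 3 - of_int n - 1" by simp
    have c: "- 3 / 4 - of_int m + (- 1 / 3 - of_int n) = - x" "- 3 / 4 - of_int m - (- 1 / 3 - of_int n) + 1 = y"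
      by (simp_all add: x_def y_def)
    show "- x * y * P_minus (n + 1) m \<xi>
        = cosh \<xi> * D_minus n m \<xi>
          + (1 / 3 + of_int n) * sinh \<xi> * P_minus n m \<xi>"
      using ferrers_mu_minus1[OF third_plus_not_Int(2), of "- 3 / 4 - of_int m" n \<xi>]
      unfolding mu c by (simp add: algebra_simps)
    \<comment> \<open>The operator flipped the sign of the reflected term, whereas a step in n flips
      the other one; the discrepancy is an overall -1.\<close>
    show "- ((- 1) powi n) * oct_s * H \<xi> - (- 1) powi m * oct_t * H (- \<xi>)
        = - 1 * (comb_minus (n + 1) m H \<xi>)"
      unfolding powi_minus1_shift by simp
    show "- x * y * oct_const_minus (n + 1) m = oct_const_minus n m * (y / 2 / 4) * - 1"
      unfolding oct_const_n_plus1 x_def[symmetric] using xy by simp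
    show "- x * y \<noteq> 0" using xy by simp
  qed
  moreover have "P_plus (n + 1) m \<xi> = oct_const_plus (n + 1) m
        * (comb_plus (n + 1) m H \<xi>)" for \<xi>
  proof (rule ladder_finish[OF _ ladder_plus[OF lad]])
    have mu: "1 / 3 + real_of_int (n + 1) = 1 / 3 + of_int n + 1" by simp
    show "- 1 * P_plus (n + 1) m \<xi>
        = cosh \<xi> * D_plus n m \<xi>
          + (1 / 3 + of_int n) * sinh \<xi> * P_plus n m \<xi>"
      unfolding mu ferrers_mu_plus1[OF third_plus_not_Int(1)] by simp
    show "(- 1) powi n * oct_t * H \<xi> - (- 1) powi m * oct_s * H (- \<xi>)
        = - 1 * (comb_plus (n + 1) m H \<xi>)"
      unfolding powi_minus1_shift by simp
    show "- 1 * oct_const_plus (n + 1) m = oct_const_plus n m * (y / 2 / 4) * - 1"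
      unfolding oct_const_n_plus1 y_def[symmetric] by simp
  qed simp
  ultimately show ?thesis using rh unfolding oct_rep_def H_def by blast
qed

lemma oct_rep_lower_n: "oct_rep (n - 1) m (oct_lower_n (of_int n) (of_int m) \<rho> \<rho>')"
proof -
  let ?r = "oct_lower_n (of_int n) (of_int m) \<rho> \<rho>'"
  define H where "H = oct_H (of_int (n - 1)) (of_int m) ?r"
  define v w where "v = 1 / 12 + real_of_int (m + n)" and "w = 5 / 12 + real_of_int (m - n)"
  have vw: "v \<noteq> 0" "w \<noteq> 0" using oct_params_nonzero by (simp_all only: v_def w_def not_False_eq_True)
  have k: "- 1 / 12 - real_of_int m - of_int n = - v" by (simp add: v_def)
  have nz: "- 1 / 12 - real_of_int m - of_int n \<noteq> 0" unfolding k using vw by simp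
  have i: "real_of_int (n - 1) = of_int n - 1" by simp
  have rh: "oct_rat ?r" "oct_hyp (of_int (n - 1)) (of_int m) ?r"
    unfolding i by (rule oct_rat_oct_lower_n[OF rep_facts(1) rat'],
        rule oct_hyp_lower_n[OF rep_facts(2,3) three_quarters_minus_not_nonpos_Int nz])
  have lad: "cosh \<xi> * oct_H_deriv (of_int n) (of_int m) \<rho> \<rho>' \<xi>
      + - (1 / 3 + of_int n) * sinh \<xi> * oct_H (of_int n) (of_int m) \<rho> \<xi> = - 8 * - v * H \<xi>" for \<xi>
    using oct_H_lower_n[OF nz, of \<xi> \<rho> \<rho>'] unfolding H_def i k .
  have "P_minus (n - 1) m \<xi> = oct_const_minus (n - 1) m
        * (comb_minus (n - 1) m H \<xi>)" for \<xi>
  proof (rule ladder_finish[OF _ ladder_minus[OF lad]])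
    have mu: "- 1 / 3 - real_of_int (n - 1) = - 1 / 3 - of_int n + 1" by simp
    show "- 1 * P_minus (n - 1) m \<xi>
        = cosh \<xi> * D_minus n m \<xi>
          + - (1 / 3 + of_int n) * sinh \<xi> * P_minus n m \<xi>"
      unfolding mu ferrers_mu_plus1[OF third_plus_not_Int(2)] by (simp add: algebra_simps)
    show "- ((- 1) powi n) * oct_s * H \<xi> - (- 1) powi m * oct_t * H (- \<xi>)
        = - 1 * (comb_minus (n - 1) m H \<xi>)"
      unfolding powi_minus1_shift by simp
    show "- 1 * oct_const_minus (n - 1) m = oct_const_minus n m * (- 8 * - v) * - 1"
      unfolding oct_const_n_minus1 v_def[symmetric] by simp
  qed simp
  moreover have "P_plus (n - 1) m \<xi> = oct_const_plus (n - 1) m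
        * (comb_plus (n - 1) m H \<xi>)" for \<xi>
  proof (rule ladder_finish[OF _ ladder_plus[OF lad]])
    have mu: "1 / 3 + real_of_int (n - 1) = 1 / 3 + of_int n - 1" by simp
    have c: "- 3 / 4 - of_int m + (1 / 3 + of_int n) = - w" "- 3 / 4 - of_int m - (1 / 3 + of_int n) + 1 = - v"
      by (simp_all add: v_def w_def)
    show "- w * - v * P_plus (n - 1) m \<xi>
        = cosh \<xi> * D_plus n m \<xi>
          + - (1 / 3 + of_int n) * sinh \<xi> * P_plus n m \<xi>"
      using ferrers_mu_minus1[OF third_plus_not_Int(1), of "- 3 / 4 - of_int m" n \<xi>]
      unfolding mu c mult_minus_left by (simp only: diff_conv_add_uminus)
    show "(- 1) powi n * oct_t * H \<xi> - (- 1) powi m * oct_s * H (- \<xi>)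
        = - 1 * (comb_plus (n - 1) m H \<xi>)"
      unfolding powi_minus1_shift by simp
    show "- w * - v * oct_const_plus (n - 1) m = oct_const_plus n m * (- 8 * - v) * - 1"
      unfolding oct_const_n_minus1 w_def[symmetric] using vw by simp
    show "- w * - v \<noteq> 0" using vw by simp
  qed
  ultimately show ?thesis using rh unfolding oct_rep_def H_def by blast
qed

lemma cosh_times_tanh: "cosh \<xi> * tanh \<xi> = sinh \<xi>" for \<xi> :: real
  by (simp add: tanh_def cosh_real_nonzero)

lemma oct_rep_raise_m: "oct_rep n (m + 1) (oct_raise (- 1 / 4 - of_int m) (of_int n) (of_int m) \<rho> \<rho>')"
proof -
  let ?r = "oct_raise (- 1 / 4 - of_int m) (of_int n) (of_int m) \<rho> \<rho>'"
  define H where "H = oct_H (of_int n) (of_int (m + 1)) ?r"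
  define x w z where "x = 13 / 12 + real_of_int (m + n)" and "w = 5 / 12 + real_of_int (m - n)"
    and "z = 1 / 4 + real_of_int m"
  have xw: "x \<noteq> 0" "w \<noteq> 0" "z \<noteq> 0" using oct_params_nonzero by (simp_all only: x_def w_def z_def not_False_eq_True)
  have k: "- 1 / 4 - real_of_int m = - z" by (simp add: z_def)
  have nz: "- 1 / 4 - real_of_int m \<noteq> 0" unfolding k using xw by simp
  have i: "real_of_int (m + 1) = of_int m + 1" by simp
  have rh: "oct_rat ?r" "oct_hyp (of_int n) (of_int (m + 1)) ?r"
    unfolding i by (rule oct_rat_oct_raise[OF rep_facts(1) rat'],
        rule oct_hyp_raise_m[OF rep_facts(2,3) three_quarters_minus_not_nonpos_Int oct_params_nonzero(7)])
  have lad: "cosh \<xi> * oct_H_deriv (of_int n) (of_int m) \<rho> \<rho>' \<xi>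
      + - (3 / 4 + of_int m) * sinh \<xi> * oct_H (of_int n) (of_int m) \<rho> \<xi> = - z / 4 * (cosh \<xi> * H \<xi>)" for \<xi>
    using oct_H_raise_m[OF nz, of \<xi> "of_int n" \<rho> \<rho>'] unfolding H_def i k .
  have mu: "- 3 / 4 - real_of_int (m + 1) = - 3 / 4 - of_int m - 1" by simp
  have nu: "- 3 / 4 - real_of_int m \<noteq> 0" using twelfths_nonzero(2)[of "- 9" "- m"] by simp
  have step: "cosh \<xi> * (\<mu> + (- 3 / 4 - of_int m)) * ferrers_P (- 3 / 4 - of_int (m + 1)) \<mu> (tanh \<xi>)
        = cosh \<xi> * ferrers_D (- 3 / 4 - of_int m) \<mu> \<xi>
          + - (3 / 4 + of_int m) * sinh \<xi> * ferrers_P (- 3 / 4 - of_int m) \<mu> (tanh \<xi>)"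
    if "\<mu> \<notin> \<int>" for \<mu> \<xi>
    unfolding mult.assoc[of "cosh \<xi>"] mu ferrers_nu_minus1[OF that nu]
    unfolding cosh_times_tanh[symmetric] by (simp add: algebra_simps)
  have "P_minus n (m + 1) \<xi> = oct_const_minus n (m + 1)
        * (comb_minus n (m + 1) H \<xi>)" for \<xi>
  proof (rule ladder_finish[OF step[OF third_plus_not_Int(2)] ladder_minus[OF lad]])
    have c: "- 1 / 3 - of_int n + (- 3 / 4 - of_int m) = - x" by (simp add: x_def)
    \<comment> \<open>A step in m flips the sign of the reflected term, exactly as the operator did.
      cosh is even and factors out.\<close>
    show "- ((- 1) powi n) * oct_s * (cosh \<xi> * H \<xi>) - (- 1) powi m * oct_t * (cosh (- \<xi>) * H (- \<xi>))
        = cosh \<xi> * (comb_minus n (m + 1) H \<xi>)"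
      unfolding powi_minus1_shift by (simp add: algebra_simps)
    show "cosh \<xi> * (- 1 / 3 - of_int n + (- 3 / 4 - of_int m)) * oct_const_minus n (m + 1)
        = oct_const_minus n m * (- z / 4) * cosh \<xi>"
      unfolding c oct_const_m_plus1 x_def[symmetric] z_def[symmetric] using xw by simp
    show "cosh \<xi> * (- 1 / 3 - of_int n + (- 3 / 4 - of_int m)) \<noteq> 0"
      unfolding c using xw by (simp add: cosh_real_nonzero)
  qed
  moreover have "P_plus n (m + 1) \<xi> = oct_const_plus n (m + 1)
        * (comb_plus n (m + 1) H \<xi>)" for \<xi>
  proof (rule ladder_finish[OF step[OF third_plus_not_Int(1)] ladder_plus[OF lad]])
    have c: "1 / 3 + of_int n + (- 3 / 4 - of_int m) = - w" by (simp add: w_def)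
    show "(- 1) powi n * oct_t * (cosh \<xi> * H \<xi>) - (- 1) powi m * oct_s * (cosh (- \<xi>) * H (- \<xi>))
        = cosh \<xi> * (comb_plus n (m + 1) H \<xi>)"
      unfolding powi_minus1_shift by (simp add: algebra_simps)
    show "cosh \<xi> * (1 / 3 + of_int n + (- 3 / 4 - of_int m)) * oct_const_plus n (m + 1)
        = oct_const_plus n m * (- z / 4) * cosh \<xi>"
      unfolding c oct_const_m_plus1 w_def[symmetric] z_def[symmetric] using xw by simp
    show "cosh \<xi> * (1 / 3 + of_int n + (- 3 / 4 - of_int m)) \<noteq> 0"
      unfolding c using xw by (simp add: cosh_real_nonzero)
  qed
  ultimately show ?thesis using rh unfolding oct_rep_def H_def by blast
qed

text \<open>Raising \<nu> has the factor - y in the first family and v in the second, up to cosh.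
  The factor 4 v y / g of the octahedral ladder contains both, and the quotients are the changes in
  \<open>oct_const_m_minus1\<close>.\<close>

lemma oct_rep_lower_m: "oct_rep n (m - 1) (oct_lower_m (of_int n) (of_int m) \<rho> \<rho>')"
proof -
  let ?r = "oct_lower_m (of_int n) (of_int m) \<rho> \<rho>'"
  define H where "H = oct_H (of_int n) (of_int (m - 1)) ?r"
  define v y g where "v = 1 / 12 + real_of_int (m + n)" and "y = 7 / 12 + real_of_int (n - m)"
    and "g = 3 / 4 - real_of_int m"
  have vy: "v \<noteq> 0" "y \<noteq> 0" "g \<noteq> 0" using oct_params_nonzero by (simp_all only: v_def y_def g_def not_False_eq_True)
  have k: "- 1 / 12 - real_of_int m - of_int n = - v" "7 / 24 + (real_of_int n - real_of_int m) / 2 = y / 2"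
    "- 1 / 24 - real_of_int m / 2 - real_of_int n / 2 = - v / 2"
    by (simp_all add: v_def y_def add_divide_distrib diff_divide_distrib)
  have nz: "- 1 / 12 - real_of_int m - of_int n \<noteq> 0" "7 / 24 + (real_of_int n - real_of_int m) / 2 \<noteq> 0"
    "(3 / 4 - real_of_int m) / ((- 1 / 24 - real_of_int m / 2 - real_of_int n / 2) * (7 / 24 + (real_of_int n - real_of_int m) / 2)) \<noteq> 0"
    unfolding k g_def[symmetric] using vy by simp_all
  have i: "real_of_int (m - 1) = of_int m - 1" by simp
  have rh: "oct_rat ?r" "oct_hyp (of_int n) (of_int (m - 1)) ?r"
    unfolding i by (rule oct_rat_oct_lower_m[OF rep_facts(1) rat'],
        rule oct_hyp_lower_m[OF rep_facts(2,3) three_quarters_minus_not_nonpos_Int nz(1,2)])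
  have K: "- 16 / (g / (- v / 2 * (y / 2))) = 4 * v * y / g" by simp
  have lad: "cosh \<xi> * oct_H_deriv (of_int n) (of_int m) \<rho> \<rho>' \<xi>
      + - (1 / 4 - of_int m) * sinh \<xi> * oct_H (of_int n) (of_int m) \<rho> \<xi> = 4 * v * y / g * (cosh \<xi> * H \<xi>)" for \<xi>
    using oct_H_lower_m[OF nz(3), of \<xi> \<rho> \<rho>'] unfolding H_def i k g_def[symmetric] K .
  have mu: "- 3 / 4 - real_of_int (m - 1) = - 3 / 4 - of_int m + 1" by simp
  have nu: "- 3 / 4 - real_of_int m \<noteq> - 1" using twelfths_nonzero(2)[of 3 "- m"] by simp
  have nu1: "- 3 / 4 - of_int m + 1 = 1 / 4 - real_of_int m" by simp
  have step: "cosh \<xi> * (\<mu> - (- 3 / 4 - of_int m) - 1) * ferrers_P (- 3 / 4 - of_int (m - 1)) \<mu> (tanh \<xi>)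
        = cosh \<xi> * ferrers_D (- 3 / 4 - of_int m) \<mu> \<xi>
          + - (1 / 4 - of_int m) * sinh \<xi> * ferrers_P (- 3 / 4 - of_int m) \<mu> (tanh \<xi>)"
    if "\<mu> \<notin> \<int>" for \<mu> \<xi>
    unfolding mult.assoc[of "cosh \<xi>"] mu ferrers_nu_plus1[OF that nu] unfolding nu1
    unfolding cosh_times_tanh[symmetric] by (simp add: algebra_simps)
  have "P_minus n (m - 1) \<xi> = oct_const_minus n (m - 1)
        * (comb_minus n (m - 1) H \<xi>)" for \<xi>
  proof (rule ladder_finish[OF step[OF third_plus_not_Int(2)] ladder_minus[OF lad]])
    have c: "- 1 / 3 - of_int n - (- 3 / 4 - of_int m) - 1 = - y" by (simp add: y_def)
    show "- ((- 1) powi n) * oct_s * (cosh \<xi> * H \<xi>) - (- 1) powi m * oct_t * (cosh (- \<xi>) * H (- \<xi>))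
        = cosh \<xi> * (comb_minus n (m - 1) H \<xi>)"
      unfolding powi_minus1_shift by (simp add: algebra_simps)
    show "cosh \<xi> * (- 1 / 3 - of_int n - (- 3 / 4 - of_int m) - 1) * oct_const_minus n (m - 1)
        = oct_const_minus n m * (4 * v * y / g) * cosh \<xi>"
      unfolding c oct_const_m_minus1 v_def[symmetric] g_def[symmetric] by simp
    show "cosh \<xi> * (- 1 / 3 - of_int n - (- 3 / 4 - of_int m) - 1) \<noteq> 0"
      unfolding c using vy by (simp add: cosh_real_nonzero)
  qed
  moreover have "P_plus n (m - 1) \<xi> = oct_const_plus n (m - 1)
        * (comb_plus n (m - 1) H \<xi>)" for \<xi>
  proof (rule ladder_finish[OF step[OF third_plus_not_Int(1)] ladder_plus[OF lad]])
    have c: "1 / 3 + of_int n - (- 3 / 4 - of_int m) - 1 = v" by (simp add: v_def)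
    show "(- 1) powi n * oct_t * (cosh \<xi> * H \<xi>) - (- 1) powi m * oct_s * (cosh (- \<xi>) * H (- \<xi>))
        = cosh \<xi> * (comb_plus n (m - 1) H \<xi>)"
      unfolding powi_minus1_shift by (simp add: algebra_simps)
    show "cosh \<xi> * (1 / 3 + of_int n - (- 3 / 4 - of_int m) - 1) * oct_const_plus n (m - 1)
        = oct_const_plus n m * (4 * v * y / g) * cosh \<xi>"
      unfolding c oct_const_m_minus1 y_def[symmetric] g_def[symmetric] by simp
    show "cosh \<xi> * (1 / 3 + of_int n - (- 3 / 4 - of_int m) - 1) \<noteq> 0"
      unfolding c using vy by (simp add: cosh_real_nonzero)
  qed
  ultimately show ?thesis using rh unfolding oct_rep_def H_def by blast
qed

end

lemma oct_rep_base: "oct_rep 0 0 (\<lambda>u. 1)"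
  unfolding oct_rep_def
proof (intro conjI allI)
  show "oct_rat (\<lambda>u. 1)" by (rule oct_rat_const)
  show "oct_hyp (of_int 0) (of_int 0) (\<lambda>u. 1)" using oct_hyp_base by simp
  fix \<xi> :: real
  have c: "oct_const_minus 0 0 = 2 powr (5 / 4) * 3 powr (- 3 / 8) / Gamma (4 / 3)"
    "oct_const_plus 0 0 = 2 powr (- 1 / 4) * 3 powr (- 3 / 8) / Gamma (2 / 3)"
    by (simp_all add: oct_const_minus_def oct_const_plus_def rising_def inverse_eq_divide)
  show "ferrers_P (- 3 / 4 - of_int 0) (- 1 / 3 - of_int 0) (tanh \<xi>) = oct_const_minus 0 0
        * (- ((- 1) powi 0) * oct_s * oct_H (of_int 0) (of_int 0) (\<lambda>u. 1) \<xi>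
           + (- 1) powi 0 * oct_t * oct_H (of_int 0) (of_int 0) (\<lambda>u. 1) (- \<xi>))"
    unfolding c of_int_0 diff_0_right add_0_right power_int_0_right mult_minus1 mult_1_left
    by (rule ferrers_base)
  show "ferrers_P (- 3 / 4 - of_int 0) (1 / 3 + of_int 0) (tanh \<xi>) = oct_const_plus 0 0
        * ((- 1) powi 0 * oct_t * oct_H (of_int 0) (of_int 0) (\<lambda>u. 1) \<xi>
           + (- 1) powi 0 * oct_s * oct_H (of_int 0) (of_int 0) (\<lambda>u. 1) (- \<xi>))"
    unfolding c of_int_0 diff_0_right add_0_right power_int_0_right mult_minus1 mult_1_left
    by (rule ferrers_base)
qed

lemma oct_rep_step:
  assumes "\<exists>\<rho>. oct_rep n m \<rho>"
  shows "\<exists>\<rho>. oct_rep (n + 1) m \<rho>" "\<exists>\<rho>. oct_rep (n - 1) m \<rho>" "\<exists>\<rho>. oct_rep n (m + 1) \<rho>" "\<exists>\<rho>. oct_rep n (m - 1) \<rho>"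
proof -
  obtain \<rho> where \<rho>: "oct_rep n m \<rho>" using assms by blast
  then have "oct_rat \<rho>" unfolding oct_rep_def by blast
  then obtain \<rho>' where \<rho>': "oct_rat \<rho>'" "\<And>u. poly oct_den u \<noteq> 0 \<Longrightarrow> (\<rho> has_real_derivative \<rho>' u) (at u)"
    using oct_rat_derivative by blast
  show "\<exists>\<rho>. oct_rep (n + 1) m \<rho>" "\<exists>\<rho>. oct_rep (n - 1) m \<rho>" "\<exists>\<rho>. oct_rep n (m + 1) \<rho>" "\<exists>\<rho>. oct_rep n (m - 1) \<rho>"
    by (rule exI, rule oct_rep_raise_n[OF \<rho> \<rho>'] oct_rep_lower_n[OF \<rho> \<rho>']
        oct_rep_raise_m[OF \<rho> \<rho>'] oct_rep_lower_m[OF \<rho> \<rho>'], assumption)+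
qed

lemma oct_rep_exists: "\<exists>\<rho>. oct_rep n m \<rho>"
proof (induction m rule: int_induct[where k = 0])
  case base
  show ?case
  proof (induction n rule: int_induct[where k = 0])
    case base
    show ?case by (rule exI, rule oct_rep_base)
  next
    case (step1 i)
    then show ?case by (intro oct_rep_step)
  next
    case (step2 i)
    then show ?case by (intro oct_rep_step)
  qed
next
  case (step1 i)
  then show ?case by (intro oct_rep_step)
next
  case (step2 i)
  then show ?case by (intro oct_rep_step)
qed

theorem theorem4p3:
  fixes n m :: int and \<xi> :: real
  shows "C_plus \<xi> > 0 \<and> C_minus \<xi> > 0
    \<and> ferrers_P (- 3 / 4 - of_int m) (- 1 / 3 - of_int n) (tanh \<xi>) =
      (2 powr (5 / 4 - 2 * of_int m - 3 * of_int n) * 3 powr (- 3 / 8)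
         * rising (1 / 4) m * inverse (rising (13 / 12) (m + n)) * inverse (Gamma (4 / 3)))
      * cosh \<xi> powr (1 / 4 - of_int m)
      * (- ((- 1) powi n) * sqrt (sqrt 3 - 1)
           * C_plus \<xi> powr (1 / 4 + 3 * of_int m + 3 * of_int n)
           * eval_ratfun (oct_r n m) (- C_minus \<xi> / C_plus \<xi>)
         + (- 1) powi m * sqrt (sqrt 3 + 1)
           * C_minus \<xi> powr (1 / 4 + 3 * of_int m + 3 * of_int n)
           * eval_ratfun (oct_r n m) (- C_plus \<xi> / C_minus \<xi>))
    \<and> ferrers_P (- 3 / 4 - of_int m) (1 / 3 + of_int n) (tanh \<xi>) =
      ((- 1) powi n * 2 powr (- 1 / 4 - 2 * of_int m - 3 * of_int n) * 3 powr (- 3 / 8)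
         * rising (1 / 4) m * inverse (rising (5 / 12) (m - n)) * inverse (Gamma (2 / 3)))
      * cosh \<xi> powr (1 / 4 - of_int m)
      * ((- 1) powi n * sqrt (sqrt 3 + 1)
           * C_plus \<xi> powr (1 / 4 + 3 * of_int m + 3 * of_int n)
           * eval_ratfun (oct_r n m) (- C_minus \<xi> / C_plus \<xi>)
         + (- 1) powi m * sqrt (sqrt 3 - 1)
           * C_minus \<xi> powr (1 / 4 + 3 * of_int m + 3 * of_int n)
           * eval_ratfun (oct_r n m) (- C_plus \<xi> / C_minus \<xi>))"
  proof -
  obtain \<rho> where \<rho>: "oct_rep n m \<rho>" using oct_rep_exists by blast
  have den: "poly oct_den (oct_u \<xi>) \<noteq> 0" for \<xi> unfolding poly_oct_den by (rule oct_u_den)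
  \<comment> \<open>Valid on the whole line: \<open>oct_u\<close> never meets a pole, so the default
    value 0 of \<open>eval_ratfun\<close> at poles does not intervene.\<close>
  have r: "eval_ratfun (oct_r n m) (oct_u \<xi>) = \<rho> (oct_u \<xi>)" for \<xi>
    using \<rho> eval_ratfun_oct_r[OF _ _ den] unfolding oct_rep_def by blast
  have u: "- C_minus \<xi> / C_plus \<xi> = oct_u \<xi>" "- C_plus \<xi> / C_minus \<xi> = oct_u (- \<xi>)"
    by (simp_all add: oct_u_def)
  have H: "oct_H (of_int n) (of_int m) \<rho> \<xi>
      = cosh \<xi> powr (1 / 4 - of_int m) * C_plus \<xi> powr (1 / 4 + 3 * of_int m + 3 * of_int n) * \<rho> (oct_u \<xi>)"
    "oct_H (of_int n) (of_int m) \<rho> (- \<xi>)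
      = cosh \<xi> powr (1 / 4 - of_int m) * C_minus \<xi> powr (1 / 4 + 3 * of_int m + 3 * of_int n) * \<rho> (oct_u (- \<xi>))"
    by (simp_all add: oct_H_def)
  have aux: "k * (p * (c * a * x) + q * (c * b * y)) = k * c * (p * a * x + q * b * y)"
    for k p c a x q b y :: real
    by (simp only: distrib_left ac_simps)
  have M: "ferrers_P (- 3 / 4 - of_int m) (- 1 / 3 - of_int n) (tanh \<xi>) = oct_const_minus n m
        * (- ((- 1) powi n) * oct_s * oct_H (of_int n) (of_int m) \<rho> \<xi>
           + (- 1) powi m * oct_t * oct_H (of_int n) (of_int m) \<rho> (- \<xi>))"
    and P: "ferrers_P (- 3 / 4 - of_int m) (1 / 3 + of_int n) (tanh \<xi>) = oct_const_plus n m
        * ((- 1) powi n * oct_t * oct_H (of_int n) (of_int m) \<rho> \<xi>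
           + (- 1) powi m * oct_s * oct_H (of_int n) (of_int m) \<rho> (- \<xi>))"
    using \<rho> unfolding oct_rep_def by blast+
  show ?thesis
    unfolding u r
    using C_plus_pos[of \<xi>] C_minus_pos[of \<xi>] M[unfolded H aux oct_const_minus_def] P[unfolded H aux oct_const_plus_def]
    by (intro conjI)
qed

end
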